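(* Let $G$ be a finite nilpotent group of class $2$. Then, as $\mathbb{Q}[G^{ab}]$-algebras, $$\mathbb{Q}(\widetilde G)/J\ \cong\ \bigoplus_{H\leq G}\mathbb{Q}[H^{ab}],$$ where the sum runs over all subgroups $H$ of $G$ and $J$ is the Jacobson radical of $\mathbb{Q}(\widetilde G)$.
   Context: $K$ is an algebraically closed field of characteristic $0$; $G^{ab}=G/[G,G]$. A glider of length at most $1$ of $G$ (for $K\subset K[G]$) is a $K[G]$-module $\Omega$ with finite-dimensional $K$-subspaces $M_{-1}\subseteq M_0\subseteq\Omega$ with $K[G]M_{-1}\subseteq M_0$; it has length $0$ if $M_{-1}=0$ and length $1$ otherwise. A morphism to $(N_{-1}\subseteq N_0)$ is a $K$-linear $f:M_0\to N_0$ with $f(M_{-1})\subseteq N_{-1}$ and $f(xm)=xf(m)$ for $x\in K[G]$, $m\in M_{-1}$. Direct sums and tensor products (diagonal $G$-action) are formed levelwise. A glider of length $1$ is irreducible iff $\dim M_{-1}=1$ and $M_0=K[G]M_{-1}$. $\overline{R}_1(\widetilde G)$ is the subring generated by the classes of irreducible gliders of length $1$ in the quotient of the split Grothendieck ring of gliders of length $\le 1$ by the ideal additively generated by gliders of length $0$. In it $[Ku\subset U]\cdot[Kv\subset V]=[K(u\otimes v)\subset K[G](u\otimes v)]$. Put $\mathbb{Q}(\widetilde G)=\mathbb{Q}\otimes_{\mathbb Z}\overline R_1(\widetilde G)$. For every group fix an isomorphism $z\mapsto T_z$ from its abelianization to the group of its one-dimensional $K$-representations. $z\in G^{ab}$ acts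 on $\mathbb{Q}(\widetilde G)$ by multiplication by the class of the glider $(T_z\subseteq T_z)$, and on $\mathbb{Q}[H^{ab}]$ by multiplication by the element of $H^{ab}$ corresponding to the restriction of $T_z$ to $H$ (diagonally on the direct sum). *)

theory Defs
  imports
    "HOL-Algebra.Algebra"
    "HOL-Algebra.Algebraic_Closure_Type"
    "HOL-Library.Poly_Mapping"
begin

section \<open>Group theory\<close>

text \<open>
  \<open>lower_central G n\<close> is the \<open>n\<close>-fold iterated commutator \<open>[...[[G,G],G]...,G]\<close>,
  so \<open>n = 0\<close> gives \<open>G\<close> and \<open>n = 1\<close> gives \<open>[G,G]\<close>.
\<close>
primrec lower_central :: "('g, 'm) monoid_scheme \<Rightarrow> nat \<Rightarrow> 'g set" where
  "lower_central G 0 = carrier G"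
| "lower_central G (Suc n) = generate G
     {a \<otimes>\<^bsub>G\<^esub> b \<otimes>\<^bsub>G\<^esub> inv\<^bsub>G\<^esub> a \<otimes>\<^bsub>G\<^esub> inv\<^bsub>G\<^esub> b | a b. a \<in> lower_central G n \<and> b \<in> carrier G}"

definition nilpotent_of_class :: "('g, 'm) monoid_scheme \<Rightarrow> nat \<Rightarrow> bool" where
  "nilpotent_of_class G c \<longleftrightarrow>
     lower_central G c = {\<one>\<^bsub>G\<^esub>} \<and> (\<forall>n<c. lower_central G n \<noteq> {\<one>\<^bsub>G\<^esub>})"

definition abelianization :: "('g, 'm) monoid_scheme \<Rightarrow> 'g set monoid" where
  "abelianization G = G Mod derived G (carrier G)"

definition mult_group_of_field :: "'k::field monoid" where
  "mult_group_of_field = \<lparr>carrier = UNIV - {0}, monoid.mult = (*), one = 1\<rparr>"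

text \<open>
  The group of one-dimensional representations under tensor product. A one-dimensional
  representation is given, up to isomorphism, by the scalars through which the group acts.
\<close>
definition linear_characters :: "('g, 'm) monoid_scheme \<Rightarrow> ('g \<Rightarrow> 'k::field) monoid" where
  "linear_characters G =
     \<lparr>carrier = hom G mult_group_of_field \<inter> extensional (carrier G),
      monoid.mult = (\<lambda>\<chi> \<psi>. \<lambda>g\<in>carrier G. \<chi> g * \<psi> g),
      one = (\<lambda>g\<in>carrier G. 1)\<rparr>"


section \<open>Ring constructions\<close>

definition monoid_algebra :: "('a, 'm) monoid_scheme \<Rightarrow> ('a \<Rightarrow>\<^sub>0 'r::comm_ring_1) ring" where
  "monoid_algebra M =
     \<lparr>carrier = {x. Poly_Mapping.keys x \<subseteq> carrier M},
      monoid.mult = (\<lambda>x y. \<Sum>a\<in>Poly_Mapping.keys x. \<Sum>b\<in>Poly_Mapping.keys y.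
         Poly_Mapping.single (a \<otimes>\<^bsub>M\<^esub> b) (Poly_Mapping.lookup x a * Poly_Mapping.lookup y b)),
      one = Poly_Mapping.single \<one>\<^bsub>M\<^esub> 1,
      ring.zero = 0,
      ring.add = (+)\<rparr>"

abbreviation additive_span :: "('a, 'm) ring_scheme \<Rightarrow> 'a set \<Rightarrow> 'a set" where
  "additive_span R S \<equiv> generate (add_monoid R) S"

text \<open>
  \<open>tensor_ring R S\<close> is \<open>R \<otimes>\<^sub>\<int> S\<close>: the free abelian group on the symbols \<open>r \<otimes> s\<close>, which
  multiply componentwise, modulo biadditivity. The set of relations is stable under
  multiplication by symbols, so its additive span is an ideal.
\<close>
definition tensor_relations ::
    "('a, 'm) ring_scheme \<Rightarrow> ('b, 'n) ring_scheme \<Rightarrow> ('a \<times> 'b \<Rightarrow>\<^sub>0 int) set" where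
  "tensor_relations R S =
     {Poly_Mapping.single (r \<oplus>\<^bsub>R\<^esub> r', s) 1 - Poly_Mapping.single (r, s) 1
        - Poly_Mapping.single (r', s) 1 | r r' s.
        r \<in> carrier R \<and> r' \<in> carrier R \<and> s \<in> carrier S} \<union>
     {Poly_Mapping.single (r, s \<oplus>\<^bsub>S\<^esub> s') 1 - Poly_Mapping.single (r, s) 1
        - Poly_Mapping.single (r, s') 1 | r s s'.
        r \<in> carrier R \<and> s \<in> carrier S \<and> s' \<in> carrier S}"

definition tensor_ideal ::
    "('a, 'm) ring_scheme \<Rightarrow> ('b, 'n) ring_scheme \<Rightarrow> ('a \<times> 'b \<Rightarrow>\<^sub>0 int) set" where
  "tensor_ideal R S = additive_span (monoid_algebra (R \<times>\<times> S)) (tensor_relations R S)"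

definition tensor_ring ::
    "('a, 'm) ring_scheme \<Rightarrow> ('b, 'n) ring_scheme \<Rightarrow> ('a \<times> 'b \<Rightarrow>\<^sub>0 int) set ring" where
  "tensor_ring R S = monoid_algebra (R \<times>\<times> S) Quot tensor_ideal R S"

definition pure_tensor ::
    "('a, 'm) ring_scheme \<Rightarrow> ('b, 'n) ring_scheme \<Rightarrow> 'a \<Rightarrow> 'b \<Rightarrow> ('a \<times> 'b \<Rightarrow>\<^sub>0 int) set" where
  "pure_tensor R S r s =
     tensor_ideal R S +>\<^bsub>monoid_algebra (R \<times>\<times> S)\<^esub> Poly_Mapping.single (r, s) 1"

text \<open>For commutative rings only: two-sided maximal ideals are used.\<close>
definition jacobson_radical :: "('a, 'm) ring_scheme \<Rightarrow> 'a set" where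
  "jacobson_radical R = carrier R \<inter> \<Inter> {I. maximalideal I R}"

text \<open>For a finite index set this is the direct sum.\<close>
definition product_ring :: "'i set \<Rightarrow> ('i \<Rightarrow> ('a, 'm) ring_scheme) \<Rightarrow> ('i \<Rightarrow> 'a) ring" where
  "product_ring I R =
     \<lparr>carrier = (\<Pi>\<^sub>E i\<in>I. carrier (R i)),
      monoid.mult = (\<lambda>x y. \<lambda>i\<in>I. x i \<otimes>\<^bsub>R i\<^esub> y i),
      one = (\<lambda>i\<in>I. \<one>\<^bsub>R i\<^esub>),
      ring.zero = (\<lambda>i\<in>I. \<zero>\<^bsub>R i\<^esub>),
      ring.add = (\<lambda>x y. \<lambda>i\<in>I. x i \<oplus>\<^bsub>R i\<^esub> y i)\<rparr>"

definition algebra_along :: "('r \<Rightarrow> 'a) \<Rightarrow> ('a, 'm) ring_scheme \<Rightarrow> ('r, 'a) module" where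
  "algebra_along \<eta> A =
     \<lparr>carrier = carrier A, monoid.mult = monoid.mult A, one = \<one>\<^bsub>A\<^esub>,
      ring.zero = \<zero>\<^bsub>A\<^esub>, ring.add = ring.add A,
      module.smult = (\<lambda>r a. \<eta> r \<otimes>\<^bsub>A\<^esub> a)\<rparr>"

definition algebra_iso ::
    "('r, 'l) ring_scheme \<Rightarrow> ('r, 'a, 'm) module_scheme \<Rightarrow> ('r, 'b, 'n) module_scheme \<Rightarrow> ('a \<Rightarrow> 'b) set"
  where
  "algebra_iso R A B =
     {\<phi> \<in> ring_iso A B. \<forall>r\<in>carrier R. \<forall>a\<in>carrier A. \<phi> (r \<odot>\<^bsub>A\<^esub> a) = r \<odot>\<^bsub>B\<^esub> \<phi> a}"


section \<open>Gliders of length at most one\<close>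

text \<open>\<open>'i \<Rightarrow>\<^sub>0 'k\<close> is the \<open>'k\<close>-vector space with basis \<open>'i\<close>.\<close>

definition vscale :: "'k::field \<Rightarrow> ('i \<Rightarrow>\<^sub>0 'k) \<Rightarrow> ('i \<Rightarrow>\<^sub>0 'k)" where
  "vscale c v = Poly_Mapping.map (\<lambda>a. c * a) v"

lemma lookup_vscale [simp]: "Poly_Mapping.lookup (vscale c v) i = c * Poly_Mapping.lookup v i"
  by (auto simp: vscale_def Poly_Mapping.map.rep_eq when_def)

global_interpretation fvs: vector_space "vscale :: 'k::field \<Rightarrow> ('i \<Rightarrow>\<^sub>0 'k) \<Rightarrow> ('i \<Rightarrow>\<^sub>0 'k)"
  by unfold_locales (auto intro!: poly_mapping_eqI simp: lookup_add algebra_simps)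

definition finite_dim_subspace :: "('i \<Rightarrow>\<^sub>0 'k::field) set \<Rightarrow> bool" where
  "finite_dim_subspace S \<longleftrightarrow> fvs.subspace S \<and> (\<exists>B. finite B \<and> fvs.span B = S)"

text \<open>
  The ambient module \<open>\<Omega>\<close> is a whole space \<open>'v = 'i \<Rightarrow>\<^sub>0 'k\<close> (any vector space, once a basis
  is chosen), on which the group acts through \<open>act\<close>; \<open>lev0\<close> is the level in degree \<open>0\<close> and
  \<open>lev1\<close> the level in degree \<open>-1\<close>.
\<close>
record ('g, 'v) glider =
  act :: "'g \<Rightarrow> 'v \<Rightarrow> 'v"
  lev0 :: "'v set"
  lev1 :: "'v set"

definition algebra_act ::
    "('g, 'i \<Rightarrow>\<^sub>0 'k::field) glider \<Rightarrow> ('g \<Rightarrow>\<^sub>0 'k) \<Rightarrow> ('i \<Rightarrow>\<^sub>0 'k) \<Rightarrow> ('i \<Rightarrow>\<^sub>0 'k)" where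
  "algebra_act M x m = (\<Sum>g\<in>Poly_Mapping.keys x. vscale (Poly_Mapping.lookup x g) (act M g m))"

definition is_glider :: "('g, 'm) monoid_scheme \<Rightarrow> ('g, 'i \<Rightarrow>\<^sub>0 'k::field) glider \<Rightarrow> bool" where
  "is_glider G M \<longleftrightarrow>
     (\<forall>g\<in>carrier G. Vector_Spaces.linear vscale vscale (act M g)) \<and>
     (\<forall>v. act M \<one>\<^bsub>G\<^esub> v = v) \<and>
     (\<forall>g\<in>carrier G. \<forall>h\<in>carrier G. \<forall>v. act M (g \<otimes>\<^bsub>G\<^esub> h) v = act M g (act M h v)) \<and>
     finite_dim_subspace (lev0 M) \<and> finite_dim_subspace (lev1 M) \<and> lev1 M \<subseteq> lev0 M \<and>
     (\<forall>x\<in>carrier (monoid_algebra G). \<forall>m\<in>lev1 M. algebra_act M x m \<in> lev0 M)"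

definition glider_length :: "('g, 'i \<Rightarrow>\<^sub>0 'k::field) glider \<Rightarrow> nat" where
  "glider_length M = (if lev1 M = {0} then 0 else 1)"

definition glider_hom ::
    "('g, 'm) monoid_scheme \<Rightarrow> ('g, 'i \<Rightarrow>\<^sub>0 'k::field) glider \<Rightarrow> ('g, 'j \<Rightarrow>\<^sub>0 'k) glider \<Rightarrow>
     (('i \<Rightarrow>\<^sub>0 'k) \<Rightarrow> ('j \<Rightarrow>\<^sub>0 'k)) set" where
  "glider_hom G M N =
     {f. f \<in> lev0 M \<rightarrow> lev0 N \<and>
         (\<forall>u\<in>lev0 M. \<forall>v\<in>lev0 M. f (u + v) = f u + f v) \<and>
         (\<forall>c. \<forall>u\<in>lev0 M. f (vscale c u) = vscale c (f u)) \<and>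
         f \<in> lev1 M \<rightarrow> lev1 N \<and>
         (\<forall>x\<in>carrier (monoid_algebra G). \<forall>m\<in>lev1 M.
            f (algebra_act M x m) = algebra_act N x (f m))}"

definition glider_isomorphic ::
    "('g, 'm) monoid_scheme \<Rightarrow> ('g, 'i \<Rightarrow>\<^sub>0 'k::field) glider \<Rightarrow> ('g, 'j \<Rightarrow>\<^sub>0 'k) glider \<Rightarrow> bool" where
  "glider_isomorphic G M N \<longleftrightarrow>
     (\<exists>f\<in>glider_hom G M N. \<exists>h\<in>glider_hom G N M.
        (\<forall>u\<in>lev0 M. h (f u) = u) \<and> (\<forall>v\<in>lev0 N. f (h v) = v))"

definition push_vec :: "('i \<Rightarrow> 'j) \<Rightarrow> ('i \<Rightarrow>\<^sub>0 'k::field) \<Rightarrow> ('j \<Rightarrow>\<^sub>0 'k)" where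
  "push_vec f v = (\<Sum>i\<in>Poly_Mapping.keys v. Poly_Mapping.single (f i) (Poly_Mapping.lookup v i))"

definition glider_sum ::
    "('g, 'i \<Rightarrow>\<^sub>0 'k::field) glider \<Rightarrow> ('g, 'j \<Rightarrow>\<^sub>0 'k) glider \<Rightarrow> ('g, 'i + 'j \<Rightarrow>\<^sub>0 'k) glider" where
  "glider_sum M N =
     \<lparr>act = (\<lambda>g w. push_vec Inl (act M g (Poly_Mapping.map_key Inl w)) +
                   push_vec Inr (act N g (Poly_Mapping.map_key Inr w))),
      lev0 = {push_vec Inl u + push_vec Inr v | u v. u \<in> lev0 M \<and> v \<in> lev0 N},
      lev1 = {push_vec Inl u + push_vec Inr v | u v. u \<in> lev1 M \<and> v \<in> lev1 N}\<rparr>"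

definition tensor_vec :: "('i \<Rightarrow>\<^sub>0 'k::field) \<Rightarrow> ('j \<Rightarrow>\<^sub>0 'k) \<Rightarrow> ('i \<times> 'j \<Rightarrow>\<^sub>0 'k)" where
  "tensor_vec u v = (\<Sum>i\<in>Poly_Mapping.keys u. \<Sum>j\<in>Poly_Mapping.keys v.
     Poly_Mapping.single (i, j) (Poly_Mapping.lookup u i * Poly_Mapping.lookup v j))"

text \<open>The action below is the linear extension of \<open>e\<^sub>i \<otimes> e\<^sub>j \<mapsto> g e\<^sub>i \<otimes> g e\<^sub>j\<close>.\<close>
definition glider_tensor ::
    "('g, 'i \<Rightarrow>\<^sub>0 'k::field) glider \<Rightarrow> ('g, 'j \<Rightarrow>\<^sub>0 'k) glider \<Rightarrow> ('g, 'i \<times> 'j \<Rightarrow>\<^sub>0 'k) glider" where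
  "glider_tensor M N =
     \<lparr>act = (\<lambda>g w. \<Sum>(i, j)\<in>Poly_Mapping.keys w. vscale (Poly_Mapping.lookup w (i, j))
               (tensor_vec (act M g (Poly_Mapping.single i 1)) (act N g (Poly_Mapping.single j 1)))),
      lev0 = fvs.span {tensor_vec u v | u v. u \<in> lev0 M \<and> v \<in> lev0 N},
      lev1 = fvs.span {tensor_vec u v | u v. u \<in> lev1 M \<and> v \<in> lev1 N}\<rparr>"

definition irreducible_length_one ::
    "('g, 'm) monoid_scheme \<Rightarrow> ('g, 'i \<Rightarrow>\<^sub>0 'k::field) glider \<Rightarrow> bool" where
  "irreducible_length_one G M \<longleftrightarrow>
     is_glider G M \<and> glider_length M = 1 \<and> fvs.dim (lev1 M) = 1 \<and>
     lev0 M = fvs.span {algebra_act M x m | x m. x \<in> carrier (monoid_algebra G) \<and> m \<in> lev1 M}"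

text \<open>
  The glider \<open>T \<subseteq> T\<close> for a one-dimensional representation \<open>T\<close>, realised on a line inside
  an isotypic module.
\<close>
definition character_glider :: "('g \<Rightarrow> 'k::field) \<Rightarrow> ('g, nat \<Rightarrow>\<^sub>0 'k) glider" where
  "character_glider \<chi> =
     \<lparr>act = (\<lambda>g. vscale (\<chi> g)),
      lev0 = fvs.span {Poly_Mapping.single 0 1},
      lev1 = fvs.span {Poly_Mapping.single 0 1}\<rparr>"


section \<open>The ring of irreducible gliders\<close>

text \<open>
  Isomorphism classes are formed inside the space of countable dimension. Isomorphism of
  gliders depends on the ambient module only through the action on \<open>lev1\<close>, and for a finite
  group \<open>lev0\<close> generates a finite-dimensional submodule, which can be complemented by a trivial
  module of countable dimension; so every isomorphism class of gliders is met. In particular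
  the product in \<open>iso_class_monoid\<close>, a union of equal sets, is again an isomorphism class.
\<close>
type_synonym ('g, 'k) glider_class = "('g, nat \<Rightarrow>\<^sub>0 'k) glider set"
type_synonym ('g, 'k) split_class = "(('g, 'k) glider_class \<Rightarrow>\<^sub>0 int) set"

definition iso_class ::
    "('g, 'm) monoid_scheme \<Rightarrow> ('g, 'i \<Rightarrow>\<^sub>0 'k::field) glider \<Rightarrow> ('g, 'k) glider_class" where
  "iso_class G M = {N. is_glider G N \<and> glider_isomorphic G M N}"

definition iso_class_monoid ::
    "('g, 'm) monoid_scheme \<Rightarrow> ('g, 'k::field) glider_class monoid" where
  "iso_class_monoid G =
     \<lparr>carrier = iso_class G ` {M :: ('g, nat \<Rightarrow>\<^sub>0 'k) glider. is_glider G M},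
      monoid.mult = (\<lambda>A B. \<Union>M\<in>A. \<Union>N\<in>B. iso_class G (glider_tensor M N)),
      one = iso_class G (character_glider (\<lambda>_. 1))\<rparr>"

definition iso_class_ring ::
    "('g, 'm) monoid_scheme \<Rightarrow> (('g, 'k::field) glider_class \<Rightarrow>\<^sub>0 int) ring" where
  "iso_class_ring G = monoid_algebra (iso_class_monoid G)"

definition split_ideal ::
    "('g, 'm) monoid_scheme \<Rightarrow> (('g, 'k::field) glider_class \<Rightarrow>\<^sub>0 int) set" where
  "split_ideal G = additive_span (iso_class_ring G)
     {Poly_Mapping.single (iso_class G (glider_sum M N)) 1
        - Poly_Mapping.single (iso_class G M) 1 - Poly_Mapping.single (iso_class G N) 1
      | (M :: ('g, nat \<Rightarrow>\<^sub>0 'k) glider) (N :: ('g, nat \<Rightarrow>\<^sub>0 'k) glider). is_glider G M \<and> is_glider G N}"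

definition split_grothendieck_ring ::
    "('g, 'm) monoid_scheme \<Rightarrow> ('g, 'k::field) split_class ring" where
  "split_grothendieck_ring G = iso_class_ring G Quot split_ideal G"

definition split_class ::
    "('g, 'm) monoid_scheme \<Rightarrow> ('g, 'i \<Rightarrow>\<^sub>0 'k::field) glider \<Rightarrow> ('g, 'k) split_class" where
  "split_class G M = split_ideal G +>\<^bsub>iso_class_ring G\<^esub> Poly_Mapping.single (iso_class G M) 1"

definition length_zero_ideal ::
    "('g, 'm) monoid_scheme \<Rightarrow> ('g, 'k::field) split_class set" where
  "length_zero_ideal G = additive_span (split_grothendieck_ring G)
     {split_class G M | M :: ('g, nat \<Rightarrow>\<^sub>0 'k) glider. is_glider G M \<and> glider_length M = 0}"

definition reduced_ring ::
    "('g, 'm) monoid_scheme \<Rightarrow> ('g, 'k::field) split_class set ring" where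
  "reduced_ring G = split_grothendieck_ring G Quot length_zero_ideal G"

definition reduced_class ::
    "('g, 'm) monoid_scheme \<Rightarrow> ('g, 'i \<Rightarrow>\<^sub>0 'k::field) glider \<Rightarrow> ('g, 'k) split_class set" where
  "reduced_class G M = length_zero_ideal G +>\<^bsub>split_grothendieck_ring G\<^esub> split_class G M"

definition irreducible_ring ::
    "('g, 'm) monoid_scheme \<Rightarrow> ('g, 'k::field) split_class set ring" where
  "irreducible_ring G = (reduced_ring G)
     \<lparr>carrier := generate_ring (reduced_ring G)
        {reduced_class G M | M :: ('g, nat \<Rightarrow>\<^sub>0 'k) glider. irreducible_length_one G M}\<rparr>"

definition rational_glider_ring ::
    "('g, 'm) monoid_scheme \<Rightarrow> (rat \<times> ('g, 'k::field) split_class set \<Rightarrow>\<^sub>0 int) set ring" where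
  "rational_glider_ring G = tensor_ring ring_of_type_algebra (irreducible_ring G)"


section \<open>Algebra structures over the rational group algebra of the abelianization\<close>

text \<open>
  \<open>T H\<close> is the chosen isomorphism from the abelianization of the subgroup \<open>H\<close> to its group
  of one-dimensional representations. Both algebra structures are given by the image of the
  group algebra, i.e. by the \<open>\<rat>\<close>-linear extension of the element by which \<open>z\<close> acts.
\<close>

definition glider_structure_map ::
    "('g, 'm) monoid_scheme \<Rightarrow> ('g set \<Rightarrow> 'g set \<Rightarrow> 'g \<Rightarrow> 'k::field) \<Rightarrow> ('g set \<Rightarrow>\<^sub>0 rat) \<Rightarrow>
     (rat \<times> ('g, 'k) split_class set \<Rightarrow>\<^sub>0 int) set" where
  "glider_structure_map G T x =
     (\<Oplus>\<^bsub>rational_glider_ring G\<^esub> z\<in>Poly_Mapping.keys x.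
        pure_tensor ring_of_type_algebra (irreducible_ring G) (Poly_Mapping.lookup x z)
          (reduced_class G (character_glider (T (carrier G) z))))"

definition glider_algebra_mod_radical ::
    "('g, 'm) monoid_scheme \<Rightarrow> ('g set \<Rightarrow> 'g set \<Rightarrow> 'g \<Rightarrow> 'k::field) \<Rightarrow>
     ('g set \<Rightarrow>\<^sub>0 rat, (rat \<times> ('g, 'k) split_class set \<Rightarrow>\<^sub>0 int) set set) module" where
  "glider_algebra_mod_radical G T =
     (let A = rational_glider_ring G; J = jacobson_radical A
      in algebra_along (\<lambda>x. J +>\<^bsub>A\<^esub> glider_structure_map G T x) (A Quot J))"

definition restricted_element ::
    "('g, 'm) monoid_scheme \<Rightarrow> ('g set \<Rightarrow> 'g set \<Rightarrow> 'g \<Rightarrow> 'k::field) \<Rightarrow> 'g set \<Rightarrow> 'g set \<Rightarrow> 'g set"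
  where
  "restricted_element G T H z =
     inv_into (carrier (abelianization (G\<lparr>carrier := H\<rparr>))) (T H) (restrict (T (carrier G) z) H)"

definition subgroup_algebra_sum ::
    "('g, 'm) monoid_scheme \<Rightarrow> ('g set \<Rightarrow> 'g set \<Rightarrow> 'g \<Rightarrow> 'k::field) \<Rightarrow>
     ('g set \<Rightarrow>\<^sub>0 rat, 'g set \<Rightarrow> ('g set \<Rightarrow>\<^sub>0 rat)) module" where
  "subgroup_algebra_sum G T =
     algebra_along
       (\<lambda>x. \<lambda>H\<in>{H. subgroup H G}. \<Sum>z\<in>Poly_Mapping.keys x.
          Poly_Mapping.single (restricted_element G T H z) (Poly_Mapping.lookup x z))
       (product_ring {H. subgroup H G} (\<lambda>H. monoid_algebra (abelianization (G\<lparr>carrier := H\<rparr>))))"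

end

theory Submission
  imports Defs
begin

text \<open>
  An irreducible glider of length one is a line \<open>K u\<close> together with the module \<open>K[G] u\<close> that it
  generates. Let \<open>H\<close> be the stabilizer of the line and \<open>\<chi>\<close> the character through which \<open>H\<close> acts on
  it. Comparing coordinates shows that \<open>u \<otimes> v\<close> has stabilizer \<open>H\<^sub>u \<inter> H\<^sub>v\<close> and character
  \<open>\<chi>\<^sub>u \<chi>\<^sub>v\<close> (\<open>line_stab_ntensor\<close>). So the pairs \<open>(H, \<chi>)\<close>, the types, form a finite commutative
  monoid, and the class of a glider is mapped to its type. The theorem says that, rationally, the
  kernel of this map is the radical and that the algebra of the monoid of types is the sum of the
  group algebras of the character groups.

  The coefficients of the map are additive invariants of all gliders: \<open>eigendim H \<chi> M\<close> is
  the dimension of the space of vectors in the lower level on which \<open>H\<close> acts through \<open>\<chi>\<close>. It is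
  additive, vanishes on gliders of length zero, and equals \<open>1\<close> or \<open>0\<close> on an irreducible glider,
  according to whether its type restricts to \<open>(H, \<chi>)\<close>. For fixed \<open>H\<close> these numbers are the
  coefficients of an element of \<open>\<rat>[H\<^sup>a\<^sup>b]\<close>, and all of them together give the homomorphism
  \<open>char_hom\<close>. As every type occurs (\<open>induced_glider_exists\<close>), the matrix of the homomorphism with
  respect to one representative for each type is unitriangular for the order by restriction. Hence
  \<open>char_hom\<close> is onto, and the combinations of the representatives meet its kernel in \<open>0\<close>.

  The kernel lies in the radical. Two gliders of the same type have isomorphic high tensor
  powers, up to gliders of length zero: for \<open>n \<ge> |G|\<close> the vectors \<open>(g u)\<^sup>\<otimes>\<^sup>n\<close> that belong to
  different cosets of \<open>H\<close> are linearly independent, so the annihilator of \<open>u\<^sup>\<otimes>\<^sup>n\<close> depends on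
  \<open>H\<close> and \<open>\<chi>\<^sup>n\<close> only (\<open>tensor_power_annihilator\<close>). If \<open>a\<^sup>n = b\<^sup>n\<close> for all large \<open>n\<close>, then \<open>a - b\<close> lies
  in every prime ideal, hence in every maximal one. Modulo a maximal ideal an element is therefore
  a combination of the representatives, and for an element of the kernel this combination is \<open>0\<close>.

  The radical lies in the kernel. For \<open>h \<in> H\<close> the values \<open>\<chi>(h)\<close> turn the \<open>H\<close>-component of
  \<open>char_hom\<close> into a ring homomorphism to \<open>K\<close> whose image has finite dimension over \<open>\<rat>\<close>. The image
  is then a field, so the kernel of this evaluation is a maximal ideal. By the independence of
  characters, the evaluations at all \<open>h \<in> H\<close> determine the \<open>H\<close>-component.
\<close>

section \<open>Linear maps in coordinates\<close>

abbreviation lookup :: "('i \<Rightarrow>\<^sub>0 'c::zero) \<Rightarrow> 'i \<Rightarrow> 'c" where "lookup \<equiv> Poly_Mapping.lookup"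
abbreviation keys :: "('i \<Rightarrow>\<^sub>0 'c::zero) \<Rightarrow> 'i set" where "keys \<equiv> Poly_Mapping.keys"
abbreviation single :: "'i \<Rightarrow> 'c \<Rightarrow> ('i \<Rightarrow>\<^sub>0 'c::zero)" where "single \<equiv> Poly_Mapping.single"

abbreviation lin :: "(('i \<Rightarrow>\<^sub>0 'k::field) \<Rightarrow> ('j \<Rightarrow>\<^sub>0 'k)) \<Rightarrow> bool" where
  "lin f \<equiv> Vector_Spaces.linear vscale vscale f"

global_interpretation fvs_pair: vector_space_pair
  "vscale :: 'k::field \<Rightarrow> ('i \<Rightarrow>\<^sub>0 'k) \<Rightarrow> ('i \<Rightarrow>\<^sub>0 'k)"
  "vscale :: 'k::field \<Rightarrow> ('j \<Rightarrow>\<^sub>0 'k) \<Rightarrow> ('j \<Rightarrow>\<^sub>0 'k)"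
  by unfold_locales

lemma lin_iff: "lin f \<longleftrightarrow> (\<forall>x y. f (x + y) = f x + f y) \<and> (\<forall>c x. f (vscale c x) = vscale c (f x))"
  by (simp add: Vector_Spaces.linear_iff fvs.vector_space_axioms)

lemmas lin_add = fvs_pair.linear_add and lin_scale = fvs_pair.linear_scale and lin_zero = fvs_pair.linear_0
  and lin_sum = fvs_pair.linear_sum and lin_diff = fvs_pair.linear_diff

lemma lin_compose: "lin f \<Longrightarrow> lin g \<Longrightarrow> lin (\<lambda>x. f (g x))"
  by (simp add: lin_iff)

lemma lin_plus: "lin f \<Longrightarrow> lin g \<Longrightarrow> lin (\<lambda>x. f x + g x)"
  by (simp add: lin_iff fvs.scale_right_distrib)

lemma lin_minus: "lin f \<Longrightarrow> lin g \<Longrightarrow> lin (\<lambda>x. f x - g x)"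
  by (simp add: lin_iff fvs.scale_right_diff_distrib)

lemma lin_id [simp]: "lin (\<lambda>x. x)"
  by (simp add: lin_iff)

lemma lin_span_subset:
  assumes "lin f" "\<And>x. x \<in> S \<Longrightarrow> f x \<in> V" "fvs.subspace V" "x \<in> fvs.span S"
  shows "f x \<in> V"
proof -
  have "fvs.subspace {x. f x \<in> V}"
    using fvs_pair.linear_subspace_linear_preimage[OF assms(1,3)] .
  then have "fvs.span S \<subseteq> {x. f x \<in> V}"
    using assms(2) by (intro fvs.span_minimal) auto
  then show ?thesis using assms(4) by auto
qed

lemma lin_eq_span:
  assumes "lin f" "lin g" "\<And>x. x \<in> S \<Longrightarrow> f x = g x" "x \<in> fvs.span S"
  shows "f x = g x"
  using fvs_pair.linear_eq_on[OF assms(1,2,4)] assms(3) by blast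

lemma sum_singles: "finite A \<Longrightarrow> keys v \<subseteq> A \<Longrightarrow> (\<Sum>i\<in>A. single i (lookup v i)) = v"
  by (rule poly_mapping_eqI) (auto simp: lookup_sum lookup_single when_def in_keys_iff)

lemma span_singles: "v \<in> fvs.span (range (\<lambda>i. single i (1::'k::field)))"
proof -
  have "single i (lookup v i) = vscale (lookup v i) (single i 1)" for i
    by (rule poly_mapping_eqI) (auto simp: lookup_single when_def)
  then have "v = (\<Sum>i\<in>keys v. vscale (lookup v i) (single i 1))"
    using sum_singles[of "keys v" v] by simp
  also have "\<dots> \<in> fvs.span (range (\<lambda>i. single i 1))"
    by (intro fvs.span_sum fvs.span_scale fvs.span_base) auto
  finally show ?thesis .
qed

lemma lin_eqI:
  assumes "lin f" "lin g" "\<And>i. f (single i 1) = g (single i 1)"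
  shows "f v = g v"
  using lin_eq_span[OF assms(1,2) _ span_singles[of v]] assms(3) by blast

definition linear_ext :: "('i \<Rightarrow> ('j \<Rightarrow>\<^sub>0 'k::field)) \<Rightarrow> ('i \<Rightarrow>\<^sub>0 'k) \<Rightarrow> ('j \<Rightarrow>\<^sub>0 'k)" where
  "linear_ext \<phi> w = (\<Sum>i\<in>keys w. vscale (lookup w i) (\<phi> i))"

lemma linear_ext_superset:
  "finite A \<Longrightarrow> keys w \<subseteq> A \<Longrightarrow> linear_ext \<phi> w = (\<Sum>i\<in>A. vscale (lookup w i) (\<phi> i))"
  unfolding linear_ext_def by (intro sum.mono_neutral_left) (auto simp: in_keys_iff)

lemma lin_linear_ext [simp]: "lin (linear_ext \<phi>)"
  unfolding lin_iff
proof safe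
  fix x y :: "'b \<Rightarrow>\<^sub>0 'a" and c
  have "finite (keys x \<union> keys y)" "keys (x + y) \<subseteq> keys x \<union> keys y"
    by (auto dest: subsetD[OF keys_add])
  then show "linear_ext \<phi> (x + y) = linear_ext \<phi> x + linear_ext \<phi> y"
    by (simp add: linear_ext_superset[of "keys x \<union> keys y"] lookup_add fvs.scale_left_distrib sum.distrib)
  have "keys (vscale c x) \<subseteq> keys x" by (auto simp: in_keys_iff)
  then show "linear_ext \<phi> (vscale c x) = vscale c (linear_ext \<phi> x)"
    by (simp add: linear_ext_superset[of "keys x"] fvs.scale_sum_right)
qed

lemma linear_ext_single [simp]: "linear_ext \<phi> (single i c) = vscale c (\<phi> i)"
  by (cases "c = 0") (simp_all add: linear_ext_def)

lemma push_vec_linear_ext: "(push_vec f :: ('i \<Rightarrow>\<^sub>0 'k::field) \<Rightarrow> _) = linear_ext (\<lambda>i. single (f i) 1)"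
proof -
  have "single (f i) c = vscale c (single (f i) (1::'k::field))" for i :: 'i and c
    by (rule poly_mapping_eqI) (auto simp: lookup_single when_def)
  then show ?thesis by (intro ext, unfold push_vec_def linear_ext_def) (rule sum.cong[OF refl])
qed

lemma lin_push [simp]: "lin (push_vec f)"
  by (simp add: push_vec_linear_ext)

lemma push_single [simp]: "push_vec f (single i c) = single (f i) c"
  by (simp add: push_vec_linear_ext) (rule poly_mapping_eqI, auto simp: lookup_single when_def)

lemma push_push: "push_vec f (push_vec g v) = push_vec (\<lambda>i. f (g i)) v"
  by (rule lin_eqI[of "\<lambda>v. push_vec f (push_vec g v)"]) (auto intro: lin_compose)

lemma push_id [simp]: "push_vec (\<lambda>i. i) v = v"
  by (rule lin_eqI[of "push_vec (\<lambda>i. i)"]) auto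

lemma lookup_push_inj: "inj f \<Longrightarrow> lookup (push_vec f v) (f i) = lookup v i"
  by (auto simp: push_vec_def lookup_sum lookup_single when_def inj_eq in_keys_iff)

lemma lookup_push_notin: "j \<notin> range f \<Longrightarrow> lookup (push_vec f v) j = 0"
  by (auto simp: push_vec_def lookup_sum lookup_single when_def intro!: sum.neutral)

lemma lookup_tensor [simp]: "lookup (tensor_vec u v) (i, j) = lookup u i * lookup v j"
proof -
  have "lookup (tensor_vec u v) (i, j) =
    (\<Sum>a\<in>keys u. \<Sum>b\<in>keys v. (if a = i \<and> b = j then lookup u a * lookup v b else 0))"
    unfolding tensor_vec_def lookup_sum lookup_single when_def by (intro sum.cong) auto
  also have "\<dots> = (\<Sum>a\<in>keys u. if a = i then (\<Sum>b\<in>keys v. (if b = j then lookup u a * lookup v b else 0)) else 0)"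
    by (intro sum.cong) (auto intro!: sum.neutral)
  also have "\<dots> = lookup u i * lookup v j"
    by (auto simp: sum.delta in_keys_iff)
  finally show ?thesis .
qed

lemma lin_tensor_left [simp]: "lin (\<lambda>u. tensor_vec u v)"
  unfolding lin_iff by (safe; rule poly_mapping_eqI) (auto simp: lookup_add algebra_simps)

lemma lin_tensor_right [simp]: "lin (tensor_vec u)"
  unfolding lin_iff by (safe; rule poly_mapping_eqI) (auto simp: lookup_add algebra_simps)

lemma tensor_singles [simp]: "tensor_vec (single i a) (single j b) = single (i, j) (a * b)"
proof (rule poly_mapping_eqI)
  fix s
  show "lookup (tensor_vec (single i a) (single j b)) s = lookup (single (i, j) (a * b)) s"
    by (cases s) (simp add: lookup_single when_def)
qed

lemma tensor_scale: "tensor_vec (vscale a u) (vscale b v) = vscale (a * b) (tensor_vec u v)"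
  by (simp add: lin_scale[OF lin_tensor_left] lin_scale[OF lin_tensor_right])

lemma tensor_eq_0: "tensor_vec u v = 0 \<longleftrightarrow> u = 0 \<or> v = 0"
proof -
  have "lookup u i \<noteq> 0 \<Longrightarrow> lookup v j \<noteq> 0 \<Longrightarrow> tensor_vec u v \<noteq> 0" for i j
    by (metis lookup_tensor lookup_zero mult_eq_0_iff)
  then have "tensor_vec u v = 0 \<Longrightarrow> u = 0 \<or> v = 0"
    by (metis lookup_zero poly_mapping_eqI)
  then show ?thesis by (auto simp: tensor_vec_def)
qed

lemma lin_eq_tensorI:
  assumes "lin f" "lin g" "\<And>u v. f (tensor_vec u v) = g (tensor_vec u v)"
  shows "f w = g w"
proof (rule lin_eqI[OF assms(1,2)])
  fix i
  show "f (single i 1) = g (single i 1)"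
    using assms(3)[of "single (fst i) 1" "single (snd i) 1"] by simp
qed

definition tensor_map where
  "tensor_map f f' = linear_ext (\<lambda>(i, j). tensor_vec (f (single i 1)) (f' (single j 1)))"

lemma lin_tensor_map [simp]: "lin (tensor_map f f')"
  by (simp add: tensor_map_def)

lemma tensor_map_tensor:
  assumes "lin f" "lin f'"
  shows "tensor_map f f' (tensor_vec u v) = tensor_vec (f u) (f' v)"
proof -
  have lin_l: "lin (\<lambda>u. tensor_map f f' (tensor_vec u v))" "lin (\<lambda>u. tensor_vec (f u) (f' v))" for v
    using lin_compose[OF lin_tensor_map lin_tensor_left] lin_compose[OF lin_tensor_left assms(1)] by blast+
  have lin_r: "lin (\<lambda>v. tensor_map f f' (tensor_vec u v))" "lin (\<lambda>v. tensor_vec (f u) (f' v))" for u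
    using lin_compose[OF lin_tensor_map lin_tensor_right] lin_compose[OF lin_tensor_right assms(2)] by blast+
  have "tensor_map f f' (tensor_vec (single i 1) (single j 1)) = tensor_vec (f (single i 1)) (f' (single j 1))" for i j
    by (simp add: tensor_map_def)
  then have "tensor_map f f' (tensor_vec (single i 1) v) = tensor_vec (f (single i 1)) (f' v)" for i
    by (rule lin_eqI[OF lin_r])
  then show ?thesis
    by (rule lin_eqI[OF lin_l])
qed

lemma lin_map_key: "inj f \<Longrightarrow> lin (Poly_Mapping.map_key f)"
  unfolding lin_iff by (safe; rule poly_mapping_eqI) (auto simp: lookup_add map_key.rep_eq)

lemma map_key_push: "inj f \<Longrightarrow> Poly_Mapping.map_key f (push_vec f v) = v"
  by (rule poly_mapping_eqI) (auto simp: map_key.rep_eq lookup_push_inj)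

lemma map_key_push_disjoint:
  "inj f \<Longrightarrow> range f \<inter> range g = {} \<Longrightarrow> Poly_Mapping.map_key f (push_vec g v) = 0"
  by (rule poly_mapping_eqI) (auto simp: map_key.rep_eq intro!: lookup_push_notin)

lemma lookup_map_key: "inj f \<Longrightarrow> lookup (Poly_Mapping.map_key f v) i = lookup v (f i)"
  by (simp add: map_key.rep_eq)

lemma push_sum_decomp:
  "push_vec Inl (Poly_Mapping.map_key Inl w) + push_vec Inr (Poly_Mapping.map_key Inr w) = w"
proof (rule poly_mapping_eqI)
  fix s
  show "lookup (push_vec Inl (Poly_Mapping.map_key Inl w) + push_vec Inr (Poly_Mapping.map_key Inr w)) s = lookup w s"
    by (cases s) (auto simp: lookup_add lookup_push_inj lookup_push_notin image_iff lookup_map_key inj_on_def)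
qed

lemma map_key_sum_simps [simp]:
  "Poly_Mapping.map_key Inl (push_vec Inl u + push_vec Inr v) = u"
  "Poly_Mapping.map_key Inr (push_vec Inl u + push_vec Inr v) = v"
  by (auto simp: lin_add[OF lin_map_key] map_key_push intro!: map_key_push_disjoint)

lemma finite_dim_image:
  assumes "lin f" "finite_dim_subspace S" shows "finite_dim_subspace (f ` S)"
proof -
  obtain B where B: "finite B" "fvs.span B = S" using assms by (auto simp: finite_dim_subspace_def)
  have "fvs.subspace (f ` S)"
    using assms by (intro fvs_pair.linear_subspace_image) (auto simp: finite_dim_subspace_def)
  moreover have "fvs.span (f ` B) = f ` S"
    using fvs_pair.linear_span_image[OF assms(1), of B] B(2) by simp
  ultimately show ?thesis unfolding finite_dim_subspace_def using B(1) by blast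
qed

lemma finite_dim_span: "finite B \<Longrightarrow> finite_dim_subspace (fvs.span B)"
  by (auto simp: finite_dim_subspace_def)

lemma finite_dim_zero [simp]: "finite_dim_subspace {0}"
  using finite_dim_span[of "{}"] by simp

lemma tensor_span:
  assumes "u \<in> fvs.span B" "v \<in> fvs.span C" "fvs.subspace V"
    "\<And>b c. b \<in> B \<Longrightarrow> c \<in> C \<Longrightarrow> tensor_vec b c \<in> V"
  shows "tensor_vec u v \<in> V"
proof (rule lin_span_subset[OF lin_tensor_left _ assms(3,1)])
  fix b assume "b \<in> B"
  show "tensor_vec b v \<in> V"
    by (rule lin_span_subset[OF lin_tensor_right _ assms(3,2)]) (use assms(4) \<open>b \<in> B\<close> in auto)
qed

lemma finite_dim_tensor:
  assumes "finite_dim_subspace S" "finite_dim_subspace S'"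
  shows "finite_dim_subspace (fvs.span {tensor_vec u v | u v. u \<in> S \<and> v \<in> S'})"
proof -
  obtain B B' where B: "finite B" "S = fvs.span B" "finite B'" "S' = fvs.span B'"
    using assms unfolding finite_dim_subspace_def by blast
  let ?X = "(\<lambda>(u, v). tensor_vec u v) ` (B \<times> B')"
  have "fvs.span {tensor_vec u v | u v. u \<in> S \<and> v \<in> S'} = fvs.span ?X"
  proof (rule antisym)
    have "tensor_vec u v \<in> fvs.span ?X" if "u \<in> S" "v \<in> S'" for u v
      using that unfolding B(2,4) by (rule tensor_span) (auto intro!: fvs.span_base)
    then show "fvs.span {tensor_vec u v | u v. u \<in> S \<and> v \<in> S'} \<subseteq> fvs.span ?X"
      by (intro fvs.span_minimal) auto
    have "?X \<subseteq> {tensor_vec u v | u v. u \<in> S \<and> v \<in> S'}"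
      unfolding B(2,4) using fvs.span_base by (clarsimp, blast)
    then show "fvs.span ?X \<subseteq> fvs.span {tensor_vec u v | u v. u \<in> S \<and> v \<in> S'}"
      by (rule fvs.span_mono)
  qed
  then show ?thesis using B finite_dim_span[of ?X] by simp
qed

text \<open>
  The morphisms of gliders are linear on a level only; this extends them to the ambient space.
\<close>
lemma lin_on_extend:
  assumes "fvs.subspace S" "\<And>u v. u \<in> S \<Longrightarrow> v \<in> S \<Longrightarrow> f (u + v) = f u + f v"
    "\<And>c u. u \<in> S \<Longrightarrow> f (vscale c u) = vscale c (f u)"
  obtains F where "lin F" "\<And>u. u \<in> S \<Longrightarrow> F u = f u"
proof -
  obtain B where B: "B \<subseteq> S" "fvs.independent B" "S \<subseteq> fvs.span B"
    using fvs.maximal_independent_subset by blast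
  obtain F where F: "lin F" "\<forall>x\<in>B. F x = f x"
    using fvs_pair.linear_independent_extend[OF B(2)] by blast
  have f0: "f 0 = 0" using assms(3)[of 0 0] fvs.subspace_0[OF assms(1)] by simp
  have "u \<in> S \<and> F u = f u" if "u \<in> fvs.span B" for u
    using that
  proof (induction rule: fvs.span_induct_alt)
    case base
    then show ?case using f0 fvs.subspace_0[OF assms(1)] lin_zero[OF F(1)] by simp
  next
    case (step c x y)
    then have "x \<in> S" "vscale c x \<in> S" using B(1) assms(1) by (auto intro: fvs.subspace_scale)
    then show ?case using step F assms
      by (auto simp: lin_add lin_scale intro: fvs.subspace_add)
  qed
  then show ?thesis using that F B by blast
qed

lemma projection_exists:
  assumes "fvs.subspace S"
  obtains p where "lin p" "\<And>v. p v \<in> S" "\<And>v. v \<in> S \<Longrightarrow> p v = v"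
proof -
  obtain B where B: "B \<subseteq> S" "fvs.independent B" "S \<subseteq> fvs.span B"
    using fvs.maximal_independent_subset by blast
  have sp: "fvs.span B = S" using B assms fvs.span_minimal by blast
  obtain p where p: "lin p" "\<forall>x\<in>B. p x = x" "range p = fvs.span ((\<lambda>x. x) ` B)"
    using fvs_pair.linear_independent_extend_subspace[OF B(2), of "\<lambda>x. x"] by blast
  have "p v = v" if "v \<in> S" for v
    using lin_eq_span[OF p(1) lin_id, of B v] p(2) that sp by simp
  moreover have "p v \<in> S" for v using p(3) sp by auto
  ultimately show ?thesis using that p(1) by blast
qed

section \<open>Gliders and their isomorphisms\<close>

lemma algebra_act_single [simp]: "algebra_act M (single g (1::'k::field)) m = act M g m"
  by (simp add: algebra_act_def)

lemma single_in_monoid_algebra [simp]: "g \<in> carrier G \<Longrightarrow> single g c \<in> carrier (monoid_algebra G)"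
  by (simp add: monoid_algebra_def)

lemma subspace_of_finite_dim: "finite_dim_subspace S \<Longrightarrow> fvs.subspace S"
  by (simp add: finite_dim_subspace_def)

lemma is_glider_iff:
  "is_glider G M \<longleftrightarrow>
     (\<forall>g\<in>carrier G. lin (act M g)) \<and> (\<forall>v. act M \<one>\<^bsub>G\<^esub> v = v) \<and>
     (\<forall>g\<in>carrier G. \<forall>h\<in>carrier G. \<forall>v. act M (g \<otimes>\<^bsub>G\<^esub> h) v = act M g (act M h v)) \<and>
     finite_dim_subspace (lev0 M) \<and> finite_dim_subspace (lev1 M) \<and> lev1 M \<subseteq> lev0 M \<and>
     (\<forall>g\<in>carrier G. \<forall>m\<in>lev1 M. act M g m \<in> lev0 M)"
proof -
  have "(\<forall>x\<in>carrier (monoid_algebra G). \<forall>m\<in>lev1 M. algebra_act M x m \<in> lev0 M) \<longleftrightarrow>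
    (\<forall>g\<in>carrier G. \<forall>m\<in>lev1 M. act M g m \<in> lev0 M)" if s: "fvs.subspace (lev0 M)"
  proof safe
    fix g m assume "\<forall>x\<in>carrier (monoid_algebra G). \<forall>m\<in>lev1 M. algebra_act M x m \<in> lev0 M"
      "g \<in> carrier G" "m \<in> lev1 M"
    then show "act M g m \<in> lev0 M"
      using single_in_monoid_algebra[of g G 1] by (metis algebra_act_single)
  next
    fix x :: "'a \<Rightarrow>\<^sub>0 'd" and m
    assume a: "\<forall>g\<in>carrier G. \<forall>m\<in>lev1 M. act M g m \<in> lev0 M" "m \<in> lev1 M"
      "x \<in> carrier (monoid_algebra G)"
    then show "algebra_act M x m \<in> lev0 M"
      unfolding algebra_act_def
      by (intro fvs.subspace_sum[OF s] fvs.subspace_scale[OF s]) (auto simp: monoid_algebra_def)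
  qed
  then show ?thesis unfolding is_glider_def using subspace_of_finite_dim[of "lev0 M"] by argo
qed

lemma glider_lin: "is_glider G M \<Longrightarrow> g \<in> carrier G \<Longrightarrow> lin (act M g)"
  and glider_one: "is_glider G M \<Longrightarrow> act M \<one>\<^bsub>G\<^esub> v = v"
  and glider_mult: "is_glider G M \<Longrightarrow> g \<in> carrier G \<Longrightarrow> h \<in> carrier G \<Longrightarrow>
     act M (g \<otimes>\<^bsub>G\<^esub> h) v = act M g (act M h v)"
  and glider_fd0: "is_glider G M \<Longrightarrow> finite_dim_subspace (lev0 M)"
  and glider_fd1: "is_glider G M \<Longrightarrow> finite_dim_subspace (lev1 M)"
  and glider_sub0: "is_glider G M \<Longrightarrow> fvs.subspace (lev0 M)"
  and glider_sub1: "is_glider G M \<Longrightarrow> fvs.subspace (lev1 M)"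
  and glider_lev: "is_glider G M \<Longrightarrow> m \<in> lev1 M \<Longrightarrow> m \<in> lev0 M"
  and glider_act: "is_glider G M \<Longrightarrow> g \<in> carrier G \<Longrightarrow> m \<in> lev1 M \<Longrightarrow> act M g m \<in> lev0 M"
  by (auto simp: is_glider_iff finite_dim_subspace_def)

text \<open>
  A linear map that is defined on a level extends to the ambient space, because a basis of the
  level extends to a basis there. So an isomorphism of gliders and its inverse come from two
  linear maps between the whole ambient spaces, and these can be composed and tensored. The
  second map intertwines the actions automatically (see \<open>iso_pair_sym\<close>).
\<close>
definition iso_pair where
  "iso_pair G M N f f' \<longleftrightarrow> lin f \<and> lin f' \<and>
     (\<forall>u\<in>lev0 M. f u \<in> lev0 N \<and> f' (f u) = u) \<and> (\<forall>v\<in>lev0 N. f' v \<in> lev0 M \<and> f (f' v) = v) \<and>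
     (\<forall>u\<in>lev1 M. f u \<in> lev1 N) \<and> (\<forall>v\<in>lev1 N. f' v \<in> lev1 M) \<and>
     (\<forall>g\<in>carrier G. \<forall>m\<in>lev1 M. f (act M g m) = act N g (f m))"

lemma iso_pair_sym:
  assumes "is_glider G M" "is_glider G N" "iso_pair G M N f f'"
  shows "iso_pair G N M f' f"
proof -
  have "f' (act N g m) = act M g (f' m)" if g: "g \<in> carrier G" and m: "m \<in> lev1 N" for g m
  proof -
    have m': "f' m \<in> lev1 M" "f (f' m) = m"
      using assms m glider_lev[OF assms(2)] by (auto simp: iso_pair_def)
    have "f' (act N g m) = f' (f (act M g (f' m)))"
      using assms(3) g m' by (auto simp: iso_pair_def)
    also have "\<dots> = act M g (f' m)"
      using assms(3) glider_act[OF assms(1) g m'(1)] by (auto simp: iso_pair_def)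
    finally show ?thesis .
  qed
  then show ?thesis using assms(3) by (auto simp: iso_pair_def)
qed

lemma iso_pair_trans:
  assumes "iso_pair G M N f f'" "iso_pair G N L h h'"
  shows "iso_pair G M L (\<lambda>u. h (f u)) (\<lambda>v. f' (h' v))"
  using assms lin_compose[of h f] lin_compose[of f' h'] by (auto simp: iso_pair_def)

lemma iso_pair_hom:
  assumes "is_glider G M" "iso_pair G M N f f'"
  shows "f \<in> glider_hom G M N"
proof -
  have "f (algebra_act M x m) = algebra_act N x (f m)"
    if "x \<in> carrier (monoid_algebra G)" "m \<in> lev1 M" for x m
    using that assms
    by (auto simp: algebra_act_def iso_pair_def lin_sum lin_scale monoid_algebra_def intro!: sum.cong)
  then show ?thesis using assms
    by (auto simp: glider_hom_def iso_pair_def lin_add lin_scale)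
qed

lemma iso_pair_isomorphic:
  assumes "is_glider G M" "is_glider G N" "iso_pair G M N f f'"
  shows "glider_isomorphic G M N"
  using iso_pair_hom[OF assms(1,3)] iso_pair_hom[OF assms(2) iso_pair_sym[OF assms]] assms(3)
  by (auto simp: glider_isomorphic_def iso_pair_def)

lemma isomorphic_iso_pair:
  assumes "is_glider G M" "is_glider G N" "glider_isomorphic G M N"
  obtains f f' where "iso_pair G M N f f'"
proof -
  obtain f h where f: "f \<in> glider_hom G M N" and h: "h \<in> glider_hom G N M"
    and fh: "\<forall>u\<in>lev0 M. h (f u) = u" "\<forall>v\<in>lev0 N. f (h v) = v"
    using assms(3) by (auto simp: glider_isomorphic_def)
  obtain F where F: "lin F" "\<And>u. u \<in> lev0 M \<Longrightarrow> F u = f u"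
    using f by (elim lin_on_extend[OF glider_sub0[OF assms(1)], of f, rotated 2]) (auto simp: glider_hom_def)
  obtain H where H: "lin H" "\<And>u. u \<in> lev0 N \<Longrightarrow> H u = h u"
    using h by (elim lin_on_extend[OF glider_sub0[OF assms(2)], of h, rotated 2]) (auto simp: glider_hom_def)
  have f_lev: "f u \<in> lev0 N" if "u \<in> lev0 M" for u using f that by (auto simp: glider_hom_def)
  have h_lev: "h u \<in> lev0 M" if "u \<in> lev0 N" for u using h that by (auto simp: glider_hom_def)
  have "F (act M g m) = act N g (F m)" if "g \<in> carrier G" "m \<in> lev1 M" for g m
  proof -
    have "f (algebra_act M (single g 1) m) = algebra_act N (single g 1) (f m)"
      using f that single_in_monoid_algebra[of g G 1] unfolding glider_hom_def by blast
    then show ?thesis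
      using F(2) glider_act[OF assms(1) that] glider_lev[OF assms(1) that(2)] by simp
  qed
  then have "iso_pair G M N F H"
    using F H fh f h f_lev h_lev glider_lev[OF assms(1)] glider_lev[OF assms(2)]
    unfolding iso_pair_def glider_hom_def by (auto simp: Pi_iff)
  then show ?thesis using that by blast
qed

lemma isomorphic_refl: "is_glider G M \<Longrightarrow> glider_isomorphic G M M"
  by (rule iso_pair_isomorphic[of _ _ _ "\<lambda>v. v" "\<lambda>v. v"]) (auto simp: iso_pair_def)

lemma isomorphic_sym:
  "is_glider G M \<Longrightarrow> is_glider G N \<Longrightarrow> glider_isomorphic G M N \<Longrightarrow> glider_isomorphic G N M"
  by (metis isomorphic_iso_pair iso_pair_isomorphic iso_pair_sym)

lemma isomorphic_trans:
  "is_glider G M \<Longrightarrow> is_glider G N \<Longrightarrow> is_glider G L \<Longrightarrow> glider_isomorphic G M N \<Longrightarrow>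
     glider_isomorphic G N L \<Longrightarrow> glider_isomorphic G M L"
  by (metis isomorphic_iso_pair iso_pair_isomorphic iso_pair_trans)

lemma iso_class_eqI:
  assumes "is_glider G M" "is_glider G N" "glider_isomorphic G M N"
  shows "iso_class G M = iso_class G N"
  using isomorphic_trans[of G M N] isomorphic_trans[of G N M] isomorphic_sym[of G M N] assms
  unfolding iso_class_def by blast

lemma in_iso_class: "is_glider G M \<Longrightarrow> M \<in> iso_class G M"
  by (simp add: iso_class_def isomorphic_refl)


subsection \<open>Change of the basis that indexes the ambient space\<close>

text \<open>
  Isomorphism classes consist of gliders in the space with basis \<open>nat\<close>, while sums and tensor
  products of such gliders have other index types. A bijection of the index types brings them back.
\<close>
definition reindex ::
    "('i \<Rightarrow> 'j) \<Rightarrow> ('j \<Rightarrow> 'i) \<Rightarrow> ('g, 'i \<Rightarrow>\<^sub>0 'k::field) glider \<Rightarrow> ('g, 'j \<Rightarrow>\<^sub>0 'k) glider" where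
  "reindex e e' M = \<lparr>act = (\<lambda>g v. push_vec e (act M g (push_vec e' v))),
     lev0 = push_vec e ` lev0 M, lev1 = push_vec e ` lev1 M\<rparr>"

lemma reindex_glider:
  assumes "is_glider G M" "\<And>i. e' (e i) = i" "\<And>j. e (e' j) = j"
  shows "is_glider G (reindex e e' M)" "glider_isomorphic G M (reindex e e' M)"
proof -
  have inv: "push_vec e' (push_vec e u) = u" "push_vec e (push_vec e' v) = v" for u v
    by (simp_all add: push_push assms)
  have "lin (\<lambda>v. push_vec e (act M g (push_vec e' v)))" if "g \<in> carrier G" for g
    by (rule lin_compose[OF lin_push lin_compose[OF glider_lin[OF assms(1) that] lin_push]])
  moreover have "finite_dim_subspace (push_vec e ` lev0 M)" "finite_dim_subspace (push_vec e ` lev1 M)"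
    using finite_dim_image[OF lin_push] glider_fd0[OF assms(1)] glider_fd1[OF assms(1)] by blast+
  ultimately show R: "is_glider G (reindex e e' M)"
    unfolding is_glider_iff reindex_def
    using glider_lev[OF assms(1)] glider_act[OF assms(1)]
    by (auto simp: inv glider_one[OF assms(1)] glider_mult[OF assms(1)])
  show "glider_isomorphic G M (reindex e e' M)"
    by (rule iso_pair_isomorphic[OF assms(1) R, of "push_vec e" "push_vec e'"])
       (auto simp: iso_pair_def inv reindex_def)
qed


subsection \<open>Direct sums and tensor products\<close>

lemma glider_sum_act:
  "act (glider_sum M N) g (push_vec Inl u + push_vec Inr v) = push_vec Inl (act M g u) + push_vec Inr (act N g v)"
  by (simp add: glider_sum_def)

lemma sum_subspace:
  assumes "finite_dim_subspace S" "finite_dim_subspace S'"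
  shows "finite_dim_subspace {push_vec Inl u + push_vec Inr v | u v. u \<in> S \<and> v \<in> S'}"
proof -
  obtain B B' where B: "finite B" "S = fvs.span B" "finite B'" "S' = fvs.span B'"
    using assms unfolding finite_dim_subspace_def by blast
  have "fvs.span (push_vec Inl ` B \<union> push_vec Inr ` B') =
      {push_vec Inl u + push_vec Inr v | u v. u \<in> S \<and> v \<in> S'}"
    unfolding fvs.span_Un fvs_pair.linear_span_image[OF lin_push] B(2,4) by blast
  moreover have "finite (push_vec Inl ` B \<union> push_vec Inr ` B')" using B by simp
  ultimately show ?thesis using finite_dim_span by metis
qed

lemma glider_sum_glider:
  fixes M :: "('g, 'i \<Rightarrow>\<^sub>0 'k::field) glider" and N :: "('g, 'j \<Rightarrow>\<^sub>0 'k) glider"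
  assumes "is_glider G M" "is_glider G N"
  shows "is_glider G (glider_sum M N)"
proof -
  let ?l = "Poly_Mapping.map_key Inl :: ('i + 'j \<Rightarrow>\<^sub>0 'k) \<Rightarrow> _"
  let ?r = "Poly_Mapping.map_key Inr :: ('i + 'j \<Rightarrow>\<^sub>0 'k) \<Rightarrow> _"
  have "lin (act (glider_sum M N) g)" if g: "g \<in> carrier G" for g
  proof -
    have "lin ?l" "lin ?r" by (auto intro: lin_map_key)
    then have "lin (\<lambda>w. push_vec Inl (act M g (?l w)) :: 'i + 'j \<Rightarrow>\<^sub>0 'k)"
      "lin (\<lambda>w. push_vec Inr (act N g (?r w)) :: 'i + 'j \<Rightarrow>\<^sub>0 'k)"
      using lin_compose[OF lin_push lin_compose[OF glider_lin[OF assms(1) g]]]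
        lin_compose[OF lin_push lin_compose[OF glider_lin[OF assms(2) g]]] by blast+
    then show ?thesis
      unfolding glider_sum_def by (simp add: lin_plus)
  qed
  moreover have "act (glider_sum M N) \<one>\<^bsub>G\<^esub> v = v" for v
    by (simp add: glider_sum_def glider_one[OF assms(1)] glider_one[OF assms(2)] push_sum_decomp)
  moreover have "act (glider_sum M N) (g \<otimes>\<^bsub>G\<^esub> h) v = act (glider_sum M N) g (act (glider_sum M N) h v)"
    if "g \<in> carrier G" "h \<in> carrier G" for g h v
    using that by (simp add: glider_sum_def glider_mult[OF assms(1)] glider_mult[OF assms(2)])
  moreover have "act (glider_sum M N) g m \<in> lev0 (glider_sum M N)"
    if g: "g \<in> carrier G" and m: "m \<in> lev1 (glider_sum M N)" for g m
  proof -
    obtain u v where uv: "m = push_vec Inl u + push_vec Inr v" "u \<in> lev1 M" "v \<in> lev1 N"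
      using m by (auto simp: glider_sum_def)
    have "act M g u \<in> lev0 M" "act N g v \<in> lev0 N"
      using uv glider_act[OF assms(1) g] glider_act[OF assms(2) g] by blast+
    then show ?thesis unfolding uv(1) glider_sum_act by (auto simp: glider_sum_def)
  qed
  moreover have "lev1 (glider_sum M N) \<subseteq> lev0 (glider_sum M N)"
    using glider_lev[OF assms(1)] glider_lev[OF assms(2)] by (simp add: glider_sum_def) blast
  moreover have "finite_dim_subspace (lev0 (glider_sum M N))" "finite_dim_subspace (lev1 (glider_sum M N))"
    using sum_subspace[OF glider_fd0[OF assms(1)] glider_fd0[OF assms(2)]]
      sum_subspace[OF glider_fd1[OF assms(1)] glider_fd1[OF assms(2)]] by (simp_all add: glider_sum_def)
  ultimately show ?thesis
    unfolding is_glider_iff by blast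
qed

text \<open>
  A name for the spans in the definition of the tensor product, so that membership and equality
  statements can be reduced to pure tensors by one rule each.
\<close>
definition tensor_levels where
  "tensor_levels S S' = fvs.span {tensor_vec u v | u v. u \<in> S \<and> v \<in> S'}"

lemma glider_tensor_lev: "lev0 (glider_tensor M N) = tensor_levels (lev0 M) (lev0 N)"
    "lev1 (glider_tensor M N) = tensor_levels (lev1 M) (lev1 N)"
  by (simp_all add: glider_tensor_def tensor_levels_def)

lemma tensor_levels_mem: "u \<in> S \<Longrightarrow> v \<in> S' \<Longrightarrow> tensor_vec u v \<in> tensor_levels S S'"
  unfolding tensor_levels_def by (rule fvs.span_base) blast

lemma tensor_levels_map:
  assumes "lin f" "\<And>u v. u \<in> S \<Longrightarrow> v \<in> S' \<Longrightarrow> f (tensor_vec u v) \<in> V" "fvs.subspace V"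
    "w \<in> tensor_levels S S'"
  shows "f w \<in> V"
  using assms(4) unfolding tensor_levels_def
  by (rule lin_span_subset[OF assms(1) _ assms(3), rotated]) (use assms(2) in auto)

lemma tensor_levels_eq:
  assumes "lin f" "lin h" "\<And>u v. u \<in> S \<Longrightarrow> v \<in> S' \<Longrightarrow> f (tensor_vec u v) = h (tensor_vec u v)"
    "w \<in> tensor_levels S S'"
  shows "f w = h w"
  using assms(4) unfolding tensor_levels_def
  by (rule lin_eq_span[OF assms(1,2), rotated]) (use assms(3) in auto)

lemma subspace_tensor_levels [simp]: "fvs.subspace (tensor_levels S S')"
  by (simp add: tensor_levels_def)

lemma tensor_act: "act (glider_tensor M N) g = tensor_map (act M g) (act N g)"
  by (simp add: glider_tensor_def tensor_map_def linear_ext_def fun_eq_iff case_prod_unfold)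

lemma lin_tensor_act [simp]: "lin (act (glider_tensor M N) g)"
  by (simp add: tensor_act)

lemma tensor_act_tensor:
  assumes "is_glider G M" "is_glider G N" "g \<in> carrier G"
  shows "act (glider_tensor M N) g (tensor_vec u v) = tensor_vec (act M g u) (act N g v)"
  by (simp add: tensor_act tensor_map_tensor glider_lin[OF assms(1,3)] glider_lin[OF assms(2,3)])

lemma glider_tensor_glider:
  assumes "group G" "is_glider G M" "is_glider G N"
  shows "is_glider G (glider_tensor M N)"
proof -
  interpret group G by fact
  note act_tensor = tensor_act_tensor[OF assms(2,3)]
  have "act (glider_tensor M N) \<one>\<^bsub>G\<^esub> w = w" for w
    by (rule lin_eq_tensorI[of "act (glider_tensor M N) \<one>\<^bsub>G\<^esub>" "\<lambda>w. w"])
       (simp_all add: act_tensor glider_one[OF assms(2)] glider_one[OF assms(3)])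
  moreover have "act (glider_tensor M N) (g \<otimes>\<^bsub>G\<^esub> h) w = act (glider_tensor M N) g (act (glider_tensor M N) h w)"
    if "g \<in> carrier G" "h \<in> carrier G" for g h w
  proof -
    show ?thesis
      by (rule lin_eq_tensorI[OF lin_tensor_act lin_compose[OF lin_tensor_act lin_tensor_act]])
         (simp add: act_tensor glider_mult[OF assms(2)] glider_mult[OF assms(3)] that)
  qed
  moreover have "act (glider_tensor M N) g m \<in> lev0 (glider_tensor M N)"
    if g: "g \<in> carrier G" and m: "m \<in> lev1 (glider_tensor M N)" for g m
  proof -
    have "act (glider_tensor M N) g (tensor_vec u v) \<in> tensor_levels (lev0 M) (lev0 N)"
      if "u \<in> lev1 M" "v \<in> lev1 N" for u v
      using that g by (simp add: act_tensor tensor_levels_mem glider_act[OF assms(2)] glider_act[OF assms(3)])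
    then show ?thesis
      using tensor_levels_map[OF lin_tensor_act, of "lev1 M" "lev1 N" M N g "tensor_levels (lev0 M) (lev0 N)" m] m
      by (simp add: glider_tensor_lev)
  qed
  moreover have "lev1 (glider_tensor M N) \<subseteq> lev0 (glider_tensor M N)"
    unfolding glider_tensor_lev tensor_levels_def
    using glider_lev[OF assms(2)] glider_lev[OF assms(3)] by (intro fvs.span_mono) blast
  ultimately show ?thesis
    unfolding is_glider_iff
    using finite_dim_tensor[OF glider_fd0[OF assms(2)] glider_fd0[OF assms(3)]]
      finite_dim_tensor[OF glider_fd1[OF assms(2)] glider_fd1[OF assms(3)]]
    by (simp add: glider_tensor_lev tensor_levels_def)
qed

lemma tensor_cong:
  fixes M :: "('g, 'i \<Rightarrow>\<^sub>0 'k::field) glider" and N :: "('g, 'j \<Rightarrow>\<^sub>0 'k) glider"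
    and M' :: "('g, 'i' \<Rightarrow>\<^sub>0 'k) glider" and N' :: "('g, 'j' \<Rightarrow>\<^sub>0 'k) glider"
  assumes "group G" "is_glider G M" "is_glider G N" "is_glider G M'" "is_glider G N'"
    and "glider_isomorphic G M M'" "glider_isomorphic G N N'"
  shows "glider_isomorphic G (glider_tensor M N) (glider_tensor M' N')"
proof -
  obtain f f' where f: "iso_pair G M M' f f'" using isomorphic_iso_pair[OF assms(2,4,6)] .
  obtain h h' where h: "iso_pair G N N' h h'" using isomorphic_iso_pair[OF assms(3,5,7)] .
  have l: "lin f" "lin f'" "lin h" "lin h'" using f h by (auto simp: iso_pair_def)
  note T = tensor_map_tensor[OF l(1,3)] tensor_map_tensor[OF l(2,4)]
  have lev: "tensor_map a b w \<in> tensor_levels V V'"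
    if ab: "lin a" "lin b" "\<And>u. u \<in> S \<Longrightarrow> a u \<in> V" "\<And>v. v \<in> S' \<Longrightarrow> b v \<in> V'"
      and w: "w \<in> tensor_levels S S'"
    for w S S' V V' and a :: "('x \<Rightarrow>\<^sub>0 'k) \<Rightarrow> ('y \<Rightarrow>\<^sub>0 'k)" and b :: "('z \<Rightarrow>\<^sub>0 'k) \<Rightarrow> ('t \<Rightarrow>\<^sub>0 'k)"
    by (rule tensor_levels_map[OF lin_tensor_map _ _ w]) (auto simp: tensor_map_tensor ab intro!: tensor_levels_mem)
  have inv: "tensor_map c d (tensor_map a b w) = w"
    if ab: "lin a" "lin b" "lin c" "lin d" "\<And>u. u \<in> S \<Longrightarrow> c (a u) = u" "\<And>v. v \<in> S' \<Longrightarrow> d (b v) = v"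
      and w: "w \<in> tensor_levels S S'"
    for w S S' and a :: "('x \<Rightarrow>\<^sub>0 'k) \<Rightarrow> ('y \<Rightarrow>\<^sub>0 'k)" and b :: "('z \<Rightarrow>\<^sub>0 'k) \<Rightarrow> ('t \<Rightarrow>\<^sub>0 'k)" and c d
    by (rule tensor_levels_eq[OF lin_compose[OF lin_tensor_map lin_tensor_map] lin_id _ w]) (auto simp: tensor_map_tensor ab)
  have "iso_pair G (glider_tensor M N) (glider_tensor M' N') (tensor_map f h) (tensor_map f' h')"
    unfolding iso_pair_def glider_tensor_lev
  proof (intro conjI ballI lin_tensor_map)
    show "tensor_map f h w \<in> tensor_levels (lev0 M') (lev0 N')" "tensor_map f' h' (tensor_map f h w) = w"
      if "w \<in> tensor_levels (lev0 M) (lev0 N)" for w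
      using f h by (auto intro!: lev[OF l(1,3) _ _ that] inv[OF l(1,3,2,4) _ _ that] simp: iso_pair_def)
    show "tensor_map f' h' w \<in> tensor_levels (lev0 M) (lev0 N)" "tensor_map f h (tensor_map f' h' w) = w"
      if "w \<in> tensor_levels (lev0 M') (lev0 N')" for w
      using f h by (auto intro!: lev[OF l(2,4) _ _ that] inv[OF l(2,4,1,3) _ _ that] simp: iso_pair_def)
    show "tensor_map f h w \<in> tensor_levels (lev1 M') (lev1 N')"
      if "w \<in> tensor_levels (lev1 M) (lev1 N)" for w
      using f h by (auto intro!: lev[OF l(1,3) _ _ that] simp: iso_pair_def)
    show "tensor_map f' h' w \<in> tensor_levels (lev1 M) (lev1 N)"
      if "w \<in> tensor_levels (lev1 M') (lev1 N')" for w
      using f h by (auto intro!: lev[OF l(2,4) _ _ that] simp: iso_pair_def)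
    fix g w assume g: "g \<in> carrier G" and w: "w \<in> tensor_levels (lev1 M) (lev1 N)"
    have e: "f (act M g u) = act M' g (f u)" if "u \<in> lev1 M" for u
      using f g that by (auto simp: iso_pair_def)
    have e': "h (act N g v) = act N' g (h v)" if "v \<in> lev1 N" for v
      using h g that by (auto simp: iso_pair_def)
    show "tensor_map f h (act (glider_tensor M N) g w) = act (glider_tensor M' N') g (tensor_map f h w)"
      by (rule tensor_levels_eq[OF lin_compose[OF lin_tensor_map lin_tensor_act] lin_compose[OF lin_tensor_act lin_tensor_map] _ w])
         (simp add: tensor_act_tensor[OF assms(2,3) g] tensor_act_tensor[OF assms(4,5) g] T e e')
  qed
  then show ?thesis
    by (rule iso_pair_isomorphic[OF glider_tensor_glider[OF assms(1-3)] glider_tensor_glider[OF assms(1,4,5)]])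
qed

lemma tensor_commute:
  fixes M :: "('g, 'i \<Rightarrow>\<^sub>0 'k::field) glider" and N :: "('g, 'j \<Rightarrow>\<^sub>0 'k) glider"
  assumes "group G" "is_glider G M" "is_glider G N"
  shows "glider_isomorphic G (glider_tensor M N) (glider_tensor N M)"
proof -
  define sw :: "('i \<times> 'j \<Rightarrow>\<^sub>0 'k) \<Rightarrow> ('j \<times> 'i \<Rightarrow>\<^sub>0 'k)" where "sw = push_vec prod.swap"
  define ws :: "('j \<times> 'i \<Rightarrow>\<^sub>0 'k) \<Rightarrow> ('i \<times> 'j \<Rightarrow>\<^sub>0 'k)" where "ws = push_vec prod.swap"
  have l: "lin sw" "lin ws" by (simp_all add: sw_def ws_def)
  have inv: "ws (sw w) = w" "sw (ws w') = w'" for w w' by (simp_all add: sw_def ws_def push_push)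
  have lk: "lookup (push_vec prod.swap x) (a, b) = lookup x (b, a)" for x :: "'x \<times> 'y \<Rightarrow>\<^sub>0 'z::field" and a b
    using lookup_push_inj[of prod.swap x "(b, a)"] by simp
  have T: "sw (tensor_vec u v) = tensor_vec v u" "ws (tensor_vec v u) = tensor_vec u v" for u v
    by (rule poly_mapping_eqI, clarsimp simp: sw_def ws_def lk mult.commute)+
  have lev: "sw w \<in> tensor_levels B A" if "w \<in> tensor_levels A B" for w A B
    by (rule tensor_levels_map[OF l(1) _ _ that]) (auto simp: T intro!: tensor_levels_mem)
  have lev': "ws w \<in> tensor_levels A B" if "w \<in> tensor_levels B A" for w A B
    by (rule tensor_levels_map[OF l(2) _ _ that]) (auto simp: T intro!: tensor_levels_mem)
  have "sw (act (glider_tensor M N) g w) = act (glider_tensor N M) g (sw w)" if g: "g \<in> carrier G" for g w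
    by (rule lin_eq_tensorI[OF lin_compose[OF l(1) lin_tensor_act] lin_compose[OF lin_tensor_act l(1)]])
       (simp add: tensor_act_tensor[OF assms(2,3) g] tensor_act_tensor[OF assms(3,2) g] T)
  then have "iso_pair G (glider_tensor M N) (glider_tensor N M) sw ws"
    unfolding iso_pair_def glider_tensor_lev using l inv lev lev' by blast
  then show ?thesis
    by (rule iso_pair_isomorphic[OF glider_tensor_glider[OF assms(1-3)] glider_tensor_glider[OF assms(1,3,2)]])
qed

lemma tensor_assoc:
  fixes M :: "('g, 'i \<Rightarrow>\<^sub>0 'k::field) glider" and N :: "('g, 'j \<Rightarrow>\<^sub>0 'k) glider" and L :: "('g, 'l \<Rightarrow>\<^sub>0 'k) glider"
  assumes "group G" "is_glider G M" "is_glider G N" "is_glider G L"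
  shows "glider_isomorphic G (glider_tensor (glider_tensor M N) L) (glider_tensor M (glider_tensor N L))"
proof -
  define as :: "(('i \<times> 'j) \<times> 'l \<Rightarrow>\<^sub>0 'k) \<Rightarrow> ('i \<times> 'j \<times> 'l \<Rightarrow>\<^sub>0 'k)" where
    "as = push_vec (\<lambda>((i, j), k). (i, j, k))"
  define sa :: "('i \<times> 'j \<times> 'l \<Rightarrow>\<^sub>0 'k) \<Rightarrow> (('i \<times> 'j) \<times> 'l \<Rightarrow>\<^sub>0 'k)" where
    "sa = push_vec (\<lambda>(i, j, k). ((i, j), k))"
  have l: "lin as" "lin sa" by (simp_all add: as_def sa_def)
  have inv: "sa (as w) = w" "as (sa w') = w'" for w w'
    by (simp_all add: as_def sa_def push_push case_prod_unfold)
  have T: "as (tensor_vec (tensor_vec u v) w) = tensor_vec u (tensor_vec v w)" for u v w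
  proof (rule poly_mapping_eqI)
    fix s :: "'i \<times> 'j \<times> 'l"
    obtain i j k where s: "s = (\<lambda>((i, j), k). (i, j, k)) ((i, j), k)" by (cases s) auto
    have "lookup (as x) s = lookup x ((i, j), k)" for x
      unfolding s as_def by (rule lookup_push_inj) (auto simp: inj_on_def)
    then show "lookup (as (tensor_vec (tensor_vec u v) w)) s = lookup (tensor_vec u (tensor_vec v w)) s"
      by (simp add: s mult.assoc)
  qed
  have T': "sa (tensor_vec u (tensor_vec v w)) = tensor_vec (tensor_vec u v) w" for u v w
    using inv(1)[of "tensor_vec (tensor_vec u v) w"] by (simp add: T)
  have as_lev: "as w \<in> tensor_levels A (tensor_levels B C)"
    if w: "w \<in> tensor_levels (tensor_levels A B) C" for A B C w
  proof (rule tensor_levels_map[OF l(1) _ _ w])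
    fix t z assume t: "t \<in> tensor_levels A B" and z: "z \<in> C"
    show "as (tensor_vec t z) \<in> tensor_levels A (tensor_levels B C)"
      by (rule tensor_levels_map[OF lin_compose[OF l(1) lin_tensor_left] _ _ t])
         (auto simp: T z intro!: tensor_levels_mem)
  qed simp
  have sa_lev: "sa w \<in> tensor_levels (tensor_levels A B) C"
    if w: "w \<in> tensor_levels A (tensor_levels B C)" for A B C w
  proof (rule tensor_levels_map[OF l(2) _ _ w])
    fix z t assume t: "t \<in> tensor_levels B C" and z: "z \<in> A"
    show "sa (tensor_vec z t) \<in> tensor_levels (tensor_levels A B) C"
      by (rule tensor_levels_map[OF lin_compose[OF l(2) lin_tensor_right] _ _ t])
         (auto simp: T' z intro!: tensor_levels_mem)
  qed simp
  note gl = glider_tensor_glider[OF assms(1-3)] glider_tensor_glider[OF assms(1,3,4)]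
  have "as (act (glider_tensor (glider_tensor M N) L) g w) = act (glider_tensor M (glider_tensor N L)) g (as w)"
    if g: "g \<in> carrier G" for g w
  proof -
    note lins = lin_compose[OF l(1) lin_tensor_act[of "glider_tensor M N" L g]]
      lin_compose[OF lin_tensor_act[of M "glider_tensor N L" g] l(1)]
    have "as (act (glider_tensor (glider_tensor M N) L) g (tensor_vec t z)) =
         act (glider_tensor M (glider_tensor N L)) g (as (tensor_vec t z))" for t z
      by (rule lin_eq_tensorI[OF lin_compose[OF lins(1) lin_tensor_left] lin_compose[OF lins(2) lin_tensor_left]])
         (simp add: T tensor_act_tensor[OF assms(2) gl(2) g] tensor_act_tensor[OF gl(1) assms(4) g]
             tensor_act_tensor[OF assms(2,3) g] tensor_act_tensor[OF assms(3,4) g])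
    then show ?thesis by (rule lin_eq_tensorI[OF lins])
  qed
  then have "iso_pair G (glider_tensor (glider_tensor M N) L) (glider_tensor M (glider_tensor N L)) as sa"
    unfolding iso_pair_def glider_tensor_lev using l inv as_lev sa_lev by blast
  then show ?thesis
    by (rule iso_pair_isomorphic[OF glider_tensor_glider[OF assms(1) gl(1) assms(4)]
          glider_tensor_glider[OF assms(1,2) gl(2)]])
qed

lemma character_glider_glider:
  assumes "group G" "\<chi> \<in> hom G mult_group_of_field"
  shows "is_glider G (character_glider \<chi>)"
proof -
  interpret group G by fact
  have m: "\<chi> (g \<otimes>\<^bsub>G\<^esub> h) = \<chi> g * \<chi> h" and nz: "\<chi> g \<noteq> 0" if "g \<in> carrier G" "h \<in> carrier G" for g h
    using assms(2) that by (auto simp: hom_def mult_group_of_field_def)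
  have "\<chi> \<one>\<^bsub>G\<^esub> * \<chi> \<one>\<^bsub>G\<^esub> = \<chi> \<one>\<^bsub>G\<^esub>" using m[of "\<one>\<^bsub>G\<^esub>" "\<one>\<^bsub>G\<^esub>"] by simp
  then have "\<chi> \<one>\<^bsub>G\<^esub> = 1" using nz[OF one_closed one_closed] by simp
  then show ?thesis
    unfolding is_glider_iff character_glider_def
    by (auto simp: m intro!: finite_dim_span fvs.span_scale)
qed

lemma one_glider: "group G \<Longrightarrow> is_glider G (character_glider (\<lambda>_. 1))"
  by (rule character_glider_glider) (auto simp: hom_def mult_group_of_field_def)

lemma tensor_unit:
  fixes M :: "('g, 'i \<Rightarrow>\<^sub>0 'k::field) glider"
  assumes "group G" "is_glider G M"
  shows "glider_isomorphic G (glider_tensor (character_glider (\<lambda>_. 1)) M) M"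
proof -
  let ?E = "character_glider (\<lambda>_. 1)"
  note gl = one_glider[OF assms(1)]
  define e0 :: "nat \<Rightarrow>\<^sub>0 'k" where "e0 = single 0 1"
  define f :: "(nat \<times> 'i \<Rightarrow>\<^sub>0 'k) \<Rightarrow> ('i \<Rightarrow>\<^sub>0 'k)"
    where "f = linear_ext (\<lambda>(i, j). if i = 0 then single j (1::'k) else 0)"
  have l: "lin f" by (simp add: f_def)
  have f: "f (tensor_vec e0 v) = v" for v
    by (rule lin_eqI[OF lin_compose[OF l lin_tensor_right] lin_id]) (simp add: f_def e0_def del: single_one)
  have T: "tensor_vec (vscale c e0) v = vscale c (tensor_vec e0 v)" for c v
    by (rule lin_scale[OF lin_tensor_left])
  have f2: "f (tensor_vec (vscale c e0) v) = vscale c v" for c v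
    by (simp add: T f lin_scale[OF l])
  have lev: "lev0 ?E = range (\<lambda>c. vscale c e0)" "lev1 ?E = range (\<lambda>c. vscale c e0)"
    by (simp_all add: character_glider_def e0_def fvs.span_singleton del: single_one)
  have ret: "tensor_vec e0 (f w) = w" if "w \<in> tensor_levels (lev0 ?E) (lev0 M)" for w
    by (rule tensor_levels_eq[OF lin_compose[OF lin_tensor_right l] lin_id _ that])
       (auto simp: lev f T lin_scale[OF l] lin_scale[OF lin_tensor_right])
  have e0: "e0 \<in> lev0 ?E" "e0 \<in> lev1 ?E" unfolding lev by (metis fvs.scale_one rangeI)+
  have fl: "f w \<in> S" if "fvs.subspace S" "w \<in> tensor_levels (lev0 ?E) S" for w S
    by (rule tensor_levels_map[OF l _ that]) (auto simp: lev f2 intro: fvs.subspace_scale[OF that(1)])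
  have fl1: "f w \<in> S" if "fvs.subspace S" "w \<in> tensor_levels (lev1 ?E) S" for w S
    using fl that by (simp add: lev)
  have "f (act (glider_tensor ?E M) g w) = act M g (f w)"
    if g: "g \<in> carrier G" and w: "w \<in> tensor_levels (lev1 ?E) (lev1 M)" for g w
  proof -
    have ag: "act ?E g u = u" for u :: "nat \<Rightarrow>\<^sub>0 'k" by (simp add: character_glider_def)
    show ?thesis
      by (rule tensor_levels_eq[OF lin_compose[OF l lin_tensor_act] lin_compose[OF glider_lin[OF assms(2) g] l] _ w])
         (auto simp: lev tensor_act_tensor[OF gl assms(2) g] ag f2 lin_scale[OF glider_lin[OF assms(2) g]])
  qed
  then have "iso_pair G (glider_tensor ?E M) M f (tensor_vec e0)"
    unfolding iso_pair_def glider_tensor_lev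
    using l f ret fl[OF glider_sub0[OF assms(2)]] fl1[OF glider_sub1[OF assms(2)]] e0
    by (auto intro!: tensor_levels_mem)
  then show ?thesis
    by (rule iso_pair_isomorphic[OF glider_tensor_glider[OF assms(1) gl assms(2)] assms(2)])
qed

definition sum_map :: "(('i \<Rightarrow>\<^sub>0 'k::field) \<Rightarrow> ('i' \<Rightarrow>\<^sub>0 'k)) \<Rightarrow> (('j \<Rightarrow>\<^sub>0 'k) \<Rightarrow> ('j' \<Rightarrow>\<^sub>0 'k)) \<Rightarrow>
    ('i + 'j \<Rightarrow>\<^sub>0 'k) \<Rightarrow> ('i' + 'j' \<Rightarrow>\<^sub>0 'k)" where
  "sum_map f h w = push_vec Inl (f (Poly_Mapping.map_key Inl w)) + push_vec Inr (h (Poly_Mapping.map_key Inr w))"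

lemma lin_sum_map: "lin f \<Longrightarrow> lin h \<Longrightarrow> lin (sum_map f h)"
  unfolding sum_map_def
  by (rule lin_plus[OF lin_compose[OF lin_push lin_compose[OF _ lin_map_key]]
        lin_compose[OF lin_push lin_compose[OF _ lin_map_key]]]) auto

lemma sum_map_sum [simp]: "sum_map f h (push_vec Inl u + push_vec Inr v) = push_vec Inl (f u) + push_vec Inr (h v)"
  by (simp add: sum_map_def)

definition sum_levels where
  "sum_levels S S' = {push_vec Inl u + push_vec Inr v | u v. u \<in> S \<and> v \<in> S'}"

lemma glider_sum_lev: "lev0 (glider_sum M N) = sum_levels (lev0 M) (lev0 N)"
    "lev1 (glider_sum M N) = sum_levels (lev1 M) (lev1 N)"
  by (simp_all add: glider_sum_def sum_levels_def)

lemma sum_levels_mem: "u \<in> S \<Longrightarrow> v \<in> S' \<Longrightarrow> push_vec Inl u + push_vec Inr v \<in> sum_levels S S'"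
  by (auto simp: sum_levels_def)

lemma sum_levelsE:
  assumes "w \<in> sum_levels S S'"
  obtains u v where "w = push_vec Inl u + push_vec Inr v" "u \<in> S" "v \<in> S'"
  using assms by (auto simp: sum_levels_def)

lemma glider_sum_cong:
  assumes "is_glider G M" "is_glider G N" "is_glider G M'" "is_glider G N'"
    and "glider_isomorphic G M M'" "glider_isomorphic G N N'"
  shows "glider_isomorphic G (glider_sum M N) (glider_sum M' N')"
proof -
  obtain f f' where f: "iso_pair G M M' f f'" using isomorphic_iso_pair[OF assms(1,3,5)] .
  obtain h h' where h: "iso_pair G N N' h h'" using isomorphic_iso_pair[OF assms(2,4,6)] .
  have l: "lin f" "lin f'" "lin h" "lin h'" using f h by (auto simp: iso_pair_def)
  have "iso_pair G (glider_sum M N) (glider_sum M' N') (sum_map f h) (sum_map f' h')"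
    using f h unfolding iso_pair_def glider_sum_lev
    by (auto elim!: sum_levelsE intro!: sum_levels_mem simp: glider_sum_act lin_sum_map)
  then show ?thesis
    by (rule iso_pair_isomorphic[OF glider_sum_glider[OF assms(1,2)] glider_sum_glider[OF assms(3,4)]])
qed

text \<open>
  Distributivity makes the relations \<open>[M \<oplus> N] = [M] + [N]\<close> stable under multiplication by classes.
\<close>
lemma tensor_sum_distrib:
  fixes M :: "('g, 'i \<Rightarrow>\<^sub>0 'k::field) glider" and N :: "('g, 'j \<Rightarrow>\<^sub>0 'k) glider" and L :: "('g, 'l \<Rightarrow>\<^sub>0 'k) glider"
  assumes "group G" "is_glider G M" "is_glider G N" "is_glider G L"
  shows "glider_isomorphic G (glider_tensor (glider_sum M N) L)
    (glider_sum (glider_tensor M L) (glider_tensor N L))"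
proof -
  define e :: "('i + 'j) \<times> 'l \<Rightarrow> ('i \<times> 'l) + ('j \<times> 'l)" where
    "e = (\<lambda>(s, k). case s of Inl i \<Rightarrow> Inl (i, k) | Inr j \<Rightarrow> Inr (j, k))"
  define e' :: "('i \<times> 'l) + ('j \<times> 'l) \<Rightarrow> ('i + 'j) \<times> 'l" where
    "e' = (\<lambda>s. case s of Inl (i, k) \<Rightarrow> (Inl i, k) | Inr (j, k) \<Rightarrow> (Inr j, k))"
  have ee: "e' (e x) = x" "e (e' y) = y" for x y
    by (auto simp: e_def e'_def split: sum.splits prod.splits)
  define f :: "(('i + 'j) \<times> 'l \<Rightarrow>\<^sub>0 'k) \<Rightarrow> (('i \<times> 'l) + ('j \<times> 'l) \<Rightarrow>\<^sub>0 'k)" where "f = push_vec e"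
  define f' :: "(('i \<times> 'l) + ('j \<times> 'l) \<Rightarrow>\<^sub>0 'k) \<Rightarrow> (('i + 'j) \<times> 'l \<Rightarrow>\<^sub>0 'k)" where "f' = push_vec e'"
  have l: "lin f" "lin f'" by (simp_all add: f_def f'_def)
  have inv: "f' (f w) = w" "f (f' w') = w'" for w w'
    by (simp_all add: f_def f'_def push_push ee)
  have T: "f (tensor_vec (push_vec Inl u + push_vec Inr v) z) =
      push_vec Inl (tensor_vec u z) + push_vec Inr (tensor_vec v z)" for u v z
  proof (rule poly_mapping_eqI)
    fix y
    have "inj e" using ee by (metis injI)
    then have "lookup (f x) y = lookup x (e' y)" for x
      using lookup_push_inj[of e x "e' y"] by (simp add: f_def ee)
    then show "lookup (f (tensor_vec (push_vec Inl u + push_vec Inr v) z)) y =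
       lookup (push_vec Inl (tensor_vec u z) + push_vec Inr (tensor_vec v z)) y"
      by (cases y) (auto simp: e'_def lookup_add lookup_push_inj lookup_push_notin image_iff algebra_simps)
  qed
  have T': "f' (push_vec Inl (tensor_vec u z)) = tensor_vec (push_vec Inl u) z"
    "f' (push_vec Inr (tensor_vec v z)) = tensor_vec (push_vec Inr v) z" for u v z
    using inv(1)[of "tensor_vec (push_vec Inl u + push_vec Inr 0) z"] inv(1)[of "tensor_vec (push_vec Inl 0 + push_vec Inr v) z"]
    unfolding T by (simp_all add: lin_zero[OF lin_push] lin_zero[OF lin_tensor_left])
  have sub: "fvs.subspace (sum_levels S S')" if "finite_dim_subspace S" "finite_dim_subspace S'"
    for S :: "('x \<Rightarrow>\<^sub>0 'k) set" and S' :: "('y \<Rightarrow>\<^sub>0 'k) set"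
    using subspace_of_finite_dim[OF sum_subspace[OF that]] by (simp add: sum_levels_def)
  have fwd: "f w \<in> sum_levels (tensor_levels A C) (tensor_levels B C)"
    if w: "w \<in> tensor_levels (sum_levels A B) C" and fd: "finite_dim_subspace A" "finite_dim_subspace B" "finite_dim_subspace C"
    for w A B C
    by (rule tensor_levels_map[OF l(1) _ _ w])
       (auto elim!: sum_levelsE simp: T fd sub finite_dim_tensor tensor_levels_def[symmetric] 
          intro!: sum_levels_mem tensor_levels_mem sub finite_dim_tensor[folded tensor_levels_def])
  have bwd: "f' w \<in> tensor_levels (sum_levels A B) C"
    if w: "w \<in> sum_levels (tensor_levels A C) (tensor_levels B C)"
      and fd: "finite_dim_subspace A" "finite_dim_subspace B" "finite_dim_subspace C"
    for w A B C
  proof -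
    obtain s t where st: "w = push_vec Inl s + push_vec Inr t" "s \<in> tensor_levels A C" "t \<in> tensor_levels B C"
      using w by (rule sum_levelsE)
    have z: "0 \<in> A" "0 \<in> B" using fd fvs.subspace_0 subspace_of_finite_dim by blast+
    have in_sum: "push_vec Inl u \<in> sum_levels A B" "push_vec Inr v \<in> sum_levels A B" if "u \<in> A" "v \<in> B" for u v
      using sum_levels_mem[OF that(1) z(2)] sum_levels_mem[OF z(1) that(2)] by (simp_all add: lin_zero[OF lin_push])
    have "f' (push_vec Inl s) \<in> tensor_levels (sum_levels A B) C"
      by (rule tensor_levels_map[OF lin_compose[OF l(2) lin_push] _ _ st(2)])
         (auto simp: T' intro!: tensor_levels_mem in_sum z)
    moreover have "f' (push_vec Inr t) \<in> tensor_levels (sum_levels A B) C"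
      by (rule tensor_levels_map[OF lin_compose[OF l(2) lin_push] _ _ st(3)])
         (auto simp: T' intro!: tensor_levels_mem in_sum z)
    ultimately show ?thesis by (simp add: st lin_add[OF l(2)] fvs.subspace_add)
  qed
  note gl = glider_sum_glider[OF assms(2,3)] glider_tensor_glider[OF assms(1,2,4)] glider_tensor_glider[OF assms(1,3,4)]
  note gl2 = glider_tensor_glider[OF assms(1) gl(1) assms(4)] glider_sum_glider[OF gl(2,3)]
  have eq: "f (act (glider_tensor (glider_sum M N) L) g w) = act (glider_sum (glider_tensor M L) (glider_tensor N L)) g (f w)"
    if g: "g \<in> carrier G" for g w
  proof (rule lin_eq_tensorI[OF lin_compose[OF l(1) lin_tensor_act] lin_compose[OF glider_lin[OF gl2(2) g] l(1)]])
    fix x :: "'i + 'j \<Rightarrow>\<^sub>0 'k" and z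
    show "f (act (glider_tensor (glider_sum M N) L) g (tensor_vec x z)) =
       act (glider_sum (glider_tensor M L) (glider_tensor N L)) g (f (tensor_vec x z))"
      by (subst (1 2) push_sum_decomp[of x, symmetric])
         (simp only: T tensor_act_tensor[OF gl(1) assms(4) g] tensor_act_tensor[OF assms(2,4) g]
            tensor_act_tensor[OF assms(3,4) g] glider_sum_act)
  qed
  have "iso_pair G (glider_tensor (glider_sum M N) L) (glider_sum (glider_tensor M L) (glider_tensor N L)) f f'"
    unfolding iso_pair_def glider_tensor_lev glider_sum_lev 
    using l inv eq fwd[OF _ glider_fd0[OF assms(2)] glider_fd0[OF assms(3)] glider_fd0[OF assms(4)]]
      fwd[OF _ glider_fd1[OF assms(2)] glider_fd1[OF assms(3)] glider_fd1[OF assms(4)]]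
      bwd[OF _ glider_fd0[OF assms(2)] glider_fd0[OF assms(3)] glider_fd0[OF assms(4)]]
      bwd[OF _ glider_fd1[OF assms(2)] glider_fd1[OF assms(3)] glider_fd1[OF assms(4)]] by simp
  then show ?thesis
    by (rule iso_pair_isomorphic[OF gl2])
qed

lemma tensor_length_zero: "lev1 M = {0} \<Longrightarrow> lev1 (glider_tensor M N) = {0}"
proof -
  assume "lev1 M = {0}"
  then have "{tensor_vec u v | u v. u \<in> lev1 M \<and> v \<in> lev1 N} \<subseteq> {0}"
    by (auto simp: tensor_eq_0)
  then have "lev1 (glider_tensor M N) \<subseteq> {0}"
    unfolding glider_tensor_lev tensor_levels_def by (rule fvs.span_minimal) simp
  then show ?thesis using fvs.subspace_0[OF subspace_tensor_levels] by (auto simp: glider_tensor_lev)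
qed

section \<open>The monoid of isomorphism classes\<close>

definition ntensor :: "('g, nat \<Rightarrow>\<^sub>0 'k::field) glider \<Rightarrow> ('g, nat \<Rightarrow>\<^sub>0 'k) glider \<Rightarrow> ('g, nat \<Rightarrow>\<^sub>0 'k) glider" where
  "ntensor M N = reindex prod_encode prod_decode (glider_tensor M N)"

lemma ntensor:
  assumes "group G" "is_glider G M" "is_glider G N"
  shows "is_glider G (ntensor M N)" "glider_isomorphic G (glider_tensor M N) (ntensor M N)"
  using reindex_glider[OF glider_tensor_glider[OF assms], of prod_decode prod_encode]
  by (simp_all add: ntensor_def)

definition nsum :: "('g, nat \<Rightarrow>\<^sub>0 'k::field) glider \<Rightarrow> ('g, nat \<Rightarrow>\<^sub>0 'k) glider \<Rightarrow> ('g, nat \<Rightarrow>\<^sub>0 'k) glider" where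
  "nsum M N = reindex sum_encode sum_decode (glider_sum M N)"

lemma nsum:
  assumes "is_glider G M" "is_glider G N"
  shows "is_glider G (nsum M N)" "glider_isomorphic G (glider_sum M N) (nsum M N)"
  using reindex_glider[OF glider_sum_glider[OF assms], of sum_decode sum_encode]
  by (simp_all add: nsum_def)

lemma iso_class_ntensor:
  "group G \<Longrightarrow> is_glider G M \<Longrightarrow> is_glider G N \<Longrightarrow> iso_class G (glider_tensor M N) = iso_class G (ntensor M N)"
  by (intro iso_class_eqI glider_tensor_glider ntensor)

lemma iso_class_nsum:
  "is_glider G M \<Longrightarrow> is_glider G N \<Longrightarrow> iso_class G (glider_sum M N) = iso_class G (nsum M N)"
  by (intro iso_class_eqI glider_sum_glider nsum)

text \<open>
  The product in the monoid is a union over representatives; its members coincide, because tensor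
  products respect isomorphisms.
\<close>
lemma iso_class_mult:
  fixes M N :: "('g, nat \<Rightarrow>\<^sub>0 'k::field) glider"
  assumes "group G" "is_glider G M" "is_glider G N"
  shows "iso_class G M \<otimes>\<^bsub>iso_class_monoid G\<^esub> iso_class G N = iso_class G (glider_tensor M N)"
proof -
  have "iso_class G (glider_tensor M' N') = iso_class G (glider_tensor M N)"
    if "M' \<in> iso_class G M" "N' \<in> iso_class G N" for M' N' :: "('g, nat \<Rightarrow>\<^sub>0 'k::field) glider"
  proof -
    have g: "is_glider G M'" "is_glider G N'" "glider_isomorphic G M M'" "glider_isomorphic G N N'"
      using that by (auto simp: iso_class_def)
    show ?thesis
      using iso_class_eqI[OF _ _ tensor_cong[OF assms g]] glider_tensor_glider[OF assms]
        glider_tensor_glider[OF assms(1) g(1,2)] by simp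
  qed
  then have "(\<Union>M'\<in>iso_class G M. \<Union>N'\<in>iso_class G N. iso_class G (glider_tensor M' N')) =
      (\<Union>M'\<in>iso_class G M. \<Union>N'\<in>iso_class G N. iso_class G (glider_tensor M N))"
    by (intro SUP_cong refl)
  also have "\<dots> = iso_class G (glider_tensor M N)"
    using in_iso_class[OF assms(2)] in_iso_class[OF assms(3)] by blast
  finally show ?thesis by (simp add: iso_class_monoid_def)
qed

lemma iso_class_carrier:
  fixes M :: "('g, nat \<Rightarrow>\<^sub>0 'k::field) glider"
  shows "is_glider G M \<Longrightarrow> iso_class G M \<in> carrier (iso_class_monoid G)"
  by (auto simp: iso_class_monoid_def)

lemma iso_class_carrierE:
  fixes c :: "('g, 'k::field) glider_class"
  assumes "c \<in> carrier (iso_class_monoid G)"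
  obtains M :: "('g, nat \<Rightarrow>\<^sub>0 'k::field) glider" where "is_glider G M" "c = iso_class G M"
  using assms by (auto simp: iso_class_monoid_def)

lemma iso_class_comm_monoid:
  assumes "group G"
  shows "Group.comm_monoid (iso_class_monoid G :: ('g, 'k::field) glider_class monoid)"
proof -
  let ?P = "iso_class_monoid G :: ('g, 'k) glider_class monoid"
  note tg = glider_tensor_glider[OF assms]
  have one_eq: "\<one>\<^bsub>?P\<^esub> = iso_class G (character_glider (\<lambda>_. 1))" by (simp add: iso_class_monoid_def)
  show ?thesis
  proof (rule comm_monoidI)
    fix x y assume x: "x \<in> carrier ?P" and y: "y \<in> carrier ?P"
    obtain M :: "('g, nat \<Rightarrow>\<^sub>0 'k) glider" where M: "is_glider G M" "x = iso_class G M" using x by (rule iso_class_carrierE)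
    obtain N :: "('g, nat \<Rightarrow>\<^sub>0 'k) glider" where N: "is_glider G N" "y = iso_class G N" using y by (rule iso_class_carrierE)
    show "x \<otimes>\<^bsub>?P\<^esub> y \<in> carrier ?P"
      using assms M N by (simp add: iso_class_mult iso_class_ntensor iso_class_carrier ntensor)
    show "x \<otimes>\<^bsub>?P\<^esub> y = y \<otimes>\<^bsub>?P\<^esub> x"
      using iso_class_eqI[OF tg tg tensor_commute[OF assms M(1) N(1)]] M N assms by (simp add: iso_class_mult)
  next
    show "\<one>\<^bsub>?P\<^esub> \<in> carrier ?P"
      unfolding one_eq by (rule iso_class_carrier[OF one_glider[OF assms]])
  next
    fix x y z assume x: "x \<in> carrier ?P" and y: "y \<in> carrier ?P" and z: "z \<in> carrier ?P"
    obtain M :: "('g, nat \<Rightarrow>\<^sub>0 'k) glider" where M: "is_glider G M" "x = iso_class G M" using x by (rule iso_class_carrierE)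
    obtain N :: "('g, nat \<Rightarrow>\<^sub>0 'k) glider" where N: "is_glider G N" "y = iso_class G N" using y by (rule iso_class_carrierE)
    obtain L :: "('g, nat \<Rightarrow>\<^sub>0 'k) glider" where L: "is_glider G L" "z = iso_class G L" using z by (rule iso_class_carrierE)
    note MN = ntensor[OF assms M(1) N(1)] and NL = ntensor[OF assms N(1) L(1)]
    have "x \<otimes>\<^bsub>?P\<^esub> y \<otimes>\<^bsub>?P\<^esub> z = iso_class G (glider_tensor (ntensor M N) L)"
      using M N L assms MN by (simp add: iso_class_mult iso_class_ntensor[of G M N])
    also have "\<dots> = iso_class G (glider_tensor (glider_tensor M N) L)"
      by (rule iso_class_eqI[OF tg[OF tg[OF M(1) N(1)] L(1)] tg[OF MN(1) L(1)]
           tensor_cong[OF assms tg[OF M(1) N(1)] L(1) MN(1) L(1) MN(2) isomorphic_refl[OF L(1)]], symmetric])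
    also have "\<dots> = iso_class G (glider_tensor M (glider_tensor N L))"
      by (rule iso_class_eqI[OF tg[OF tg[OF M(1) N(1)] L(1)] tg[OF M(1) tg[OF N(1) L(1)]] tensor_assoc[OF assms M(1) N(1) L(1)]])
    also have "\<dots> = iso_class G (glider_tensor M (ntensor N L))"
      by (rule iso_class_eqI[OF tg[OF M(1) tg[OF N(1) L(1)]] tg[OF M(1) NL(1)]
           tensor_cong[OF assms M(1) tg[OF N(1) L(1)] M(1) NL(1) isomorphic_refl[OF M(1)] NL(2)]])
    also have "\<dots> = x \<otimes>\<^bsub>?P\<^esub> (y \<otimes>\<^bsub>?P\<^esub> z)"
      using M N L assms NL by (simp add: iso_class_mult iso_class_ntensor[of G N L])
    finally show "x \<otimes>\<^bsub>?P\<^esub> y \<otimes>\<^bsub>?P\<^esub> z = x \<otimes>\<^bsub>?P\<^esub> (y \<otimes>\<^bsub>?P\<^esub> z)" .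
  next
    fix x assume x: "x \<in> carrier ?P"
    obtain M :: "('g, nat \<Rightarrow>\<^sub>0 'k) glider" where M: "is_glider G M" "x = iso_class G M" using x by (rule iso_class_carrierE)
    have "iso_class G (character_glider (\<lambda>_. 1)) \<otimes>\<^bsub>?P\<^esub> iso_class G M = iso_class G (glider_tensor (character_glider (\<lambda>_. 1)) M)"
      by (rule iso_class_mult[OF assms one_glider[OF assms] M(1)])
    also have "\<dots> = iso_class G M"
      by (rule iso_class_eqI[OF tg[OF one_glider[OF assms] M(1)] M(1) tensor_unit[OF assms M(1)]])
    finally show "\<one>\<^bsub>?P\<^esub> \<otimes>\<^bsub>?P\<^esub> x = x" by (simp only: one_eq M(2))
  qed
qed

section \<open>Monoid algebras, quotients and tensor products of rings\<close>

definition convolution :: "('a, 'm) monoid_scheme \<Rightarrow> ('a \<Rightarrow>\<^sub>0 'r::comm_ring_1) \<Rightarrow> ('a \<Rightarrow>\<^sub>0 'r) \<Rightarrow> ('a \<Rightarrow>\<^sub>0 'r)" where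
  "convolution M x y = (\<Sum>a\<in>keys x. \<Sum>b\<in>keys y. single (a \<otimes>\<^bsub>M\<^esub> b) (lookup x a * lookup y b))"

lemma monoid_algebra_simps [simp]:
  "carrier (monoid_algebra M) = {x. keys x \<subseteq> carrier M}" "\<zero>\<^bsub>monoid_algebra M\<^esub> = 0"
  "x \<oplus>\<^bsub>monoid_algebra M\<^esub> y = x + y" "x \<otimes>\<^bsub>monoid_algebra M\<^esub> y = convolution M x y"
  "\<one>\<^bsub>monoid_algebra M\<^esub> = single \<one>\<^bsub>M\<^esub> 1"
  by (simp_all add: monoid_algebra_def convolution_def)

lemma convolution_superset:
  assumes "finite A" "keys x \<subseteq> A" "finite B" "keys y \<subseteq> B"
  shows "convolution M x y = (\<Sum>a\<in>A. \<Sum>b\<in>B. single (a \<otimes>\<^bsub>M\<^esub> b) (lookup x a * lookup y b))"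
proof -
  have "convolution M x y = (\<Sum>a\<in>keys x. \<Sum>b\<in>B. single (a \<otimes>\<^bsub>M\<^esub> b) (lookup x a * lookup y b))"
    unfolding convolution_def using assms
    by (intro sum.cong refl sum.mono_neutral_left) (auto simp: in_keys_iff)
  also have "\<dots> = (\<Sum>a\<in>A. \<Sum>b\<in>B. single (a \<otimes>\<^bsub>M\<^esub> b) (lookup x a * lookup y b))"
    using assms by (intro sum.mono_neutral_left) (auto simp: in_keys_iff)
  finally show ?thesis .
qed

lemma convolution_add_left: "convolution M (x + x') y = convolution M x y + convolution M x' y"
proof -
  have "keys (x + x') \<subseteq> keys x \<union> keys x'" by (rule keys_add)
  then show ?thesis
    by (simp add: convolution_superset[of "keys x \<union> keys x'" _ "keys y"] lookup_add distrib_right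
        single_add sum.distrib)
qed

lemma convolution_add_right: "convolution M x (y + y') = convolution M x y + convolution M x y'"
proof -
  have "keys (y + y') \<subseteq> keys y \<union> keys y'" by (rule keys_add)
  then show ?thesis
    by (simp add: convolution_superset[of "keys x" _ "keys y \<union> keys y'"] lookup_add distrib_left
        single_add sum.distrib)
qed

lemma convolution_single [simp]: "convolution M (single a c) (single b d) = single (a \<otimes>\<^bsub>M\<^esub> b) (c * d)"
  by (subst convolution_superset[of "{a}" _ "{b}"]) auto

lemma convolution_zero [simp]: "convolution M 0 y = 0" "convolution M x 0 = 0"
  by (simp_all add: convolution_def)

text \<open>
  The identities of the monoid algebra are additive in each variable, so they need to be checked on
  monomials only.
\<close>
lemma poly_mapping_single_induct [consumes 1, case_names zero single add]:
  assumes "keys x \<subseteq> C" "P 0" "\<And>a c. a \<in> C \<Longrightarrow> P (single a c)"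
    "\<And>x y. keys x \<subseteq> C \<Longrightarrow> keys y \<subseteq> C \<Longrightarrow> P x \<Longrightarrow> P y \<Longrightarrow> P (x + y)"
  shows "P (x :: 'a \<Rightarrow>\<^sub>0 'r::comm_ring_1)"
proof -
  have "keys (\<Sum>i\<in>A. single i (lookup x i)) \<subseteq> C \<and> P (\<Sum>i\<in>A. single i (lookup x i))"
    if "finite A" "A \<subseteq> C" for A
    using that
  proof (induction A)
    case (insert i A)
    then show ?case
      using assms(3)[of i "lookup x i"] assms(4)[of "single i (lookup x i)" "\<Sum>i\<in>A. single i (lookup x i)"]
        keys_add[of "single i (lookup x i)" "\<Sum>i\<in>A. single i (lookup x i)"]
      by (auto split: if_splits)
  qed (use assms(2) in simp)
  then show ?thesis using sum_singles[of "keys x" x] assms(1) by (metis finite_keys order_refl)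
qed

lemma keys_add_subset: "keys x \<subseteq> C \<Longrightarrow> keys y \<subseteq> C \<Longrightarrow> keys (x + y) \<subseteq> C"
  using keys_add[of x y] by blast

lemma monoid_algebra_cring:
  assumes "Group.comm_monoid M"
  shows "cring (monoid_algebra M :: ('a \<Rightarrow>\<^sub>0 'r::comm_ring_1) ring)"
proof -
  interpret Group.comm_monoid M by fact
  let ?C = "carrier M"
  have closed: "keys (convolution M x y) \<subseteq> ?C" if "keys x \<subseteq> ?C" "keys y \<subseteq> ?C" for x y :: "'a \<Rightarrow>\<^sub>0 'r"
    using that(1)
  proof (induction rule: poly_mapping_single_induct)
    case (single a c)
    show ?case using that(2)
    proof (induction rule: poly_mapping_single_induct)
      case (add x y) then show ?case by (simp add: convolution_add_right keys_add_subset)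
    qed (use single in auto)
  next
    case (add x y) then show ?case by (simp add: convolution_add_left keys_add_subset)
  qed simp
  have comm: "convolution M x y = convolution M y x" if "keys x \<subseteq> ?C" "keys y \<subseteq> ?C" for x y :: "'a \<Rightarrow>\<^sub>0 'r"
    using that(1)
  proof (induction rule: poly_mapping_single_induct)
    case (single a c)
    show ?case using that(2)
      by (induction rule: poly_mapping_single_induct)
         (auto simp: convolution_add_left convolution_add_right single mult.commute m_comm)
  qed (auto simp: convolution_add_left convolution_add_right)
  have assoc: "convolution M (convolution M x y) z = convolution M x (convolution M y z)"
    if "keys x \<subseteq> ?C" "keys y \<subseteq> ?C" "keys z \<subseteq> ?C" for x y z :: "'a \<Rightarrow>\<^sub>0 'r"
    using that(1)
  proof (induction rule: poly_mapping_single_induct)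
    case (single a c)
    show ?case using that(2)
    proof (induction rule: poly_mapping_single_induct)
      case (single b d)
      show ?case using that(3)
        by (induction rule: poly_mapping_single_induct)
           (use single \<open>a \<in> ?C\<close> in \<open>auto simp: convolution_add_left convolution_add_right mult.assoc m_assoc\<close>)
    qed (auto simp: convolution_add_left convolution_add_right)
  qed (auto simp: convolution_add_left convolution_add_right)
  have one: "convolution M (single \<one>\<^bsub>M\<^esub> 1) x = x" if "keys x \<subseteq> ?C" for x :: "'a \<Rightarrow>\<^sub>0 'r"
    using that by (induction rule: poly_mapping_single_induct) (auto simp: convolution_add_right)
  show ?thesis
  proof (rule cringI)
    show "abelian_group (monoid_algebra M :: ('a \<Rightarrow>\<^sub>0 'r) ring)"
    proof (rule abelian_groupI)
      fix x :: "'a \<Rightarrow>\<^sub>0 'r" assume "x \<in> carrier (monoid_algebra M)"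
      then show "\<exists>y\<in>carrier (monoid_algebra M). y \<oplus>\<^bsub>monoid_algebra M\<^esub> x = \<zero>\<^bsub>monoid_algebra M\<^esub>"
        by (intro bexI[of _ "- x"]) (auto simp: in_keys_iff)
    qed (auto simp: algebra_simps intro: subsetD[OF keys_add_subset])
    show "Group.comm_monoid (monoid_algebra M :: ('a \<Rightarrow>\<^sub>0 'r) ring)"
      by (rule comm_monoidI, simp add: closed, simp, simp add: assoc, simp add: one, simp, rule comm)
  qed (auto simp: convolution_add_left)
qed

lemma monoid_algebra_minus:
  assumes "Group.comm_monoid M" "keys x \<subseteq> carrier M"
  shows "\<ominus>\<^bsub>monoid_algebra M\<^esub> x = - (x :: 'a \<Rightarrow>\<^sub>0 'r::comm_ring_1)"
proof -
  interpret cring "monoid_algebra M :: ('a \<Rightarrow>\<^sub>0 'r) ring" by (rule monoid_algebra_cring[OF assms(1)])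
  show ?thesis
    by (rule minus_equality) (use assms(2) in \<open>auto simp: in_keys_iff\<close>)
qed


subsection \<open>Additive spans\<close>

context ring
begin

lemma additive_span_minus:
  assumes "B \<subseteq> carrier R" "x \<in> additive_span R B" shows "\<ominus> x \<in> additive_span R B"
  using add.generate_m_inv_closed[of B x] assms by (simp add: a_inv_def)

lemma additive_span_carrier: "B \<subseteq> carrier R \<Longrightarrow> additive_span R B \<subseteq> carrier R"
  using add.generate_incl by simp

lemma additive_span_base: "x \<in> B \<Longrightarrow> x \<in> additive_span R B"
  by (rule generate.incl)

lemma additive_span_add: "x \<in> additive_span R B \<Longrightarrow> y \<in> additive_span R B \<Longrightarrow> x \<oplus> y \<in> additive_span R B"
  using generate.eng[of x "add_monoid R" B y] by simp

lemma additive_span_zero: "\<zero> \<in> additive_span R B"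
  using generate.one[of "add_monoid R" B] by simp

lemma additive_span_induct [consumes 2, case_names zero base add minus]:
  assumes "x \<in> additive_span R B" "B \<subseteq> carrier R" "P \<zero>" "\<And>x. x \<in> B \<Longrightarrow> P x"
    "\<And>x y. x \<in> carrier R \<Longrightarrow> y \<in> carrier R \<Longrightarrow> P x \<Longrightarrow> P y \<Longrightarrow> P (x \<oplus> y)"
    "\<And>x. x \<in> carrier R \<Longrightarrow> P x \<Longrightarrow> P (\<ominus> x)"
  shows "P x"
proof -
  have "x \<in> carrier R \<and> P x"
    using assms(1)
  proof (induction rule: generate.induct)
    case (inv h)
    then show ?case using assms(2,4,6) by (auto simp: a_inv_def[symmetric])
  qed (use assms(2-5) in auto)
  then show ?thesis by simp
qed

end

text \<open>
  A subgroup is an ideal as soon as its generators stay in it under multiplication by additive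
  generators of the ring.
\<close>
lemma (in cring) additive_span_ideal:
  assumes "B \<subseteq> carrier R" "E \<subseteq> carrier R" "carrier R \<subseteq> additive_span R E"
    and stable: "\<And>e x. e \<in> E \<Longrightarrow> x \<in> B \<Longrightarrow> e \<otimes> x \<in> additive_span R B"
  shows "ideal (additive_span R B) R"
proof (rule idealI)
  show "ring R" by (rule ring_axioms)
  show "subgroup (additive_span R B) (add_monoid R)"
    using add.generate_is_subgroup[of B] assms(1) by simp
  have l: "r \<otimes> a \<in> additive_span R B" if a: "a \<in> additive_span R B" and r: "r \<in> carrier R" for a r
  proof -
    have ra: "r \<otimes> x \<in> additive_span R B" if x: "x \<in> B" for x
    proof -
      have "r \<in> additive_span R E" using r assms(3) by auto
      then show ?thesis using assms(2)
      proof (induction rule: additive_span_induct)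
        case (base e) then show ?case using stable x by blast
      next
        case (add r s) then show ?case using additive_span_add x assms(1) by (auto simp: l_distr)
      next
        case (minus r) then show ?case using additive_span_minus[OF assms(1)] x assms(1) by (auto simp: l_minus)
      next
        case zero then show ?case using x assms(1) additive_span_zero by auto
      qed
    qed
    show ?thesis using a assms(1)
    proof (induction rule: additive_span_induct)
      case (add x y) then show ?case using additive_span_add r by (auto simp: r_distr)
    next
      case (minus x) then show ?case using additive_span_minus[OF assms(1)] r by (auto simp: r_minus)
    next
      case zero then show ?case using r additive_span_zero by auto
    qed (rule ra)
  qed
  show "\<And>a r. a \<in> additive_span R B \<Longrightarrow> r \<in> carrier R \<Longrightarrow> r \<otimes> a \<in> additive_span R B" by (rule l)
  show "a \<otimes> r \<in> additive_span R B" if "a \<in> additive_span R B" "r \<in> carrier R" for a r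
    using l[OF that] m_comm[of a r] that additive_span_carrier[OF assms(1)] by auto
qed

lemma monoid_algebra_int_span:
  assumes "Group.comm_monoid M"
  shows "carrier (monoid_algebra M :: ('a \<Rightarrow>\<^sub>0 int) ring) \<subseteq> additive_span (monoid_algebra M) ((\<lambda>m. single m 1) ` carrier M)"
proof
  interpret cring "monoid_algebra M :: ('a \<Rightarrow>\<^sub>0 int) ring" by (rule monoid_algebra_cring[OF assms])
  let ?E = "(\<lambda>m. single m 1) ` carrier M :: ('a \<Rightarrow>\<^sub>0 int) set"
  have E: "?E \<subseteq> carrier (monoid_algebra M)" by auto
  define A where "A = additive_span (monoid_algebra M) ?E"
  have A0: "0 \<in> A" using additive_span_zero[of ?E] unfolding A_def[symmetric] by simp
  have Aadd: "x + y \<in> A" if "x \<in> A" "y \<in> A" for x y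
    using additive_span_add[of x ?E y] that unfolding A_def[symmetric] by simp
  have A1: "single m 1 \<in> A" "- single m 1 \<in> A" if "m \<in> carrier M" for m
  proof -
    show "single m 1 \<in> A" unfolding A_def using that by (intro additive_span_base) auto
    then show "- single m 1 \<in> A"
      using additive_span_minus[OF E, of "single m 1"] monoid_algebra_minus[OF assms, of "single m (1::int)"] that
      unfolding A_def[symmetric] by simp
  qed
  have s: "single m n \<in> A" if m: "m \<in> carrier M" for m and n :: int
  proof (induction n rule: int_induct[of _ 0])
    case base show ?case using A0 by simp
  next
    case (step1 i)
    then show ?case using Aadd[OF _ A1(1)[OF m], of "single m i"] by (simp add: single_add)
  next
    case (step2 i)
    then show ?case using Aadd[OF _ A1(2)[OF m], of "single m i"] by (simp add: single_diff)
  qed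
  fix x :: "'a \<Rightarrow>\<^sub>0 int" assume "x \<in> carrier (monoid_algebra M)"
  then have "keys x \<subseteq> carrier M" by simp
  then show "x \<in> additive_span (monoid_algebra M) ?E"
    unfolding A_def[symmetric]
    by (induction rule: poly_mapping_single_induct) (auto intro: A0 Aadd s)
qed


subsection \<open>Additive functions on quotients\<close>

definition additive_map :: "('a, 'm) ring_scheme \<Rightarrow> ('a \<Rightarrow> 'b::ab_group_add) \<Rightarrow> bool" where
  "additive_map R \<delta> \<longleftrightarrow> (\<forall>x\<in>carrier R. \<forall>y\<in>carrier R. \<delta> (x \<oplus>\<^bsub>R\<^esub> y) = \<delta> x + \<delta> y)"

lemma (in ring) additive_map_zero: "additive_map R \<delta> \<Longrightarrow> \<delta> \<zero> = 0"
  by (metis additive_map_def add_cancel_right_right l_zero zero_closed)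

lemma (in ring) additive_map_minus: "additive_map R \<delta> \<Longrightarrow> x \<in> carrier R \<Longrightarrow> \<delta> (\<ominus> x) = - \<delta> x"
  using additive_map_zero[of \<delta>] r_neg[of x] unfolding additive_map_def
  by (metis a_inv_closed add.commute eq_neg_iff_add_eq_0)

lemma (in ring) additive_map_span_zero:
  assumes "additive_map R \<delta>" "B \<subseteq> carrier R" "\<And>x. x \<in> B \<Longrightarrow> \<delta> x = 0" "x \<in> additive_span R B"
  shows "\<delta> x = 0"
  using assms(4,2)
proof (induction rule: additive_span_induct)
  case (add x y) then show ?case using assms(1) by (simp add: additive_map_def)
next
  case (minus x) then show ?case using additive_map_minus[OF assms(1)] by simp
qed (use assms additive_map_zero in auto)

text \<open>
  The value of a function at an arbitrary element of a coset. This is the induced function on the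
  quotient when the function is additive and vanishes on the ideal.
\<close>
definition coset_lift :: "('a \<Rightarrow> 'b) \<Rightarrow> 'a set \<Rightarrow> 'b" where
  "coset_lift \<delta> C = \<delta> (SOME x. x \<in> C)"

context ideal
begin

lemma quot_simps:
  "x \<in> carrier R \<Longrightarrow> y \<in> carrier R \<Longrightarrow> (I +> x) \<oplus>\<^bsub>R Quot I\<^esub> (I +> y) = I +> (x \<oplus> y)"
  "x \<in> carrier R \<Longrightarrow> y \<in> carrier R \<Longrightarrow> (I +> x) \<otimes>\<^bsub>R Quot I\<^esub> (I +> y) = I +> (x \<otimes> y)"
  "\<one>\<^bsub>R Quot I\<^esub> = I +> \<one>" "\<zero>\<^bsub>R Quot I\<^esub> = I"
  by (simp_all add: FactRing_def a_rcos_sum rcoset_mult_add)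

lemma coset_zero: "I +> \<zero> = I"
  using a_rcos_zero[OF is_ideal] additive_subgroup.zero_closed[OF additive_subgroup_axioms] by blast

lemma quot_carrier: "carrier (R Quot I) = (\<lambda>x. I +> x) ` carrier R"
  by (auto simp: FactRing_simps)

lemma quot_minus: "x \<in> carrier R \<Longrightarrow> \<ominus>\<^bsub>R Quot I\<^esub> (I +> x) = I +> (\<ominus> x)"
proof -
  assume x: "x \<in> carrier R"
  interpret Q: ring "R Quot I" by (rule quotient_is_ring)
  show "\<ominus>\<^bsub>R Quot I\<^esub> (I +> x) = I +> (\<ominus> x)"
  proof (rule Q.minus_equality)
    have "(I +> (\<ominus> x)) \<oplus>\<^bsub>R Quot I\<^esub> (I +> x) = I +> (\<ominus> x \<oplus> x)"
      by (rule quot_simps(1)) (use x in auto)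
    also have "\<dots> = \<zero>\<^bsub>R Quot I\<^esub>" using x by (simp only: l_neg coset_zero quot_simps(4))
    finally show "(I +> (\<ominus> x)) \<oplus>\<^bsub>R Quot I\<^esub> (I +> x) = \<zero>\<^bsub>R Quot I\<^esub>" .
  qed (use x in \<open>auto simp: quot_carrier\<close>)
qed

lemma coset_lift:
  assumes "additive_map R \<delta>" "\<And>i. i \<in> I \<Longrightarrow> \<delta> i = 0" "x \<in> carrier R"
  shows "coset_lift \<delta> (I +> x) = \<delta> x"
proof -
  have "\<exists>y. y \<in> I +> x" using a_rcos_self[OF assms(3)] by blast
  then have "(SOME y. y \<in> I +> x) \<in> I +> x" by (rule someI_ex)
  then obtain i where i: "i \<in> I" "(SOME y. y \<in> I +> x) = i \<oplus> x" by (auto simp: a_r_coset_def')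
  then show ?thesis
    using assms by (simp add: coset_lift_def additive_map_def)
qed

lemma additive_coset_lift:
  assumes "additive_map R \<delta>" "\<And>i. i \<in> I \<Longrightarrow> \<delta> i = 0"
  shows "additive_map (R Quot I) (coset_lift \<delta>)"
  using assms(1) by (auto simp: additive_map_def quot_carrier quot_simps coset_lift[OF assms])

lemma quot_span:
  assumes "carrier R \<subseteq> additive_span R E" "E \<subseteq> carrier R"
  shows "carrier (R Quot I) \<subseteq> additive_span (R Quot I) ((\<lambda>x. I +> x) ` E)"
proof
  interpret Q: ring "R Quot I" by (rule quotient_is_ring)
  let ?E = "(\<lambda>x. I +> x) ` E"
  have E: "?E \<subseteq> carrier (R Quot I)" using assms(2) by (auto simp: quot_carrier)
  fix c assume "c \<in> carrier (R Quot I)"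
  then obtain x where x: "x \<in> carrier R" "c = I +> x" by (auto simp: quot_carrier)
  define A where "A = additive_span (R Quot I) ?E"
  have A0: "I \<in> A" using Q.additive_span_zero[of ?E] unfolding A_def[symmetric] by (simp add: quot_simps)
  have Aadd: "a \<oplus>\<^bsub>R Quot I\<^esub> b \<in> A" if "a \<in> A" "b \<in> A" for a b
    using Q.additive_span_add[of a ?E b] that unfolding A_def[symmetric] by simp
  have Amin: "\<ominus>\<^bsub>R Quot I\<^esub> a \<in> A" if "a \<in> A" for a
    using Q.additive_span_minus[OF E] that unfolding A_def[symmetric] by simp
  have "x \<in> additive_span R E" using x assms by auto
  then have "I +> x \<in> A" using assms(2)
  proof (induction rule: additive_span_induct)
    case zero show ?case using A0 by (simp only: coset_zero)
  next
    case (base x) then show ?case unfolding A_def by (intro Q.additive_span_base) auto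
  next
    case (add x y) then show ?case using Aadd by (auto simp flip: quot_simps(1))
  next
    case (minus x) then show ?case using Amin by (auto simp flip: quot_minus)
  qed
  then show "c \<in> additive_span (R Quot I) ?E" using x unfolding A_def by simp
qed

end


subsection \<open>Products\<close>

lemma product_ring_ring:
  assumes "\<And>i. i \<in> I \<Longrightarrow> ring (R i)"
  shows "ring (product_ring I R)"
proof (rule ringI)
  have neg: "\<ominus>\<^bsub>R i\<^esub> x \<in> carrier (R i)" "\<ominus>\<^bsub>R i\<^esub> x \<oplus>\<^bsub>R i\<^esub> x = \<zero>\<^bsub>R i\<^esub>"
    if "i \<in> I" "x \<in> carrier (R i)" for i x
    using abelian_group.a_inv_closed[OF ring.is_abelian_group[OF assms]]
      abelian_group.l_neg[OF ring.is_abelian_group[OF assms]] that by blast+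
  show "abelian_group (product_ring I R)"
  proof (rule abelian_groupI)
    fix x assume x: "x \<in> carrier (product_ring I R)"
    then show "\<exists>y\<in>carrier (product_ring I R). y \<oplus>\<^bsub>product_ring I R\<^esub> x = \<zero>\<^bsub>product_ring I R\<^esub>"
      using assms
      by (intro bexI[of _ "\<lambda>i\<in>I. \<ominus>\<^bsub>R i\<^esub> x i"])
         (auto simp: product_ring_def fun_eq_iff PiE_def Pi_def neg)
  qed (use assms in \<open>auto simp: product_ring_def fun_eq_iff PiE_def Pi_def extensional_def ring.ring_simprules\<close>)
  have r1: "a \<otimes>\<^bsub>R i\<^esub> \<one>\<^bsub>R i\<^esub> = a" if "i \<in> I" "a \<in> carrier (R i)" for i a
    using monoid.r_one[OF ring.is_monoid[OF assms]] that by blast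
  show "Group.monoid (product_ring I R)"
  proof (rule monoidI)
    fix x assume "x \<in> carrier (product_ring I R)"
    then show "x \<otimes>\<^bsub>product_ring I R\<^esub> \<one>\<^bsub>product_ring I R\<^esub> = x"
      by (auto simp: product_ring_def fun_eq_iff PiE_def Pi_def extensional_def r1)
  qed (use assms in \<open>auto simp: product_ring_def fun_eq_iff PiE_def Pi_def extensional_def ring.ring_simprules\<close>)
qed (use assms in \<open>auto simp: product_ring_def fun_eq_iff PiE_def Pi_def extensional_def ring.ring_simprules\<close>)


subsection \<open>Tensor products over the integers\<close>

locale tensor_of_crings = R: cring R + S: cring S for R :: "('a, 'm) ring_scheme" and S :: "('b, 'n) ring_scheme"
begin

abbreviation "Z \<equiv> monoid_algebra (R \<times>\<times> S) :: ('a \<times> 'b \<Rightarrow>\<^sub>0 int) ring"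
abbreviation sym :: "'a \<Rightarrow> 'b \<Rightarrow> ('a \<times> 'b \<Rightarrow>\<^sub>0 int)" where "sym r s \<equiv> single (r, s) 1"

lemma dirprod_monoid: "Group.comm_monoid (R \<times>\<times> S)"
  by (rule comm_monoidI)
     (auto simp: DirProd_def R.m_assoc S.m_assoc R.m_comm S.m_comm R.m_lcomm S.m_lcomm)

sublocale Z: cring Z
  by (rule monoid_algebra_cring[OF dirprod_monoid])

lemma Z_minus: "x \<in> carrier Z \<Longrightarrow> \<ominus>\<^bsub>Z\<^esub> x = - x"
  using monoid_algebra_minus[OF dirprod_monoid] by simp

lemma Z_diff: "x \<in> carrier Z \<Longrightarrow> y \<in> carrier Z \<Longrightarrow> x \<ominus>\<^bsub>Z\<^esub> y = x - y"
  by (simp add: a_minus_def Z_minus del: monoid_algebra_simps(1))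

lemma sym_carrier: "r \<in> carrier R \<Longrightarrow> s \<in> carrier S \<Longrightarrow> keys (sym r s) \<subseteq> carrier (R \<times>\<times> S)"
  by (auto simp: DirProd_def)

lemma diff_carrier: "keys x \<subseteq> C \<Longrightarrow> keys y \<subseteq> C \<Longrightarrow> keys (x - y :: 'c \<Rightarrow>\<^sub>0 int) \<subseteq> C"
  using keys_diff[of x y] by blast

lemma relations_carrier: "tensor_relations R S \<subseteq> carrier Z"
proof -
  have "sym (r \<oplus>\<^bsub>R\<^esub> r') s - sym r s - sym r' s \<in> carrier Z"
    if "r \<in> carrier R" "r' \<in> carrier R" "s \<in> carrier S" for r r' s
    unfolding monoid_algebra_simps mem_Collect_eq using that by (intro diff_carrier sym_carrier R.a_closed)
  moreover have "sym r (s \<oplus>\<^bsub>S\<^esub> s') - sym r s - sym r s' \<in> carrier Z"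
    if "r \<in> carrier R" "s \<in> carrier S" "s' \<in> carrier S" for r s s'
    unfolding monoid_algebra_simps mem_Collect_eq using that by (intro diff_carrier sym_carrier S.a_closed)
  ultimately show ?thesis unfolding tensor_relations_def by blast
qed

lemma convolution_diff_right: "convolution (R \<times>\<times> S) x (y - z) = convolution (R \<times>\<times> S) x y - convolution (R \<times>\<times> S) x (z :: _ \<Rightarrow>\<^sub>0 int)"
  using convolution_add_right[of "R \<times>\<times> S" x "y - z" z] by simp

lemma tensor_ideal: "ideal (tensor_ideal R S) Z"
  unfolding tensor_ideal_def
proof (rule Z.additive_span_ideal[OF relations_carrier _ monoid_algebra_int_span[OF dirprod_monoid]])
  show "(\<lambda>m. single m 1) ` carrier (R \<times>\<times> S) \<subseteq> carrier Z" by auto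
  fix e x assume "e \<in> (\<lambda>m. single m (1::int)) ` carrier (R \<times>\<times> S)" and x: "x \<in> tensor_relations R S"
  then obtain a b where ab: "a \<in> carrier R" "b \<in> carrier S" "e = sym a b" by (auto simp: DirProd_def)
  have rel: "sym (r \<oplus>\<^bsub>R\<^esub> r') s - sym r s - sym r' s \<in> tensor_relations R S"
    if "r \<in> carrier R" "r' \<in> carrier R" "s \<in> carrier S" for r r' s
    unfolding tensor_relations_def using that by blast
  have rel': "sym r (s \<oplus>\<^bsub>S\<^esub> s') - sym r s - sym r s' \<in> tensor_relations R S"
    if "r \<in> carrier R" "s \<in> carrier S" "s' \<in> carrier S" for r s s'
    unfolding tensor_relations_def using that by blast
  have c: "convolution (R \<times>\<times> S) e (sym r s) = sym (a \<otimes>\<^bsub>R\<^esub> r) (b \<otimes>\<^bsub>S\<^esub> s)" for r s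
    by (simp add: ab(3) DirProd_def)
  consider r r' s where "r \<in> carrier R" "r' \<in> carrier R" "s \<in> carrier S" "x = sym (r \<oplus>\<^bsub>R\<^esub> r') s - sym r s - sym r' s"
    | r s s' where "r \<in> carrier R" "s \<in> carrier S" "s' \<in> carrier S" "x = sym r (s \<oplus>\<^bsub>S\<^esub> s') - sym r s - sym r s'"
    using x unfolding tensor_relations_def by blast
  then have "e \<otimes>\<^bsub>Z\<^esub> x \<in> tensor_relations R S"
  proof cases
    case 1
    then show ?thesis
      using ab(1,2) rel[of "a \<otimes>\<^bsub>R\<^esub> r" "a \<otimes>\<^bsub>R\<^esub> r'" "b \<otimes>\<^bsub>S\<^esub> s"] by (simp add: convolution_diff_right c R.r_distr)
  next
    case 2
    then show ?thesis
      using ab(1,2) rel'[of "a \<otimes>\<^bsub>R\<^esub> r" "b \<otimes>\<^bsub>S\<^esub> s" "b \<otimes>\<^bsub>S\<^esub> s'"] by (simp add: convolution_diff_right c S.r_distr)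
  qed
  then show "e \<otimes>\<^bsub>Z\<^esub> x \<in> additive_span Z (tensor_relations R S)" by (rule Z.additive_span_base)
qed

sublocale I: ideal "tensor_ideal R S" Z by (rule tensor_ideal)

lemma tensor_cring: "cring (tensor_ring R S)"
  unfolding tensor_ring_def by (rule I.quotient_is_cring[OF Z.is_cring])

sublocale T: cring "tensor_ring R S" by (rule tensor_cring)

lemma coset_eqI:
  assumes "x \<in> carrier Z" "y \<in> carrier Z" "x - y \<in> tensor_ideal R S"
  shows "tensor_ideal R S +>\<^bsub>Z\<^esub> x = tensor_ideal R S +>\<^bsub>Z\<^esub> y"
  using Z.quotient_eq_iff_same_a_r_cos[OF tensor_ideal assms(1,2)] assms Z_diff by simp

lemma pure_carrier: "r \<in> carrier R \<Longrightarrow> s \<in> carrier S \<Longrightarrow> pure_tensor R S r s \<in> carrier (tensor_ring R S)"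
  unfolding pure_tensor_def tensor_ring_def I.quot_carrier by (auto simp: DirProd_def)

lemma pure_mult:
  assumes "r \<in> carrier R" "s \<in> carrier S" "r' \<in> carrier R" "s' \<in> carrier S"
  shows "pure_tensor R S r s \<otimes>\<^bsub>tensor_ring R S\<^esub> pure_tensor R S r' s' = pure_tensor R S (r \<otimes>\<^bsub>R\<^esub> r') (s \<otimes>\<^bsub>S\<^esub> s')"
  using assms unfolding pure_tensor_def tensor_ring_def by (subst I.quot_simps) (auto simp: DirProd_def)

lemma pure_one: "\<one>\<^bsub>tensor_ring R S\<^esub> = pure_tensor R S \<one>\<^bsub>R\<^esub> \<one>\<^bsub>S\<^esub>"
  unfolding pure_tensor_def tensor_ring_def by (subst I.quot_simps) (auto simp: DirProd_def)

lemma pure_add_left: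
  assumes "r \<in> carrier R" "r' \<in> carrier R" "s \<in> carrier S"
  shows "pure_tensor R S (r \<oplus>\<^bsub>R\<^esub> r') s = pure_tensor R S r s \<oplus>\<^bsub>tensor_ring R S\<^esub> pure_tensor R S r' s"
proof -
  have "sym (r \<oplus>\<^bsub>R\<^esub> r') s - sym r s - sym r' s \<in> tensor_ideal R S"
    unfolding tensor_ideal_def by (rule Z.additive_span_base) (use assms in \<open>auto simp: tensor_relations_def\<close>)
  then have "tensor_ideal R S +>\<^bsub>Z\<^esub> sym (r \<oplus>\<^bsub>R\<^esub> r') s = tensor_ideal R S +>\<^bsub>Z\<^esub> (sym r s + sym r' s)"
    using assms keys_add[of "sym r s" "sym r' s"]
    by (intro coset_eqI) (auto simp: DirProd_def algebra_simps)
  then show ?thesis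
    using assms unfolding pure_tensor_def tensor_ring_def by (subst I.quot_simps) (auto simp: DirProd_def)
qed

lemma pure_add_right:
  assumes "r \<in> carrier R" "s \<in> carrier S" "s' \<in> carrier S"
  shows "pure_tensor R S r (s \<oplus>\<^bsub>S\<^esub> s') = pure_tensor R S r s \<oplus>\<^bsub>tensor_ring R S\<^esub> pure_tensor R S r s'"
proof -
  have "sym r (s \<oplus>\<^bsub>S\<^esub> s') - sym r s - sym r s' \<in> tensor_ideal R S"
    unfolding tensor_ideal_def by (rule Z.additive_span_base) (use assms in \<open>auto simp: tensor_relations_def\<close>)
  then have "tensor_ideal R S +>\<^bsub>Z\<^esub> sym r (s \<oplus>\<^bsub>S\<^esub> s') = tensor_ideal R S +>\<^bsub>Z\<^esub> (sym r s + sym r s')"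
    using assms keys_add[of "sym r s" "sym r s'"]
    by (intro coset_eqI) (auto simp: DirProd_def algebra_simps)
  then show ?thesis
    using assms unfolding pure_tensor_def tensor_ring_def by (subst I.quot_simps) (auto simp: DirProd_def)
qed

lemma pure_zero_left:
  assumes "s \<in> carrier S" shows "pure_tensor R S \<zero>\<^bsub>R\<^esub> s = \<zero>\<^bsub>tensor_ring R S\<^esub>"
  using pure_add_left[of "\<zero>\<^bsub>R\<^esub>" "\<zero>\<^bsub>R\<^esub>" s] assms pure_carrier[of "\<zero>\<^bsub>R\<^esub>" s]
  by (simp add: T.add.r_cancel_one') 

lemma pure_zero_right:
  assumes "r \<in> carrier R" shows "pure_tensor R S r \<zero>\<^bsub>S\<^esub> = \<zero>\<^bsub>tensor_ring R S\<^esub>"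
  using pure_add_right[of r "\<zero>\<^bsub>S\<^esub>" "\<zero>\<^bsub>S\<^esub>"] assms pure_carrier[of r "\<zero>\<^bsub>S\<^esub>"]
  by (simp add: T.add.r_cancel_one') 

lemma pure_minus_left:
  assumes "r \<in> carrier R" "s \<in> carrier S"
  shows "\<ominus>\<^bsub>tensor_ring R S\<^esub> pure_tensor R S r s = pure_tensor R S (\<ominus>\<^bsub>R\<^esub> r) s"
  by (rule T.minus_equality)
     (use assms in \<open>simp_all add: pure_carrier pure_add_left[symmetric] R.l_neg pure_zero_left\<close>)

lemma pure_minus_right:
  assumes "r \<in> carrier R" "s \<in> carrier S"
  shows "pure_tensor R S r (\<ominus>\<^bsub>S\<^esub> s) = pure_tensor R S (\<ominus>\<^bsub>R\<^esub> r) s"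
  unfolding pure_minus_left[OF assms, symmetric]
  by (rule T.minus_equality[symmetric])
     (use assms in \<open>simp_all add: pure_carrier pure_add_right[symmetric] S.l_neg pure_zero_right\<close>)

text \<open>Additive generators of one factor suffice, because signs can be moved to the other factor.\<close>
lemma tensor_induct [consumes 1, case_names pure add]:
  assumes "x \<in> carrier (tensor_ring R S)" and irred_classes: "carrier S \<subseteq> additive_span S irred_classes" "irred_classes \<subseteq> carrier S"
    and pure: "\<And>r w. r \<in> carrier R \<Longrightarrow> w \<in> irred_classes \<Longrightarrow> P (pure_tensor R S r w)"
    and zero: "P \<zero>\<^bsub>tensor_ring R S\<^esub>"
    and add: "\<And>x y. x \<in> carrier (tensor_ring R S) \<Longrightarrow> y \<in> carrier (tensor_ring R S) \<Longrightarrow> P x \<Longrightarrow> P y \<Longrightarrow>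
      P (x \<oplus>\<^bsub>tensor_ring R S\<^esub> y)"
  shows "P x"
proof -
  have ps: "P (pure_tensor R S r s)" if "r \<in> carrier R" "s \<in> carrier S" for r s
  proof -
    have "s \<in> additive_span S irred_classes" using that irred_classes by auto
    then have "\<forall>r\<in>carrier R. P (pure_tensor R S r s)" using irred_classes(2)
    proof (induction rule: S.additive_span_induct)
      case zero then show ?case using assms(5) by (simp add: pure_zero_right)
    next
      case (add x y) then show ?case using assms(6) by (simp add: pure_add_right pure_carrier)
    next
      case (minus x) then show ?case by (simp add: pure_minus_right)
    qed (use pure in auto)
    then show ?thesis using that by blast
  qed
  have E: "(\<lambda>m. single m 1) ` carrier (R \<times>\<times> S) \<subseteq> carrier Z" by auto
  have "x \<in> additive_span (tensor_ring R S) ((\<lambda>z. tensor_ideal R S +>\<^bsub>Z\<^esub> z) ` ((\<lambda>m. single m 1) ` carrier (R \<times>\<times> S)))"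
    using subsetD[OF I.quot_span[OF monoid_algebra_int_span[OF dirprod_monoid] E]] assms(1) unfolding tensor_ring_def .
  also have "(\<lambda>z. tensor_ideal R S +>\<^bsub>Z\<^esub> z) ` ((\<lambda>m. single m 1) ` carrier (R \<times>\<times> S)) =
     {pure_tensor R S r s | r s. r \<in> carrier R \<and> s \<in> carrier S}" (is "_ = ?P")
    by (auto simp: pure_tensor_def DirProd_def image_iff; blast)
  finally have x: "x \<in> additive_span (tensor_ring R S) ?P" .
  have P: "?P \<subseteq> carrier (tensor_ring R S)" using pure_carrier by auto
  have "P x \<and> P (\<ominus>\<^bsub>tensor_ring R S\<^esub> x)"
    using x P
  proof (induction rule: T.additive_span_induct)
    case (base x) then show ?case using ps by (auto simp: pure_minus_left)
  next
    case (add x y) then show ?case using assms(6) by (auto simp: T.minus_add)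
  qed (use zero in auto)
  then show ?thesis by simp
qed

end

section \<open>Gliders generated by one vector\<close>

locale finite_group = group G for G (structure) + assumes finite_carrier: "finite (carrier G)"

lemma dim_image_inj:
  assumes "lin f" "fvs.subspace V" "inj_on f V"
  shows "fvs.dim (f ` V) = fvs.dim V"
proof -
  obtain B where B: "B \<subseteq> V" "fvs.independent B" "V \<subseteq> fvs.span B" "card B = fvs.dim V"
    using fvs.basis_exists by blast
  have sp: "fvs.span B = V" using B assms(2) fvs.span_minimal by blast
  have "fvs.independent (f ` B)"
    using fvs_pair.linear_independent_injective_image[OF assms(1) B(2)] assms(3) sp by simp
  moreover have "f ` V = fvs.span (f ` B)"
    using fvs_pair.linear_span_image[OF assms(1)] sp by simp
  moreover have "card (f ` B) = card B"
    using assms(3) B(1) by (meson card_image inj_on_subset)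
  ultimately show ?thesis using B(4) fvs.dim_span_eq_card_independent by metis
qed

lemma dim_zero: "fvs.dim {0 :: 'i \<Rightarrow>\<^sub>0 'k::field} = 0"
  by (rule fvs.dim_unique[of "{}"]) (auto simp: fvs.independent_empty)

lemma dim_line: "u \<noteq> 0 \<Longrightarrow> fvs.dim (fvs.span {u :: 'i \<Rightarrow>\<^sub>0 'k::field}) = 1"
  by (subst fvs.dim_span_eq_card_independent) auto

lemma dim_sum_levels:
  fixes V :: "('i \<Rightarrow>\<^sub>0 'k::field) set" and V' :: "('j \<Rightarrow>\<^sub>0 'k) set"
  assumes "finite_dim_subspace V" "finite_dim_subspace V'"
  shows "fvs.dim (sum_levels V V') = fvs.dim V + fvs.dim V'"
proof -
  have bas: "\<exists>B. finite B \<and> fvs.independent B \<and> fvs.span B = U \<and> card B = fvs.dim U"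
    if U: "finite_dim_subspace U" for U :: "('x \<Rightarrow>\<^sub>0 'k) set"
  proof -
    obtain C where C: "finite C" "fvs.span C = U" using U by (auto simp: finite_dim_subspace_def)
    obtain B where B: "B \<subseteq> U" "fvs.independent B" "U \<subseteq> fvs.span B" "card B = fvs.dim U"
      using fvs.basis_exists by blast
    have "fvs.span B = U" using B U fvs.span_minimal unfolding finite_dim_subspace_def by blast
    moreover have "finite B" using fvs.independent_span_bound[OF C(1) B(2)] B(1) C(2) by simp
    ultimately show ?thesis using B by blast
  qed
  obtain B where B: "finite B" "fvs.independent B" "fvs.span B = V" "card B = fvs.dim V"
    using bas[OF assms(1)] by blast
  obtain B' where B': "finite B'" "fvs.independent B'" "fvs.span B' = V'" "card B' = fvs.dim V'"
    using bas[OF assms(2)] by blast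
  let ?l = "push_vec Inl :: ('i \<Rightarrow>\<^sub>0 'k) \<Rightarrow> ('i + 'j \<Rightarrow>\<^sub>0 'k)" and ?r = "push_vec Inr :: ('j \<Rightarrow>\<^sub>0 'k) \<Rightarrow> ('i + 'j \<Rightarrow>\<^sub>0 'k)"
  let ?l' = "Poly_Mapping.map_key Inl :: ('i + 'j \<Rightarrow>\<^sub>0 'k) \<Rightarrow> _" and ?r' = "Poly_Mapping.map_key Inr :: ('i + 'j \<Rightarrow>\<^sub>0 'k) \<Rightarrow> _"
  have lin': "lin ?l'" "lin ?r'" by (simp_all add: lin_map_key)
  have mk: "?l' (?l u) = u" "?r' (?r v) = v" "?l' (?r v) = 0" "?r' (?l u) = 0" for u v
    by (auto simp: map_key_push intro!: map_key_push_disjoint)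
  have inj: "inj ?l" "inj ?r" using mk by (metis injI)+
  have ne: "?l u \<noteq> ?r v" if "u \<in> B" for u v
  proof
    assume "?l u = ?r v"
    then have "u = 0" using mk by metis
    then show False using that B(2) fvs.dependent_zero by blast
  qed
  have "fvs.independent (?l ` B \<union> ?r ` B')"
    unfolding fvs.dependent_def
  proof (safe; clarsimp)
    fix b assume b: "b \<in> B" and s: "?l b \<in> fvs.span (?l ` B \<union> ?r ` B' - {?l b})"
    have "?l' (?l b) \<in> fvs.span (B - {b})"
      by (rule lin_span_subset[OF lin'(1) _ _ s]) (auto simp: mk fvs.span_zero intro: fvs.span_base)
    then show False using B(2) b by (auto simp: mk fvs.dependent_def)
  next
    fix b assume b: "b \<in> B'" and s: "?r b \<in> fvs.span (?l ` B \<union> ?r ` B' - {?r b})"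
    have "?r' (?r b) \<in> fvs.span (B' - {b})"
      by (rule lin_span_subset[OF lin'(2) _ _ s]) (auto simp: mk fvs.span_zero intro: fvs.span_base)
    then show False using B'(2) b by (auto simp: mk fvs.dependent_def)
  qed
  moreover have "card (?l ` B \<union> ?r ` B') = card B + card B'"
    using B(1) B'(1) ne inj
    by (subst card_Un_disjoint) (auto simp: card_image inj_on_subset[OF _ subset_UNIV] dest: injD intro!: card_image inj_on_subset[OF _ subset_UNIV])
  moreover have "fvs.span (?l ` B \<union> ?r ` B') = sum_levels V V'"
    unfolding fvs.span_Un fvs_pair.linear_span_image[OF lin_push] B(3) B'(3) sum_levels_def by blast
  ultimately show ?thesis using B(4) B'(4) fvs.dim_span_eq_card_independent by metis
qed


subsection \<open>Dimensions of eigenspaces\<close>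

definition eigen :: "'g set \<Rightarrow> ('g \<Rightarrow> 'k::field) \<Rightarrow> ('g, 'i \<Rightarrow>\<^sub>0 'k) glider \<Rightarrow> ('i \<Rightarrow>\<^sub>0 'k) set" where
  "eigen H \<chi> M = {m \<in> lev1 M. \<forall>h\<in>H. act M h m = vscale (\<chi> h) m}"

text \<open>
  These dimensions are the additive invariants that detect the type of an irreducible glider.
\<close>
definition eigendim :: "'g set \<Rightarrow> ('g \<Rightarrow> 'k::field) \<Rightarrow> ('g, 'i \<Rightarrow>\<^sub>0 'k) glider \<Rightarrow> nat" where
  "eigendim H \<chi> M = fvs.dim (eigen H \<chi> M)"

lemma subspace_eigen:
  assumes "is_glider G M" "H \<subseteq> carrier G" shows "fvs.subspace (eigen H \<chi> M)"
proof (rule fvs.subspaceI)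
  have l: "lin (act M h)" if "h \<in> H" for h using glider_lin[OF assms(1)] assms(2) that by blast
  note s = glider_sub1[OF assms(1)]
  show "0 \<in> eigen H \<chi> M" using fvs.subspace_0[OF s] by (auto simp: eigen_def lin_zero[OF l])
  show "x + y \<in> eigen H \<chi> M" if "x \<in> eigen H \<chi> M" "y \<in> eigen H \<chi> M" for x y
    using that fvs.subspace_add[OF s] by (auto simp: eigen_def lin_add[OF l] fvs.scale_right_distrib)
  show "vscale c x \<in> eigen H \<chi> M" if "x \<in> eigen H \<chi> M" for c x
    using that fvs.subspace_scale[OF s] by (auto simp: eigen_def lin_scale[OF l] mult.commute)
qed

lemma finite_dim_sub:
  assumes "finite_dim_subspace V" "fvs.subspace U" "U \<subseteq> V" shows "finite_dim_subspace U"
proof -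
  obtain C where C: "finite C" "fvs.span C = V" using assms(1) by (auto simp: finite_dim_subspace_def)
  obtain B where B: "B \<subseteq> U" "fvs.independent B" "U \<subseteq> fvs.span B"
    using fvs.maximal_independent_subset by blast
  have "fvs.span B = U" using B assms(2) fvs.span_minimal by blast
  moreover have "finite B" using fvs.independent_span_bound[OF C(1) B(2)] B(1) C(2) assms(3) by auto
  ultimately show ?thesis using finite_dim_span by blast
qed

lemma eigendim_iso:
  assumes "is_glider G M" "is_glider G N" "glider_isomorphic G M N" "H \<subseteq> carrier G"
  shows "eigendim H \<chi> M = eigendim H \<chi> N"
proof -
  obtain f f' where f: "iso_pair G M N f f'" using isomorphic_iso_pair[OF assms(1-3)] .
  note f' = iso_pair_sym[OF assms(1,2) f]
  have sub: "f ` eigen H \<chi> M \<subseteq> eigen H \<chi> N" if "iso_pair G M N f f'"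
    for M :: "('a, 'x \<Rightarrow>\<^sub>0 'd) glider" and N :: "('a, 'y \<Rightarrow>\<^sub>0 'd) glider" and f f'
  proof -
    have l: "lin f" using that by (simp add: iso_pair_def)
    have "f (act M h m) = act N h (f m)" if "m \<in> lev1 M" "h \<in> H" for m h
      using that \<open>iso_pair G M N f f'\<close> assms(4) by (auto simp: iso_pair_def)
    then show ?thesis using that unfolding eigen_def iso_pair_def
      by (auto simp: lin_scale[OF l]) (metis lin_scale[OF l])
  qed
  have "f ` eigen H \<chi> M = eigen H \<chi> N"
  proof
    show "eigen H \<chi> N \<subseteq> f ` eigen H \<chi> M"
    proof
      fix v assume v: "v \<in> eigen H \<chi> N"
      then have "f (f' v) = v" using f glider_lev[OF assms(2)] by (auto simp: iso_pair_def eigen_def)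
      moreover have "f' v \<in> eigen H \<chi> M" using sub[OF f'] v by blast
      ultimately show "v \<in> f ` eigen H \<chi> M" by force
    qed
  qed (rule sub[OF f])
  moreover have "inj_on f (eigen H \<chi> M)"
    by (rule inj_on_inverseI[of _ f']) (use f glider_lev[OF assms(1)] in \<open>auto simp: iso_pair_def eigen_def\<close>)
  moreover have "lin f" using f by (simp add: iso_pair_def)
  ultimately show ?thesis
    unfolding eigendim_def using dim_image_inj[OF _ subspace_eigen[OF assms(1,4)]] by metis
qed

lemma eigendim_sum:
  assumes "is_glider G M" "is_glider G N" "H \<subseteq> carrier G"
  shows "eigendim H \<chi> (glider_sum M N) = eigendim H \<chi> M + eigendim H \<chi> N"
proof -
  have "eigen H \<chi> (glider_sum M N) = sum_levels (eigen H \<chi> M) (eigen H \<chi> N)"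
  proof (rule antisym; rule subsetI)
    fix w assume w: "w \<in> eigen H \<chi> (glider_sum M N)"
    then obtain u v where uv: "w = push_vec Inl u + push_vec Inr v" "u \<in> lev1 M" "v \<in> lev1 N"
      by (auto simp: eigen_def glider_sum_lev elim!: sum_levelsE)
    have "act M h u = vscale (\<chi> h) u \<and> act N h v = vscale (\<chi> h) v" if h: "h \<in> H" for h
    proof -
      have "push_vec Inl (act M h u) + push_vec Inr (act N h v) =
        push_vec Inl (vscale (\<chi> h) u) + (push_vec Inr (vscale (\<chi> h) v) :: _ + _ \<Rightarrow>\<^sub>0 _)"
        using w h unfolding eigen_def uv(1) by (simp add: glider_sum_act lin_scale fvs.scale_right_distrib)
      then show ?thesis using map_key_sum_simps by metis
    qed
    then show "w \<in> sum_levels (eigen H \<chi> M) (eigen H \<chi> N)"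
      unfolding uv(1) using uv by (intro sum_levels_mem) (auto simp: eigen_def)
  next
    fix w assume "w \<in> sum_levels (eigen H \<chi> M) (eigen H \<chi> N)"
    then show "w \<in> eigen H \<chi> (glider_sum M N)"
      by (elim sum_levelsE)
         (auto simp: eigen_def glider_sum_lev glider_sum_act lin_scale fvs.scale_right_distrib intro!: sum_levels_mem)
  qed
  moreover have "finite_dim_subspace (eigen H \<chi> M)" "finite_dim_subspace (eigen H \<chi> N)"
    using finite_dim_sub[OF glider_fd1[OF assms(1)] subspace_eigen[OF assms(1,3)]]
      finite_dim_sub[OF glider_fd1[OF assms(2)] subspace_eigen[OF assms(2,3)]] by (auto simp: eigen_def)
  ultimately show ?thesis by (simp add: eigendim_def dim_sum_levels)
qed

lemma eigendim_length_zero: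
  assumes "is_glider G M" "H \<subseteq> carrier G" "lev1 M = {0}" shows "eigendim H \<chi> M = 0"
proof -
  have "eigen H \<chi> M = {0}"
    using assms(3) fvs.subspace_0[OF subspace_eigen[OF assms(1,2)]] by (auto simp: eigen_def)
  then show ?thesis by (simp add: eigendim_def dim_zero)
qed


subsection \<open>Pointed gliders\<close>

text \<open>
  The tensor product of two irreducible gliders has a one-dimensional lower level, but the upper
  level is usually larger than what the lower one generates. This notion is stable under tensor
  products, and in the reduced ring it gives the same classes as irreducibility.
\<close>
definition pointed :: "('g, 'm) monoid_scheme \<Rightarrow> ('g, 'i \<Rightarrow>\<^sub>0 'k::field) glider \<Rightarrow> ('i \<Rightarrow>\<^sub>0 'k) \<Rightarrow> bool" where
  "pointed G M u \<longleftrightarrow> is_glider G M \<and> u \<noteq> 0 \<and> lev1 M = fvs.span {u}"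

lemma pointed_glider: "pointed G M u \<Longrightarrow> is_glider G M" by (simp add: pointed_def)

lemma pointed_lev1: "pointed G M u \<Longrightarrow> lev1 M = range (\<lambda>c. vscale c u)"
  by (simp add: pointed_def fvs.span_singleton)

lemma irreducible_pointed:
  assumes "irreducible_length_one G M" shows "\<exists>u. pointed G M u"
proof -
  have g: "is_glider G M" and d: "fvs.dim (lev1 M) = 1" using assms by (auto simp: irreducible_length_one_def)
  obtain B where B: "B \<subseteq> lev1 M" "fvs.independent B" "lev1 M \<subseteq> fvs.span B" "card B = fvs.dim (lev1 M)"
    using fvs.basis_exists by blast
  then obtain u where u: "B = {u}" using d card_1_singletonE by metis
  have "fvs.span B = lev1 M" using B glider_sub1[OF g] fvs.span_minimal by blast
  then show ?thesis using g B(2) u by (auto simp: pointed_def)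
qed

lemma eigendim_pointed:
  assumes "pointed G M u" "H \<subseteq> carrier G"
  shows "eigendim H \<chi> M = (if \<forall>h\<in>H. act M h u = vscale (\<chi> h) u then 1 else 0)"
proof -
  have u: "u \<noteq> 0" using assms by (simp add: pointed_def)
  note lev = pointed_lev1[OF assms(1)]
  have l: "lin (act M h)" if "h \<in> H" for h
    using glider_lin[OF pointed_glider[OF assms(1)]] assms(2) that by blast
  have "vscale c u \<in> eigen H \<chi> M \<longleftrightarrow> c = 0 \<or> (\<forall>h\<in>H. act M h u = vscale (\<chi> h) u)" for c
  proof -
    have "act M h (vscale c u) = vscale (\<chi> h) (vscale c u) \<longleftrightarrow> c = 0 \<or> act M h u = vscale (\<chi> h) u" if "h \<in> H" for h
    proof -
      have "vscale (\<chi> h) (vscale c u) = vscale c (vscale (\<chi> h) u)" by (simp add: mult.commute)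
      then show ?thesis unfolding lin_scale[OF l[OF that]] using fvs.scale_cancel_left by metis
    qed
    then show ?thesis by (auto simp: eigen_def lev)
  qed
  then have "eigen H \<chi> M = (if \<forall>h\<in>H. act M h u = vscale (\<chi> h) u then fvs.span {u} else {0})"
    by (auto simp: fvs.span_singleton) (auto simp: eigen_def lev lin_zero[OF l])
  then show ?thesis using dim_line[OF u] by (simp add: eigendim_def dim_zero)
qed

text \<open>
  The element \<open>\<Sum> x(g) g\<close> of the group algebra applied to \<open>u\<close>. The coefficients are a function, of
  which the values on the group count; its zeros, as \<open>x\<close> varies, are the annihilator of \<open>u\<close>.
\<close>
definition orbit_comb :: "('g, 'm) monoid_scheme \<Rightarrow> ('g, 'i \<Rightarrow>\<^sub>0 'k::field) glider \<Rightarrow> ('i \<Rightarrow>\<^sub>0 'k) \<Rightarrow> ('g \<Rightarrow> 'k) \<Rightarrow> ('i \<Rightarrow>\<^sub>0 'k)" where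
  "orbit_comb G M u x = (\<Sum>g\<in>carrier G. vscale (x g) (act M g u))"

lemma orbit_comb_add: "orbit_comb G M u (\<lambda>g. x g + y g) = orbit_comb G M u x + orbit_comb G M u y"
  by (simp add: orbit_comb_def fvs.scale_left_distrib sum.distrib)

lemma orbit_comb_diff: "orbit_comb G M u (\<lambda>g. x g - y g) = orbit_comb G M u x - orbit_comb G M u y"
  by (simp add: orbit_comb_def fvs.scale_left_diff_distrib sum_subtractf)

lemma orbit_comb_scale: "orbit_comb G M u (\<lambda>g. c * x g) = vscale c (orbit_comb G M u x)"
  by (simp add: orbit_comb_def fvs.scale_sum_right)

lemma lookup_orbit_comb: "lookup (orbit_comb G M u x) i = (\<Sum>g\<in>carrier G. x g * lookup (act M g u) i)"
  by (simp add: orbit_comb_def lookup_sum)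

definition cyclic_part :: "('g, 'm) monoid_scheme \<Rightarrow> ('g, 'i \<Rightarrow>\<^sub>0 'k::field) glider \<Rightarrow> ('i \<Rightarrow>\<^sub>0 'k) \<Rightarrow> ('g, 'i \<Rightarrow>\<^sub>0 'k) glider" where
  "cyclic_part G M u = M\<lparr>lev0 := range (orbit_comb G M u)\<rparr>"

lemma cyclic_part_simps [simp]: "act (cyclic_part G M u) = act M" "lev1 (cyclic_part G M u) = lev1 M" "lev0 (cyclic_part G M u) = range (orbit_comb G M u)"
  by (simp_all add: cyclic_part_def)

context finite_group
begin

lemma orbit_comb_delta: "g \<in> carrier G \<Longrightarrow> orbit_comb G M u (\<lambda>h. if h = g then c else 0) = vscale c (act M g u)"
  unfolding orbit_comb_def by (simp add: if_distrib[of "\<lambda>c. vscale c _"] finite_carrier cong: if_cong)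

lemma range_orbit_comb: "range (orbit_comb G M u) = fvs.span ((\<lambda>g. act M g u) ` carrier G)"
proof
  show "range (orbit_comb G M u) \<subseteq> fvs.span ((\<lambda>g. act M g u) ` carrier G)"
    by (auto simp: orbit_comb_def intro!: fvs.span_sum fvs.span_scale intro: fvs.span_base)
  have "fvs.subspace (range (orbit_comb G M u))"
  proof (rule fvs.subspaceI)
    show "0 \<in> range (orbit_comb G M u)" by (rule range_eqI[of _ _ "\<lambda>_. 0"]) (simp add: orbit_comb_def)
    show "x + y \<in> range (orbit_comb G M u)" if "x \<in> range (orbit_comb G M u)" "y \<in> range (orbit_comb G M u)" for x y
      using that by (auto simp flip: orbit_comb_add)
    show "vscale c x \<in> range (orbit_comb G M u)" if "x \<in> range (orbit_comb G M u)" for c x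
      using that by (auto simp flip: orbit_comb_scale)
  qed
  moreover have "act M g u \<in> range (orbit_comb G M u)" if "g \<in> carrier G" for g
    using orbit_comb_delta[OF that, of M u 1] by (metis fvs.scale_one rangeI)
  ultimately show "fvs.span ((\<lambda>g. act M g u) ` carrier G) \<subseteq> range (orbit_comb G M u)"
    by (intro fvs.span_minimal) auto
qed

lemma cyclic_part_irreducible:
  assumes "pointed G M u" shows "irreducible_length_one G (cyclic_part G M u)" "pointed G (cyclic_part G M u) u"
proof -
  note g = pointed_glider[OF assms] and lev = pointed_lev1[OF assms]
  have u: "u \<noteq> 0" using assms by (simp add: pointed_def)
  have acts: "act M h (vscale c u) \<in> range (orbit_comb G M u)" if "h \<in> carrier G" for h c
    using orbit_comb_delta[OF that, of M u c] lin_scale[OF glider_lin[OF g that]] by (metis rangeI)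
  have "lev1 M \<subseteq> range (orbit_comb G M u)"
    using acts[OF one_closed] by (auto simp: lev glider_one[OF g])
  moreover have "finite_dim_subspace (range (orbit_comb G M u))"
    unfolding range_orbit_comb by (rule finite_dim_span) (simp add: finite_carrier)
  ultimately have gc: "is_glider G (cyclic_part G M u)"
    using g acts by (auto simp: is_glider_iff lev)
  then show "pointed G (cyclic_part G M u) u" using assms by (simp add: pointed_def)
  have "u \<in> lev1 M" using lev by (metis fvs.scale_one rangeI)
  have "fvs.span {algebra_act (cyclic_part G M u) x m | x m. x \<in> carrier (monoid_algebra G) \<and> m \<in> lev1 M} = range (orbit_comb G M u)"
    (is "fvs.span ?S = _")
  proof
    show "fvs.span ?S \<subseteq> range (orbit_comb G M u)"
    proof (rule fvs.span_minimal)
      show "?S \<subseteq> range (orbit_comb G M u)" using gc unfolding is_glider_def by auto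
      show "fvs.subspace (range (orbit_comb G M u))" by (simp add: range_orbit_comb)
    qed
    have "act M h u \<in> ?S" if "h \<in> carrier G" for h
      using that single_in_monoid_algebra[OF that, of 1] \<open>u \<in> lev1 M\<close> algebra_act_single[of "cyclic_part G M u" h u]
      by (metis (mono_tags, lifting) cyclic_part_simps(1) mem_Collect_eq)
    then show "range (orbit_comb G M u) \<subseteq> fvs.span ?S"
      unfolding range_orbit_comb by (intro fvs.span_mono) auto
  qed
  then show "irreducible_length_one G (cyclic_part G M u)"
    using gc assms dim_line[OF u] u \<open>u \<in> lev1 M\<close>
    by (auto simp: irreducible_length_one_def glider_length_def pointed_def)
qed

text \<open>A vector-space complement of the generated subglider splits off as a glider of length zero.\<close>
lemma split_off_length_zero:
  fixes M :: "('a, 'i \<Rightarrow>\<^sub>0 'k::field) glider"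
  assumes "pointed G M u"
  obtains C :: "('a, 'i \<Rightarrow>\<^sub>0 'k) glider" where "is_glider G C" "lev1 C = {0}" "glider_isomorphic G M (glider_sum (cyclic_part G M u) C)"
proof -
  note g = pointed_glider[OF assms] and gc = pointed_glider[OF cyclic_part_irreducible(2)[OF assms]]
  let ?S = "range (orbit_comb G M u)"
  obtain p where p: "lin p" "\<And>v. p v \<in> ?S" "\<And>v. v \<in> ?S \<Longrightarrow> p v = v"
    using projection_exists[OF glider_sub0[OF gc]] by auto
  have S_lev0: "?S \<subseteq> lev0 M"
  proof -
    have "u \<in> lev1 M" using pointed_lev1[OF assms] by (metis fvs.scale_one rangeI)
    then show ?thesis
      unfolding range_orbit_comb using glider_act[OF g] by (intro fvs.span_minimal glider_sub0[OF g]) auto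
  qed
  define C where "C = M\<lparr>lev0 := (\<lambda>v. v - p v) ` lev0 M, lev1 := {0}\<rparr>"
  have C: "act C = act M" "lev0 C = (\<lambda>v. v - p v) ` lev0 M" "lev1 C = {0}" by (simp_all add: C_def)
  have lq: "lin (\<lambda>v. v - p v)" by (rule lin_minus[OF lin_id p(1)])
  have fd: "finite_dim_subspace (lev0 C)" unfolding C using finite_dim_image[OF lq glider_fd0[OF g]] .
  have "0 \<in> lev0 C" using fvs.subspace_0[OF subspace_of_finite_dim[OF fd]] .
  then have gC: "is_glider G C"
    using g fd unfolding is_glider_iff C(1,3) by (auto simp: lin_zero)
  let ?f = "\<lambda>w. Poly_Mapping.map_key Inl w + Poly_Mapping.map_key Inr w"
  let ?f' = "\<lambda>v. push_vec Inl (p v) + push_vec Inr (v - p v)"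
  have lf: "lin ?f" by (rule lin_plus) (simp_all add: lin_map_key)
  have lf': "lin ?f'" by (rule lin_plus[OF lin_compose[OF lin_push p(1)] lin_compose[OF lin_push lq]])
  have pp: "p (v - p v) = 0" for v by (simp add: lin_diff[OF p(1)] p(2,3))
  have Cl: "w \<in> lev0 M" "p w = 0" if w: "w \<in> lev0 C" for w
  proof -
    obtain v where v: "v \<in> lev0 M" "w = v - p v" using w by (auto simp: C)
    show "p w = 0" using v pp by simp
    show "w \<in> lev0 M" using v S_lev0 p(2) fvs.subspace_diff[OF glider_sub0[OF g]] by blast
  qed
  have "iso_pair G (glider_sum (cyclic_part G M u) C) M ?f ?f'"
    unfolding iso_pair_def glider_sum_lev
  proof (intro conjI ballI lf lf')
    fix w assume "w \<in> sum_levels (lev0 (cyclic_part G M u)) (lev0 C)"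
    then obtain a b where ab: "w = push_vec Inl a + push_vec Inr b" "a \<in> ?S" "b \<in> lev0 C"
      by (elim sum_levelsE) auto
    show "?f w \<in> lev0 M" using ab Cl S_lev0 fvs.subspace_add[OF glider_sub0[OF g]] by auto
    show "?f' (?f w) = w" using Cl[OF ab(3)] p(3)[OF ab(2)] by (simp add: ab(1) lin_add[OF p(1)])
  next
    fix v assume "v \<in> lev0 M"
    then show "?f' v \<in> sum_levels (lev0 (cyclic_part G M u)) (lev0 C)"
      by (intro sum_levels_mem) (auto simp: C p(2))
    show "?f (?f' v) = v" by simp
  next
    fix w assume "w \<in> sum_levels (lev1 (cyclic_part G M u)) (lev1 C)"
    then show "?f w \<in> lev1 M" by (elim sum_levelsE) (auto simp: C)
  next
    fix v assume v: "v \<in> lev1 M"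
    then have "p v = v" using p(3) glider_lev[OF gc, of v] by simp
    then show "?f' v \<in> sum_levels (lev1 (cyclic_part G M u)) (lev1 C)"
      using v by (intro sum_levels_mem) (auto simp: C)
  next
    fix h m assume h: "h \<in> carrier G" and m: "m \<in> sum_levels (lev1 (cyclic_part G M u)) (lev1 C)"
    obtain a where a: "m = push_vec Inl a + push_vec Inr 0" "a \<in> lev1 M"
      using m by (elim sum_levelsE) (auto simp: C)
    show "?f (act (glider_sum (cyclic_part G M u) C) h m) = act M h (?f m)"
      by (simp only: a(1) glider_sum_act map_key_sum_simps C(1) cyclic_part_simps lin_zero[OF glider_lin[OF g h]] add_0_right)
  qed
  then have "glider_isomorphic G (glider_sum (cyclic_part G M u) C) M"
    by (rule iso_pair_isomorphic[OF glider_sum_glider[OF gc gC] g])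
  then show ?thesis
    using that[OF gC C(3)] isomorphic_sym[OF glider_sum_glider[OF gc gC] g] by blast
qed

text \<open>
  The map \<open>x u \<mapsto> x v\<close> is well defined, and so is its inverse, because the annihilators agree.
\<close>
lemma cyclic_part_isomorphic:
  fixes M :: "('a, 'i \<Rightarrow>\<^sub>0 'k::field) glider" and N :: "('a, 'j \<Rightarrow>\<^sub>0 'k) glider"
  assumes "pointed G M u" "pointed G N v" "\<And>x. orbit_comb G M u x = 0 \<longleftrightarrow> orbit_comb G N v x = 0"
  shows "glider_isomorphic G (cyclic_part G M u) (cyclic_part G N v)"
proof -
  have eqv: "orbit_comb G M u x = orbit_comb G M u y \<longleftrightarrow> orbit_comb G N v x = orbit_comb G N v y" for x y
    using assms(3)[of "\<lambda>g. x g - y g"] by (simp add: orbit_comb_diff)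
  define f where "f w = orbit_comb G N v (SOME x. orbit_comb G M u x = w)" for w
  define h where "h w = orbit_comb G M u (SOME x. orbit_comb G N v x = w)" for w
  have f: "f (orbit_comb G M u x) = orbit_comb G N v x" for x
  proof -
    have "orbit_comb G M u (SOME y. orbit_comb G M u y = orbit_comb G M u x) = orbit_comb G M u x"
      by (rule someI[of "\<lambda>y. orbit_comb G M u y = orbit_comb G M u x" x]) (rule refl)
    then show ?thesis by (simp add: f_def eqv)
  qed
  have h: "h (orbit_comb G N v x) = orbit_comb G M u x" for x
  proof -
    have "orbit_comb G N v (SOME y. orbit_comb G N v y = orbit_comb G N v x) = orbit_comb G N v x"
      by (rule someI[of "\<lambda>y. orbit_comb G N v y = orbit_comb G N v x" x]) (rule refl)
    then show ?thesis by (simp add: h_def eqv)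
  qed
  have algebra_orb: "algebra_act L x (vscale c w) = orbit_comb G L w (\<lambda>g. c * lookup x g)"
    if L: "pointed G L w" and x: "x \<in> carrier (monoid_algebra G)" for c x w and L :: "('a, 'z \<Rightarrow>\<^sub>0 'k) glider"
  proof -
    have k: "keys x \<subseteq> carrier G" using x by simp
    have "algebra_act L x (vscale c w) = (\<Sum>g\<in>keys x. vscale (c * lookup x g) (act L g w))"
      unfolding algebra_act_def using k
      by (intro sum.cong refl) (auto simp: lin_scale[OF glider_lin[OF pointed_glider[OF L]]] mult.commute)
    also have "\<dots> = orbit_comb G L w (\<lambda>g. c * lookup x g)"
      unfolding orbit_comb_def using k finite_carrier by (intro sum.mono_neutral_left) (auto simp: in_keys_iff)
    finally show ?thesis .
  qed
  have gen: "vscale c w = orbit_comb G L w (\<lambda>g. if g = \<one> then c else 0)"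
    if L: "pointed G L w" for c w and L :: "('a, 'z \<Rightarrow>\<^sub>0 'k) glider"
    using orbit_comb_delta[OF one_closed, of L w c] by (simp add: glider_one[OF pointed_glider[OF L]])
  have fc: "f (vscale c u) = vscale c v" and hc: "h (vscale c v) = vscale c u" for c
    by (simp_all only: gen[OF assms(1)] gen[OF assms(2)] f h)
  have act_cyc: "algebra_act (cyclic_part G L w) = algebra_act L" for w and L :: "('a, 'z \<Rightarrow>\<^sub>0 'k) glider"
    by (simp add: fun_eq_iff algebra_act_def)
  have "f \<in> glider_hom G (cyclic_part G M u) (cyclic_part G N v)"
    unfolding glider_hom_def
    by (auto simp: f pointed_lev1[OF assms(1)] pointed_lev1[OF assms(2)] act_cyc fc
          algebra_orb[OF assms(1)] algebra_orb[OF assms(2)] simp flip: orbit_comb_add orbit_comb_scale simp del: monoid_algebra_simps)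
  moreover have "h \<in> glider_hom G (cyclic_part G N v) (cyclic_part G M u)"
    unfolding glider_hom_def
    by (auto simp: h pointed_lev1[OF assms(1)] pointed_lev1[OF assms(2)] act_cyc hc
          algebra_orb[OF assms(1)] algebra_orb[OF assms(2)] simp flip: orbit_comb_add orbit_comb_scale simp del: monoid_algebra_simps)
  ultimately show ?thesis
    unfolding glider_isomorphic_def by (intro bexI[of _ f] bexI[of _ h]) (auto simp: f h)
qed

end

subsection \<open>The line stabilizer and its character\<close>

definition line_stab :: "('g, 'm) monoid_scheme \<Rightarrow> ('g, 'i \<Rightarrow>\<^sub>0 'k::field) glider \<Rightarrow> ('i \<Rightarrow>\<^sub>0 'k) \<Rightarrow> 'g set" where
  "line_stab G M u = {h \<in> carrier G. \<exists>c. act M h u = vscale c u}"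

definition line_char :: "('g, 'i \<Rightarrow>\<^sub>0 'k::field) glider \<Rightarrow> ('i \<Rightarrow>\<^sub>0 'k) \<Rightarrow> 'g \<Rightarrow> 'k" where
  "line_char M u h = (THE c. act M h u = vscale c u)"

lemma line_char_eq: "u \<noteq> 0 \<Longrightarrow> act M h u = vscale c u \<Longrightarrow> line_char M u h = c"
  unfolding line_char_def by (rule the_equality) auto

lemma line_stab_act: "u \<noteq> 0 \<Longrightarrow> h \<in> line_stab G M u \<Longrightarrow> act M h u = vscale (line_char M u h) u"
  using line_char_eq[of u M h] by (auto simp: line_stab_def)

definition ntensor_vec :: "(nat \<Rightarrow>\<^sub>0 'k::field) \<Rightarrow> (nat \<Rightarrow>\<^sub>0 'k) \<Rightarrow> (nat \<Rightarrow>\<^sub>0 'k)" where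
  "ntensor_vec u v = push_vec prod_encode (tensor_vec u v)"

lemma lookup_ntensor_vec [simp]: "lookup (ntensor_vec u v) (prod_encode (i, j)) = lookup u i * lookup v j"
  unfolding ntensor_vec_def by (subst lookup_push_inj) (auto simp: inj_prod_encode)

lemma ntensor_vec_eq_0: "ntensor_vec u v = 0 \<longleftrightarrow> u = 0 \<or> v = 0"
proof -
  have "push_vec prod_decode (ntensor_vec u v) = tensor_vec u v"
    by (simp add: ntensor_vec_def push_push)
  then have "ntensor_vec u v = 0 \<longleftrightarrow> tensor_vec u v = 0"
    by (auto simp: ntensor_vec_def lin_zero[OF lin_push])
  then show ?thesis by (simp add: tensor_eq_0)
qed

lemma ntensor_vec_scale: "ntensor_vec (vscale a u) (vscale b v) = vscale (a * b) (ntensor_vec u v)"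
  by (simp only: ntensor_vec_def tensor_scale lin_scale[OF lin_push])

lemma ntensor_act:
  assumes "is_glider G M" "is_glider G N" "g \<in> carrier G"
  shows "act (ntensor M N) g (ntensor_vec u v) = ntensor_vec (act M g u) (act N g v)"
  by (simp add: ntensor_def reindex_def ntensor_vec_def push_push tensor_act_tensor[OF assms])

lemma ntensor_pointed:
  assumes "group G" "pointed G M u" "pointed G N v"
  shows "pointed G (ntensor M N) (ntensor_vec u v)"
proof -
  have "tensor_levels (fvs.span {u}) (fvs.span {v}) = fvs.span {tensor_vec u v}"
  proof
    have "tensor_vec a b \<in> fvs.span {tensor_vec u v}" if "a \<in> fvs.span {u}" "b \<in> fvs.span {v}" for a b
      using that by (rule tensor_span) (auto intro: fvs.span_base)
    then show "tensor_levels (fvs.span {u}) (fvs.span {v}) \<subseteq> fvs.span {tensor_vec u v}"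
      unfolding tensor_levels_def by (intro fvs.span_minimal) auto
    show "fvs.span {tensor_vec u v} \<subseteq> tensor_levels (fvs.span {u}) (fvs.span {v})"
      by (intro fvs.span_minimal) (auto intro!: tensor_levels_mem fvs.span_base)
  qed
  then have "lev1 (ntensor M N) = fvs.span {ntensor_vec u v}"
    using assms(2,3) fvs_pair.linear_span_image[OF lin_push, of prod_encode "{tensor_vec u v}"]
    by (simp add: ntensor_def reindex_def glider_tensor_lev pointed_def ntensor_vec_def)
  then show ?thesis
    using assms ntensor(1)[OF assms(1)] by (auto simp: pointed_def ntensor_vec_eq_0)
qed

context finite_group
begin

lemma act_inverse:
  assumes "is_glider G M" "h \<in> carrier G" shows "act M (inv h) (act M h v) = v" "act M h (act M (inv h) v) = v"
  using glider_mult[OF assms(1), of "inv h" h v] glider_mult[OF assms(1), of h "inv h" v] assms glider_one[OF assms(1)]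
  by auto

lemma act_nonzero:
  assumes "is_glider G M" "h \<in> carrier G" "v \<noteq> 0" shows "act M h v \<noteq> 0"
  using act_inverse(1)[OF assms(1,2), of v] assms(3) lin_zero[OF glider_lin[OF assms(1) inv_closed[OF assms(2)]]] by auto

lemma line_stab_subset: "line_stab G M u \<subseteq> carrier G" by (auto simp: line_stab_def)

lemma line_char_nonzero:
  assumes "pointed G M u" "h \<in> line_stab G M u" shows "line_char M u h \<noteq> 0"
proof -
  have "u \<noteq> 0" "h \<in> carrier G" using assms by (auto simp: pointed_def line_stab_def)
  then show ?thesis
    using act_nonzero[OF pointed_glider[OF assms(1)], of h u] line_stab_act[of u h G M] assms(2) by auto
qed

lemma line_char_mult:
  assumes "pointed G M u" "g \<in> line_stab G M u" "h \<in> line_stab G M u"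
  shows "act M (g \<otimes> h) u = vscale (line_char M u g * line_char M u h) u"
proof -
  have u: "u \<noteq> 0" and c: "g \<in> carrier G" "h \<in> carrier G" using assms by (auto simp: pointed_def line_stab_def)
  show ?thesis
    using line_stab_act[OF u assms(2)] line_stab_act[OF u assms(3)]
    by (simp add: glider_mult[OF pointed_glider[OF assms(1)] c] lin_scale[OF glider_lin[OF pointed_glider[OF assms(1)] c(1)]] mult.commute)
qed

lemma line_stab_subgroup:
  assumes "pointed G M u" shows "subgroup (line_stab G M u) G"
proof (rule subgroupI)
  note g = pointed_glider[OF assms]
  have u: "u \<noteq> 0" using assms by (simp add: pointed_def)
  have "act M \<one> u = vscale 1 u" by (simp add: glider_one[OF g])
  then show "line_stab G M u \<noteq> {}" unfolding line_stab_def by blast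
  fix a assume a: "a \<in> line_stab G M u"
  then have ac: "a \<in> carrier G" by (simp add: line_stab_def)
  have "vscale (inverse (line_char M u a)) u = vscale (inverse (line_char M u a)) (act M (inv a) (act M a u))"
    by (simp add: act_inverse[OF g ac])
  also have "\<dots> = act M (inv a) u"
    using line_char_nonzero[OF assms a] by (simp add: line_stab_act[OF u a] lin_scale[OF glider_lin[OF g inv_closed[OF ac]]])
  finally show "inv a \<in> line_stab G M u" using ac by (auto simp: line_stab_def intro!: exI[of _ "inverse (line_char M u a)"])
  fix b assume b: "b \<in> line_stab G M u"
  show "a \<otimes> b \<in> line_stab G M u"
    using line_char_mult[OF assms a b] ac b by (auto simp: line_stab_def)
qed (auto simp: line_stab_def)

lemma line_char_character:
  assumes "pointed G M u" "subgroup H G" "H \<subseteq> line_stab G M u"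
  shows "restrict (line_char M u) H \<in> carrier (linear_characters (G\<lparr>carrier := H\<rparr>))"
proof -
  have u: "u \<noteq> 0" using assms by (simp add: pointed_def)
  have "line_char M u (g \<otimes> h) = line_char M u g * line_char M u h" if "g \<in> H" "h \<in> H" for g h
    using line_char_eq[OF u line_char_mult[OF assms(1)]] that assms(3) by blast
  moreover have "line_char M u h \<noteq> 0" if "h \<in> H" for h using line_char_nonzero[OF assms(1)] that assms(3) by blast
  ultimately show ?thesis
    using subgroup.m_closed[OF assms(2)]
    by (auto simp: linear_characters_def hom_def mult_group_of_field_def)
qed

text \<open>
  In \<open>h u \<otimes> h v = c (u \<otimes> v)\<close> fix a coordinate at which \<open>h v\<close> does not vanish: the remaining
  coordinates say that \<open>h u\<close> is a multiple of \<open>u\<close>. By symmetry \<open>h v\<close> is a multiple of \<open>v\<close>.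
\<close>
lemma line_stab_ntensor:
  assumes "pointed G M u" "pointed G N v"
  shows "line_stab G (ntensor M N) (ntensor_vec u v) = line_stab G M u \<inter> line_stab G N v"
    and "h \<in> line_stab G M u \<Longrightarrow> h \<in> line_stab G N v \<Longrightarrow> line_char (ntensor M N) (ntensor_vec u v) h = line_char M u h * line_char N v h"
proof -
  note gM = pointed_glider[OF assms(1)] and gN = pointed_glider[OF assms(2)]
  have u: "u \<noteq> 0" "v \<noteq> 0" using assms by (auto simp: pointed_def)
  have both: "act (ntensor M N) h (ntensor_vec u v) = vscale (line_char M u h * line_char N v h) (ntensor_vec u v)"
    if "h \<in> line_stab G M u" "h \<in> line_stab G N v" for h
    using that(1)
    by (auto simp: line_stab_def[of G M] ntensor_act[OF gM gN] line_stab_act[OF u(1) that(1)] line_stab_act[OF u(2) that(2)] ntensor_vec_scale)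
  have nz: "ntensor_vec u v \<noteq> 0" by (simp add: ntensor_vec_eq_0 u)
  show "h \<in> line_stab G M u \<Longrightarrow> h \<in> line_stab G N v \<Longrightarrow> line_char (ntensor M N) (ntensor_vec u v) h = line_char M u h * line_char N v h"
    by (rule line_char_eq[OF nz both])
  have "h \<in> line_stab G M u \<inter> line_stab G N v" if h: "h \<in> line_stab G (ntensor M N) (ntensor_vec u v)" for h
  proof -
    have hc: "h \<in> carrier G" using h by (simp add: line_stab_def)
    obtain c where "act (ntensor M N) h (ntensor_vec u v) = vscale c (ntensor_vec u v)"
      using h unfolding line_stab_def by blast
    then have "ntensor_vec (act M h u) (act N h v) = vscale c (ntensor_vec u v)"
      by (simp only: ntensor_act[OF gM gN hc])
    then have e: "lookup (act M h u) i * lookup (act N h v) j = c * (lookup u i * lookup v j)" for i j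
      by (metis lookup_ntensor_vec lookup_vscale)
    obtain i where i: "lookup (act M h u) i \<noteq> 0"
      using act_nonzero[OF gM hc u(1)] by (metis lookup_zero poly_mapping_eqI)
    obtain j where j: "lookup (act N h v) j \<noteq> 0"
      using act_nonzero[OF gN hc u(2)] by (metis lookup_zero poly_mapping_eqI)
    have "act M h u = vscale (c * lookup v j / lookup (act N h v) j) u"
      by (rule poly_mapping_eqI) (use e[of _ j] j in \<open>auto simp: field_simps\<close>)
    moreover have "act N h v = vscale (c * lookup u i / lookup (act M h u) i) v"
      by (rule poly_mapping_eqI) (use e[of i] i in \<open>auto simp: field_simps\<close>)
    ultimately show ?thesis using hc by (auto simp: line_stab_def)
  qed
  moreover have "h \<in> line_stab G (ntensor M N) (ntensor_vec u v)" if "h \<in> line_stab G M u" "h \<in> line_stab G N v" for h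
    using both[OF that] that(1) by (auto simp: line_stab_def)
  ultimately show "line_stab G (ntensor M N) (ntensor_vec u v) = line_stab G M u \<inter> line_stab G N v"
    by blast
qed


subsection \<open>High tensor powers\<close>

text \<open>
  The functions on the group that are orthogonal to the annihilator of the generator; these are
  its matrix coefficients.
\<close>
definition coeff_fun :: "('a, 'i \<Rightarrow>\<^sub>0 'k::field) glider \<Rightarrow> ('i \<Rightarrow>\<^sub>0 'k) \<Rightarrow> ('a \<Rightarrow> 'k) \<Rightarrow> bool" where
  "coeff_fun M u \<phi> \<longleftrightarrow> (\<forall>x. orbit_comb G M u x = 0 \<longrightarrow> (\<Sum>g\<in>carrier G. x g * \<phi> g) = 0)"

lemma coeff_fun_coordinate: "coeff_fun M u (\<lambda>g. lookup (act M g u) i)"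
  by (simp add: coeff_fun_def flip: lookup_orbit_comb)

lemma coeff_fun_comb:
  assumes "coeff_fun M u \<phi>" "coeff_fun M u \<psi>" shows "coeff_fun M u (\<lambda>g. a * \<phi> g - b * \<psi> g)"
proof -
  have "(\<Sum>g\<in>carrier G. x g * (a * \<phi> g - b * \<psi> g)) =
      a * (\<Sum>g\<in>carrier G. x g * \<phi> g) - b * (\<Sum>g\<in>carrier G. x g * \<psi> g)" for x
    by (simp add: sum_distrib_left sum_subtractf algebra_simps)
  then show ?thesis using assms by (simp add: coeff_fun_def)
qed

lemma coeff_fun_mult:
  assumes "pointed G M u" "pointed G N v" "coeff_fun M u \<phi>" "coeff_fun N v \<psi>"
  shows "coeff_fun (ntensor M N) (ntensor_vec u v) (\<lambda>g. \<phi> g * \<psi> g)"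
  unfolding coeff_fun_def
proof (intro allI impI)
  note gM = pointed_glider[OF assms(1)] and gN = pointed_glider[OF assms(2)]
  fix x assume x: "orbit_comb G (ntensor M N) (ntensor_vec u v) x = 0"
  have "orbit_comb G N v (\<lambda>g. x g * lookup (act M g u) i) = 0" for i
  proof (rule poly_mapping_eqI)
    fix j
    have "(\<Sum>g\<in>carrier G. x g * (lookup (act M g u) i * lookup (act N g v) j)) =
        lookup (orbit_comb G (ntensor M N) (ntensor_vec u v) x) (prod_encode (i, j))"
      unfolding lookup_orbit_comb by (intro sum.cong refl) (simp add: ntensor_act[OF gM gN])
    then show "lookup (orbit_comb G N v (\<lambda>g. x g * lookup (act M g u) i)) j = lookup 0 j"
      by (simp add: x lookup_orbit_comb mult.assoc)
  qed
  then have "(\<Sum>g\<in>carrier G. x g * lookup (act M g u) i * \<psi> g) = 0" for i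
    using assms(4) by (simp add: coeff_fun_def)
  then have "orbit_comb G M u (\<lambda>g. x g * \<psi> g) = 0"
    by (intro poly_mapping_eqI) (simp add: lookup_orbit_comb mult_ac)
  then have "(\<Sum>g\<in>carrier G. x g * \<psi> g * \<phi> g) = 0"
    using assms(3) by (simp add: coeff_fun_def)
  then show "(\<Sum>g\<in>carrier G. x g * (\<phi> g * \<psi> g)) = 0" by (simp add: mult_ac)
qed

lemma coeff_fun_equivariant:
  assumes "pointed G M u" "coeff_fun M u \<phi>" "g \<in> carrier G" "h \<in> line_stab G M u"
  shows "\<phi> (g \<otimes> h) = line_char M u h * \<phi> g"
proof -
  note gM = pointed_glider[OF assms(1)]
  have u: "u \<noteq> 0" using assms by (simp add: pointed_def)
  have h: "h \<in> carrier G" using assms(4) line_stab_subset by blast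
  let ?x = "\<lambda>y. (if y = g \<otimes> h then 1 else 0) - (if y = g then line_char M u h else 0)"
  have "orbit_comb G M u ?x = 0"
    using assms(3) h line_stab_act[OF u assms(4)]
    by (simp add: orbit_comb_diff orbit_comb_delta glider_mult[OF gM] lin_scale[OF glider_lin[OF gM]])
  then have "(\<Sum>y\<in>carrier G. ?x y * \<phi> y) = 0" using assms(2) by (simp add: coeff_fun_def)
  moreover have "(\<Sum>y\<in>carrier G. ?x y * \<phi> y) = (\<Sum>y\<in>carrier G. if y = g \<otimes> h then \<phi> y else 0) -
      (\<Sum>y\<in>carrier G. if y = g then line_char M u h * \<phi> y else 0)"
    unfolding sum_subtractf[symmetric] by (intro sum.cong) (auto simp: algebra_simps)
  ultimately show ?thesis using assms(3) h finite_carrier by simp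
qed

primrec tensor_power :: "('a, nat \<Rightarrow>\<^sub>0 'k::field) glider \<Rightarrow> nat \<Rightarrow> ('a, nat \<Rightarrow>\<^sub>0 'k) glider" where
  "tensor_power M 0 = character_glider (\<lambda>_. 1)"
| "tensor_power M (Suc n) = ntensor M (tensor_power M n)"

primrec tensor_power_vec :: "(nat \<Rightarrow>\<^sub>0 'k::field) \<Rightarrow> nat \<Rightarrow> (nat \<Rightarrow>\<^sub>0 'k)" where
  "tensor_power_vec u 0 = single 0 1"
| "tensor_power_vec u (Suc n) = ntensor_vec u (tensor_power_vec u n)"

lemma tensor_power_pointed: "pointed G M u \<Longrightarrow> pointed G (tensor_power M n) (tensor_power_vec u n)"
proof (induction n)
  case 0
  then show ?case using one_glider[OF group_axioms] by (simp add: pointed_def character_glider_def)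
next
  case (Suc n)
  then show ?case using ntensor_pointed[OF group_axioms] by simp
qed

lemma tensor_power_line_stab:
  assumes "pointed G M u" "h \<in> line_stab G M u"
  shows "h \<in> line_stab G (tensor_power M n) (tensor_power_vec u n) \<and> line_char (tensor_power M n) (tensor_power_vec u n) h = line_char M u h ^ n"
proof (induction n)
  case 0
  have "act (tensor_power M 0) h (tensor_power_vec u 0) = vscale 1 (tensor_power_vec u 0)" by (simp add: character_glider_def)
  moreover have "tensor_power_vec u 0 \<noteq> 0" by simp
  ultimately show ?case
    using line_char_eq[of "tensor_power_vec u 0" "tensor_power M 0" h 1] assms(2) unfolding line_stab_def power_0 by blast
next
  case (Suc n)
  then show ?case
    using line_stab_ntensor(1)[OF assms(1) tensor_power_pointed[OF assms(1), of n]]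
      line_stab_ntensor(2)[OF assms(1) tensor_power_pointed[OF assms(1), of n], of h] assms(2) by simp
qed

lemma separating_coeff_fun:
  assumes "pointed G M u" "g \<in> carrier G" "g' \<in> carrier G" "inv g' \<otimes> g \<notin> line_stab G M u"
  shows "\<exists>\<phi>. coeff_fun M u \<phi> \<and> \<phi> g = 0 \<and> \<phi> g' \<noteq> 0"
proof (rule ccontr)
  note gM = pointed_glider[OF assms(1)]
  assume neg: "\<not> ?thesis"
  have u: "u \<noteq> 0" using assms by (simp add: pointed_def)
  let ?a = "\<lambda>y i. lookup (act M y u) i"
  have "?a g i * ?a g' j - ?a g j * ?a g' i = 0" for i j
  proof -
    have "coeff_fun M u (\<lambda>y. ?a g i * ?a y j - ?a g j * ?a y i)"
      by (rule coeff_fun_comb[OF coeff_fun_coordinate coeff_fun_coordinate])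
    moreover have "?a g i * ?a g j - ?a g j * ?a g i = 0" by (simp add: mult.commute)
    ultimately show ?thesis using neg by blast
  qed
  moreover obtain j where "?a g' j \<noteq> 0"
    using act_nonzero[OF gM assms(3) u] by (metis lookup_zero poly_mapping_eqI)
  ultimately have "act M g u = vscale (?a g j / ?a g' j) (act M g' u)"
    by (intro poly_mapping_eqI) (auto simp: field_simps)
  then obtain d where "act M g u = vscale d (act M g' u)" by blast
  then have "act M (inv g' \<otimes> g) u = vscale d u"
    using assms(2,3) by (simp add: glider_mult[OF gM] lin_scale[OF glider_lin[OF gM]] act_inverse[OF gM])
  then show False using assms(2-4) by (auto simp: line_stab_def)
qed

lemma nonvanishing_coeff_fun:
  assumes "pointed G M u" "g \<in> carrier G"
  shows "\<exists>\<phi>. coeff_fun M u \<phi> \<and> \<phi> g \<noteq> 0"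
proof -
  have "u \<noteq> 0" using assms by (simp add: pointed_def)
  then obtain i where "lookup (act M g u) i \<noteq> 0"
    using act_nonzero[OF pointed_glider[OF assms(1)] assms(2)] by (metis lookup_zero poly_mapping_eqI)
  then show ?thesis
    by (intro exI[of _ "\<lambda>g. lookup (act M g u) i"]) (simp add: coeff_fun_coordinate)
qed

text \<open>
  A high power of the glider has a coefficient that is supported on a single coset of the line
  stabilizer: multiply coefficients that vanish at the other points, one for each of them.
\<close>
lemma concentrated_coeff_fun:
  assumes "pointed G M u" "g \<in> carrier G" "finite S" "S \<subseteq> carrier G"
    "\<And>s. s \<in> S \<Longrightarrow> inv g \<otimes> s \<notin> line_stab G M u" "card S \<le> n"
  shows "\<exists>\<phi>. coeff_fun (tensor_power M n) (tensor_power_vec u n) \<phi> \<and> \<phi> g \<noteq> 0 \<and> (\<forall>s\<in>S. \<phi> s = 0)"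
  using assms(3-6)
proof (induction n arbitrary: S)
  case 0
  then show ?case using nonvanishing_coeff_fun[OF tensor_power_pointed[OF assms(1)] assms(2), of 0] by auto
next
  case (Suc n)
  obtain \<psi> S' where \<psi>: "coeff_fun M u \<psi>" "\<psi> g \<noteq> 0" and S': "S' \<subseteq> S" "card S' \<le> n" "\<forall>s\<in>S - S'. \<psi> s = 0"
  proof (cases "S = {}")
    case True
    then show ?thesis using that[of _ "{}"] nonvanishing_coeff_fun[OF assms(1,2)] by auto
  next
    case False
    then obtain s where s: "s \<in> S" by blast
    then obtain \<psi> where "coeff_fun M u \<psi>" "\<psi> s = 0" "\<psi> g \<noteq> 0"
      using separating_coeff_fun[OF assms(1) _ assms(2), of s] Suc.prems by blast
    moreover have "card (S - {s}) \<le> n" using s Suc.prems by simp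
    moreover have "S - (S - {s}) = {s}" using s by blast
    ultimately show ?thesis using that[of \<psi> "S - {s}"] by simp
  qed
  have fin': "finite S'" using S'(1) Suc.prems(1) by (rule finite_subset)
  have sub': "S' \<subseteq> carrier G" using S'(1) Suc.prems(2) by (rule subset_trans)
  have not': "inv g \<otimes> s \<notin> line_stab G M u" if "s \<in> S'" for s using Suc.prems(3)[of s] S'(1) that by blast
  obtain \<phi> where \<phi>: "coeff_fun (tensor_power M n) (tensor_power_vec u n) \<phi>" "\<phi> g \<noteq> 0" "\<forall>s\<in>S'. \<phi> s = 0"
    using Suc.IH[OF fin' sub' not' S'(2)] by blast
  have "coeff_fun (tensor_power M (Suc n)) (tensor_power_vec u (Suc n)) (\<lambda>y. \<psi> y * \<phi> y)"
    using coeff_fun_mult[OF assms(1) tensor_power_pointed[OF assms(1)] \<psi>(1) \<phi>(1)] by simp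
  moreover have "\<forall>s\<in>S. \<psi> s * \<phi> s = 0" using S' \<phi>(3) by auto
  ultimately show ?case using \<psi>(2) \<phi>(2) by (intro exI[of _ "\<lambda>y. \<psi> y * \<phi> y"]) auto
qed

text \<open>
  Pair the relation with a coefficient that is concentrated on the coset \<open>g H\<close>.
\<close>
lemma coset_sum_zero:
  assumes "pointed G M u" "card (carrier G) \<le> n" "orbit_comb G (tensor_power M n) (tensor_power_vec u n) x = 0" "g \<in> carrier G"
  shows "(\<Sum>h\<in>line_stab G M u. x (g \<otimes> h) * line_char M u h ^ n) = 0"
proof -
  let ?H = "line_stab G M u"
  let ?S = "carrier G - (\<lambda>h. g \<otimes> h) ` ?H"
  have "inv g \<otimes> s \<notin> ?H" if "s \<in> ?S" for s
  proof
    assume "inv g \<otimes> s \<in> ?H"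
    moreover have "g \<otimes> (inv g \<otimes> s) = s" using that assms(4) by (simp flip: m_assoc)
    ultimately show False using that by (metis DiffD2 image_eqI)
  qed
  moreover have "card ?S \<le> n" using card_mono[OF finite_carrier, of ?S] assms(2) by auto
  ultimately obtain \<phi> where \<phi>: "coeff_fun (tensor_power M n) (tensor_power_vec u n) \<phi>" "\<phi> g \<noteq> 0" "\<forall>s\<in>?S. \<phi> s = 0"
    using concentrated_coeff_fun[OF assms(1,4), of ?S n] finite_carrier by auto
  have inj: "inj_on (\<lambda>h. g \<otimes> h) ?H"
  proof (rule inj_onI)
    fix h h' assume "h \<in> ?H" "h' \<in> ?H" and e: "g \<otimes> h = g \<otimes> h'"
    then have "h \<in> carrier G" "h' \<in> carrier G" by (simp_all add: line_stab_def)
    then show "h = h'" using e assms(4) by simp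
  qed
  have "0 = (\<Sum>y\<in>carrier G. x y * \<phi> y)" using \<phi>(1) assms(3) by (simp add: coeff_fun_def)
  also have "\<dots> = (\<Sum>y\<in>(\<lambda>h. g \<otimes> h) ` ?H. x y * \<phi> y)"
    using finite_carrier \<phi>(3) assms(4) line_stab_subset[of M u] by (intro sum.mono_neutral_right) auto
  also have "\<dots> = (\<Sum>h\<in>?H. x (g \<otimes> h) * \<phi> (g \<otimes> h))" by (simp add: sum.reindex[OF inj])
  also have "\<dots> = (\<Sum>h\<in>?H. \<phi> g * (x (g \<otimes> h) * line_char M u h ^ n))"
    using coeff_fun_equivariant[OF tensor_power_pointed[OF assms(1)] \<phi>(1) assms(4)] tensor_power_line_stab[OF assms(1), of _ n]
    by (intro sum.cong refl) simp
  finally show ?thesis using \<phi>(2) by (simp flip: sum_distrib_left)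
qed

text \<open>
  Coefficients of a power transform under right translation by the n-th power of the character;
  averaging over the stabilizer therefore expresses the pairing with such a function through the
  coset sums of the preceding lemma, which depend on the stabilizer and the character only.
\<close>
lemma tensor_power_annihilator:
  fixes M N :: "('a, nat \<Rightarrow>\<^sub>0 'k::field_char_0) glider"
  assumes M: "pointed G M u" and N: "pointed G N v" and st: "line_stab G M u = line_stab G N v"
    and w: "\<And>h. h \<in> line_stab G M u \<Longrightarrow> line_char M u h = line_char N v h"
    and n: "card (carrier G) \<le> n" and x: "orbit_comb G (tensor_power M n) (tensor_power_vec u n) x = 0"
  shows "orbit_comb G (tensor_power N n) (tensor_power_vec v n) x = 0"
proof (rule poly_mapping_eqI)
  fix j
  let ?H = "line_stab G M u"
  let ?\<psi> = "\<lambda>g. lookup (act (tensor_power N n) g (tensor_power_vec v n)) j"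
  have fH: "finite ?H" "?H \<noteq> {}" "?H \<subseteq> carrier G"
    using finite_subset[OF line_stab_subset finite_carrier] subgroup.one_closed[OF line_stab_subgroup[OF M]] line_stab_subset by blast+
  have eq: "?\<psi> (g \<otimes> h) = line_char M u h ^ n * ?\<psi> g" if "g \<in> carrier G" "h \<in> ?H" for g h
    using coeff_fun_equivariant[OF tensor_power_pointed[OF N] coeff_fun_coordinate that(1), of h n] tensor_power_line_stab[OF N, of h n] that st w
    by simp
  have shift: "(\<Sum>g\<in>carrier G. x (g \<otimes> h) * ?\<psi> (g \<otimes> h)) = (\<Sum>g\<in>carrier G. x g * ?\<psi> g)" if h: "h \<in> carrier G" for h
  proof (rule sum.reindex_bij_witness[of _ "\<lambda>g. g \<otimes> inv h" "\<lambda>g. g \<otimes> h"])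
  qed (use h in \<open>auto simp: m_assoc\<close>)
  have "of_nat (card ?H) * (\<Sum>g\<in>carrier G. x g * ?\<psi> g) = (\<Sum>h\<in>?H. \<Sum>g\<in>carrier G. x (g \<otimes> h) * ?\<psi> (g \<otimes> h))"
    using shift fH(3) by (simp add: subset_iff)
  also have "\<dots> = (\<Sum>g\<in>carrier G. \<Sum>h\<in>?H. x (g \<otimes> h) * ?\<psi> (g \<otimes> h))" by (rule sum.swap)
  also have "\<dots> = (\<Sum>g\<in>carrier G. ?\<psi> g * (\<Sum>h\<in>?H. x (g \<otimes> h) * line_char M u h ^ n))"
    unfolding sum_distrib_left by (intro sum.cong refl) (simp add: eq mult_ac)
  also have "\<dots> = 0" using coset_sum_zero[OF M n x] by simp
  finally have "(\<Sum>g\<in>carrier G. x g * ?\<psi> g) = 0" using fH by simp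
  then show "lookup (orbit_comb G (tensor_power N n) (tensor_power_vec v n) x) j = lookup 0 j" by (simp add: lookup_orbit_comb)
qed

end

subsection \<open>Every character of every subgroup occurs\<close>

context finite_group
begin

text \<open>
  In the regular module the vector \<open>\<Sum>\<^sub>h \<chi>(h)\<^sup>-\<^sup>1 h\<close>, with the sum over \<open>H\<close>, is multiplied by \<open>\<chi>(g)\<close> when
  \<open>g \<in> H\<close>, and it is moved to a vector with support \<open>g H\<close> otherwise. The regular module is placed
  in the space with basis \<open>nat\<close> by numbering the group elements; the remaining basis vectors are
  fixed.
\<close>
lemma induced_glider_exists:
  fixes \<chi> :: "'a \<Rightarrow> 'k::field"
  assumes H: "subgroup H G" and \<chi>: "\<And>h. h \<in> H \<Longrightarrow> \<chi> h \<noteq> 0" "\<And>g h. g \<in> H \<Longrightarrow> h \<in> H \<Longrightarrow> \<chi> (g \<otimes> h) = \<chi> g * \<chi> h"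
  shows "\<exists>(M :: ('a, nat \<Rightarrow>\<^sub>0 'k) glider) u. pointed G M u \<and> line_stab G M u = H \<and> (\<forall>h\<in>H. line_char M u h = \<chi> h)"
proof -
  obtain e :: "'a \<Rightarrow> nat" where e: "inj_on e (carrier G)"
    using finite_imp_inj_to_nat_seg[OF finite_carrier] by blast
  define d where "d = inv_into (carrier G) e"
  have de: "d (e g) = g" if "g \<in> carrier G" for g using e that by (simp add: d_def)
  define perm where "perm g i = (if i \<in> e ` carrier G then e (g \<otimes> d i) else i)" for g i
  have perm_e: "perm g (e y) = e (g \<otimes> y)" if "y \<in> carrier G" for g y using that by (simp add: perm_def de)
  have perm_out: "perm g i = i" if "i \<notin> e ` carrier G" for g i using that by (simp add: perm_def)
  have perm_mult: "perm (g \<otimes> h) i = perm g (perm h i)" if "g \<in> carrier G" "h \<in> carrier G" for g h i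
    by (cases "i \<in> e ` carrier G") (use that in \<open>auto simp: perm_e perm_out m_assoc\<close>)
  have perm_one: "perm \<one> i = i" for i
    by (cases "i \<in> e ` carrier G") (auto simp: perm_e perm_out)
  have inj_perm: "inj (perm g)" if "g \<in> carrier G" for g
    using perm_mult[of "inv g" g] perm_one that by (intro inj_on_inverseI[of _ "perm (inv g)"]) auto
  have Hc: "H \<subseteq> carrier G" using subgroup.subset[OF H] .
  define u :: "nat \<Rightarrow>\<^sub>0 'k" where "u = (\<Sum>h\<in>H. single (e h) (inverse (\<chi> h)))"
  have lu: "lookup u (e y) = (if y \<in> H then inverse (\<chi> y) else 0)" if "y \<in> carrier G" for y
  proof -
    have "lookup u (e y) = (\<Sum>h\<in>H. if h = y then inverse (\<chi> h) else 0)"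
      unfolding u_def lookup_sum
    proof (intro sum.cong refl)
      fix h assume "h \<in> H"
      then have "e h = e y \<longleftrightarrow> h = y" using e that Hc by (auto dest: inj_onD)
      then show "lookup (single (e h) (inverse (\<chi> h))) (e y) = (if h = y then inverse (\<chi> h) else 0)"
        by (simp add: lookup_single when_def)
    qed
    then show ?thesis using finite_subset[OF Hc finite_carrier] by simp
  qed
  have lu_out: "lookup u i = 0" if "i \<notin> e ` carrier G" for i
    unfolding u_def lookup_sum by (intro sum.neutral) (use that Hc in \<open>auto simp: lookup_single when_def\<close>)
  define M where "M = \<lparr>act = (\<lambda>g. push_vec (perm g) :: (nat \<Rightarrow>\<^sub>0 'k) \<Rightarrow> _),
    lev0 = fvs.span ((\<lambda>g. push_vec (perm g) u) ` carrier G), lev1 = fvs.span {u}\<rparr>"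
  have actM: "act M g = push_vec (perm g)" for g by (simp add: M_def)
  have p1: "push_vec (perm \<one>) v = v" for v :: "nat \<Rightarrow>\<^sub>0 'k"
  proof -
    have "perm \<one> = (\<lambda>i. i)" using perm_one by blast
    then show ?thesis by (simp only: push_id)
  qed
  have gM: "is_glider G M"
    unfolding is_glider_iff
  proof (intro conjI ballI allI)
    show "finite_dim_subspace (lev0 M)" unfolding M_def by (simp add: finite_carrier finite_dim_span)
    show "finite_dim_subspace (lev1 M)" unfolding M_def by (simp add: finite_dim_span)
    show "lev1 M \<subseteq> lev0 M" unfolding M_def using p1[of u] by (auto intro!: fvs.span_mono image_eqI[of _ _ \<one>])
    show "act M (g \<otimes> h) v = act M g (act M h v)" if "g \<in> carrier G" "h \<in> carrier G" for g h v
    proof -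
      have "perm (g \<otimes> h) = (\<lambda>i. perm g (perm h i))" using perm_mult[OF that] by blast
      then show ?thesis by (simp only: actM push_push)
    qed
    show "act M g m \<in> lev0 M" if g: "g \<in> carrier G" and m: "m \<in> lev1 M" for g m
    proof -
      obtain c where "m = vscale c u" using m by (auto simp: M_def fvs.span_singleton)
      moreover have "push_vec (perm g) u \<in> lev0 M"
        using g by (simp add: M_def fvs.span_base)
      moreover have "fvs.subspace (lev0 M)" by (simp add: M_def)
      ultimately show ?thesis by (simp add: actM lin_scale[OF lin_push] fvs.subspace_scale)
    qed
  qed (simp_all add: actM p1)
  have shift: "lookup (act M g u) (e y) = lookup u (e (inv g \<otimes> y))" if "g \<in> carrier G" "y \<in> carrier G" for g y
  proof -
    have "e y = perm g (e (inv g \<otimes> y))" using that by (simp add: perm_e flip: m_assoc)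
    then show ?thesis by (simp add: actM lookup_push_inj[OF inj_perm[OF that(1)]])
  qed
  have shift_out: "lookup (act M g u) i = 0" if "g \<in> carrier G" "i \<notin> e ` carrier G" for g i
    using lookup_push_inj[OF inj_perm[OF that(1)], of u i] lu_out[OF that(2)] perm_out[OF that(2)] by (simp add: actM)
  have oneH: "\<one> \<in> H" using subgroup.one_closed[OF H] .
  have u0: "u \<noteq> 0" using lu[OF one_closed] oneH \<chi>(1)[OF oneH] by auto
  have pt: "pointed G M u" using gM u0 by (simp add: pointed_def M_def)
  have act_H: "act M g u = vscale (\<chi> g) u" if g: "g \<in> H" for g
  proof (rule poly_mapping_eqI)
    fix i
    have gc: "g \<in> carrier G" using g Hc by blast
    show "lookup (act M g u) i = lookup (vscale (\<chi> g) u) i"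
    proof (cases "i \<in> e ` carrier G")
      case True
      then obtain y where y: "y \<in> carrier G" "i = e y" by blast
      have mem: "inv g \<otimes> y \<in> H \<longleftrightarrow> y \<in> H"
      proof
        assume "inv g \<otimes> y \<in> H"
        then have "g \<otimes> (inv g \<otimes> y) \<in> H" using subgroup.m_closed[OF H g] by blast
        then show "y \<in> H" using gc y by (simp flip: m_assoc)
      qed (use subgroup.m_closed[OF H] subgroup.m_inv_closed[OF H g] in blast)
      have "\<chi> y = \<chi> g * \<chi> (inv g \<otimes> y)" if "y \<in> H"
        using \<chi>(2)[OF g, of "inv g \<otimes> y"] mem that gc y by (simp flip: m_assoc)
      then show ?thesis using shift[OF gc y(1)] lu[OF y(1)] lu[of "inv g \<otimes> y"] mem gc y \<chi>(1)[OF g]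
        by (simp add: field_simps)
    next
      case False
      then show ?thesis using shift_out[OF gc] lu_out by simp
    qed
  qed
  have "g \<in> H" if g: "g \<in> carrier G" and c: "act M g u = vscale c u" for g c
  proof -
    have "lookup (act M g u) (e g) \<noteq> 0" using shift[OF g g] lu[OF one_closed] oneH \<chi>(1)[OF oneH] g by simp
    then show "g \<in> H" using c lu[OF g] by (auto split: if_splits)
  qed
  then have "line_stab G M u = H" using act_H Hc by (auto simp: line_stab_def)
  moreover have "\<forall>h\<in>H. line_char M u h = \<chi> h" by (simp add: line_char_eq[OF u0 act_H])
  ultimately have "pointed G M u \<and> line_stab G M u = H \<and> (\<forall>h\<in>H. line_char M u h = \<chi> h)" using pt by simp
  then show ?thesis by (intro exI)
qed

end

section \<open>The ring of irreducible gliders\<close>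

definition int_ext :: "('a \<Rightarrow> rat) \<Rightarrow> ('a \<Rightarrow>\<^sub>0 int) \<Rightarrow> rat" where
  "int_ext f x = (\<Sum>a\<in>keys x. of_int (lookup x a) * f a)"

lemma int_ext_add: "int_ext f (x + y) = int_ext f x + int_ext f y"
  unfolding int_ext_def by (rule setsum_keys_plus_distrib) (simp_all add: distrib_right)

lemma int_ext_single [simp]: "int_ext f (single a n) = of_int n * f a"
  by (simp add: int_ext_def)

lemma int_ext_diff: "int_ext f (x - y) = int_ext f x - int_ext f y"
  using int_ext_add[of f "x - y" y] by simp

lemma additive_int_ext: "additive_map (monoid_algebra M) (int_ext f)"
  by (simp add: additive_map_def int_ext_add)

text \<open>
  The parameter \<open>T\<close> fixes the ground field, which is not determined by the group. It will be the
  family of identifications between abelianizations and character groups.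
\<close>
locale glider_rings = finite_group G for G (structure) +
  fixes T :: "'a set \<Rightarrow> 'a set \<Rightarrow> 'a \<Rightarrow> 'k::field_char_0"
begin

abbreviation "ZP \<equiv> iso_class_ring G :: (('a, 'k) glider_class \<Rightarrow>\<^sub>0 int) ring"
abbreviation "SR \<equiv> split_grothendieck_ring G :: ('a, 'k) split_class ring"
abbreviation "RR \<equiv> reduced_ring G :: ('a, 'k) split_class set ring"
abbreviation "IR \<equiv> irreducible_ring G :: ('a, 'k) split_class set ring"
abbreviation iso1 :: "('a, nat \<Rightarrow>\<^sub>0 'k) glider \<Rightarrow> (('a, 'k) glider_class \<Rightarrow>\<^sub>0 int)" where
  "iso1 M \<equiv> single (iso_class G M) 1"

lemma P_monoid: "Group.comm_monoid (iso_class_monoid G :: ('a, 'k) glider_class monoid)"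
  by (rule iso_class_comm_monoid[OF group_axioms])

sublocale ZP: cring ZP
  unfolding iso_class_ring_def by (rule monoid_algebra_cring[OF P_monoid])

lemma iso1_carrier: "is_glider G M \<Longrightarrow> iso1 M \<in> carrier ZP"
  using iso_class_carrier[of G M] by (auto simp: iso_class_ring_def)

lemma ZP_carrier_diff: "x \<in> carrier ZP \<Longrightarrow> y \<in> carrier ZP \<Longrightarrow> x - y \<in> carrier ZP"
  using keys_diff[of x y] by (auto simp: iso_class_ring_def)

lemma ZP_diff: "x \<in> carrier ZP \<Longrightarrow> y \<in> carrier ZP \<Longrightarrow> x \<ominus>\<^bsub>ZP\<^esub> y = x - y"
  using monoid_algebra_minus[OF P_monoid, of y] by (simp add: a_minus_def iso_class_ring_def)

lemma ZP_add: "x \<oplus>\<^bsub>ZP\<^esub> y = x + y"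
  by (simp add: iso_class_ring_def)

lemma iso1_mult: "is_glider G M \<Longrightarrow> is_glider G N \<Longrightarrow> iso1 M \<otimes>\<^bsub>ZP\<^esub> iso1 N = iso1 (ntensor M N)"
  by (simp add: iso_class_ring_def iso_class_mult[OF group_axioms] iso_class_ntensor[OF group_axioms])

lemma ZP_diff_distrib:
  assumes "x \<in> carrier ZP" "y \<in> carrier ZP" "z \<in> carrier ZP"
  shows "x \<otimes>\<^bsub>ZP\<^esub> (y - z) = x \<otimes>\<^bsub>ZP\<^esub> y - x \<otimes>\<^bsub>ZP\<^esub> z"
  using assms by (simp flip: ZP_diff add: a_minus_def ZP.r_distr ZP.r_minus)

abbreviation split_relations :: "(('a, 'k) glider_class \<Rightarrow>\<^sub>0 int) set" where
  "split_relations \<equiv> {single (iso_class G (glider_sum M N)) 1 - iso1 M - iso1 N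
      | (M :: ('a, nat \<Rightarrow>\<^sub>0 'k) glider) (N :: ('a, nat \<Rightarrow>\<^sub>0 'k) glider). is_glider G M \<and> is_glider G N}"

lemma nsum_relation: "is_glider G M \<Longrightarrow> is_glider G N \<Longrightarrow> iso1 (nsum M N) - iso1 M - iso1 N \<in> split_relations"
  by (intro CollectI exI[of _ M] exI[of _ N]) (simp add: iso_class_nsum)

lemma split_relationsE:
  assumes "x \<in> split_relations"
  obtains M N where "is_glider G M" "is_glider G N" "x = iso1 (nsum M N) - iso1 M - iso1 N"
proof -
  obtain M N :: "('a, nat \<Rightarrow>\<^sub>0 'k) glider" where "is_glider G M" "is_glider G N"
      "x = single (iso_class G (glider_sum M N)) 1 - iso1 M - iso1 N"
    using assms by blast
  then show thesis using that[of M N] by (simp add: iso_class_nsum)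
qed

lemma split_relations_carrier: "split_relations \<subseteq> carrier ZP"
proof
  fix x assume "x \<in> split_relations"
  then show "x \<in> carrier ZP"
    by (elim split_relationsE) (auto intro!: ZP_carrier_diff iso1_carrier nsum(1))
qed

lemma nsum_distrib:
  fixes M N L :: "('a, nat \<Rightarrow>\<^sub>0 'k) glider"
  assumes "is_glider G M" "is_glider G N" "is_glider G L"
  shows "iso_class G (ntensor L (nsum M N)) = iso_class G (nsum (ntensor L M) (ntensor L N))"
proof -
  note tg = glider_tensor_glider[OF group_axioms] and nt = ntensor[OF group_axioms]
  note s = nsum[OF assms(1,2)]
  have "iso_class G (ntensor L (nsum M N)) = iso_class G (glider_tensor L (nsum M N))"
    using iso_class_ntensor[OF group_axioms assms(3) s(1)] by simp
  also have "\<dots> = iso_class G (glider_tensor (nsum M N) L)"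
    by (rule iso_class_eqI[OF tg[OF assms(3) s(1)] tg[OF s(1) assms(3)] tensor_commute[OF group_axioms assms(3) s(1)]])
  also have "\<dots> = iso_class G (glider_tensor (glider_sum M N) L)"
    by (rule iso_class_eqI[OF tg[OF glider_sum_glider[OF assms(1,2)] assms(3)] tg[OF s(1) assms(3)]
          tensor_cong[OF group_axioms glider_sum_glider[OF assms(1,2)] assms(3) s(1) assms(3) s(2) isomorphic_refl[OF assms(3)]], symmetric])
  also have "\<dots> = iso_class G (glider_sum (glider_tensor M L) (glider_tensor N L))"
    by (rule iso_class_eqI[OF tg[OF glider_sum_glider[OF assms(1,2)] assms(3)]
          glider_sum_glider[OF tg[OF assms(1,3)] tg[OF assms(2,3)]] tensor_sum_distrib[OF group_axioms assms]])
  also have "\<dots> = iso_class G (glider_sum (ntensor L M) (ntensor L N))"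
  proof -
    have 1: "glider_isomorphic G (glider_tensor M L) (ntensor L M)" if "is_glider G M" for M :: "('a, nat \<Rightarrow>\<^sub>0 'k) glider"
      by (rule isomorphic_trans[OF tg[OF that assms(3)] tg[OF assms(3) that] nt(1)[OF assms(3) that]
            tensor_commute[OF group_axioms that assms(3)] nt(2)[OF assms(3) that]])
    show ?thesis
      by (rule iso_class_eqI[OF glider_sum_glider[OF tg[OF assms(1,3)] tg[OF assms(2,3)]]
            glider_sum_glider[OF nt(1)[OF assms(3,1)] nt(1)[OF assms(3,2)]]
            glider_sum_cong[OF tg[OF assms(1,3)] tg[OF assms(2,3)] nt(1)[OF assms(3,1)] nt(1)[OF assms(3,2)] 1[OF assms(1)] 1[OF assms(2)]]])
  qed
  also have "\<dots> = iso_class G (nsum (ntensor L M) (ntensor L N))"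
    by (rule iso_class_nsum[OF nt(1)[OF assms(3,1)] nt(1)[OF assms(3,2)]])
  finally show ?thesis .
qed

text \<open>
  Multiplication by the class of a glider maps relations to relations, by \<open>nsum_distrib\<close>.
\<close>
lemma split_ideal: "ideal (split_ideal G) ZP"
  unfolding split_ideal_def
proof (rule ZP.additive_span_ideal[OF split_relations_carrier])
  let ?E = "(\<lambda>m. single m (1::int)) ` carrier (iso_class_monoid G :: ('a, 'k) glider_class monoid)"
  show "?E \<subseteq> carrier ZP" by (auto simp: iso_class_ring_def)
  show "carrier ZP \<subseteq> additive_span ZP ?E"
    unfolding iso_class_ring_def by (rule monoid_algebra_int_span[OF P_monoid])
  fix c x assume "c \<in> ?E" and x: "x \<in> split_relations"
  then obtain L :: "('a, nat \<Rightarrow>\<^sub>0 'k) glider" where L: "is_glider G L" "c = iso1 L"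
    by (auto elim: iso_class_carrierE)
  obtain M N where MN: "is_glider G M" "is_glider G N" "x = iso1 (nsum M N) - iso1 M - iso1 N"
    using x by (rule split_relationsE)
  note nt = ntensor(1)[OF group_axioms L(1)] and s = nsum(1)[OF MN(1,2)]
  have "c \<otimes>\<^bsub>ZP\<^esub> x = iso1 (nsum (ntensor L M) (ntensor L N)) - iso1 (ntensor L M) - iso1 (ntensor L N)"
    using L MN s
    by (simp add: ZP_diff_distrib ZP_carrier_diff iso1_carrier iso1_mult nsum_distrib)
  then have "c \<otimes>\<^bsub>ZP\<^esub> x \<in> split_relations" using nsum_relation[OF nt[OF MN(1)] nt[OF MN(2)]] by simp
  then show "c \<otimes>\<^bsub>ZP\<^esub> x \<in> additive_span ZP split_relations" by (rule ZP.additive_span_base)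
qed

sublocale SI: ideal "split_ideal G" ZP by (rule split_ideal)

sublocale SR: cring SR
  unfolding split_grothendieck_ring_def by (rule SI.quotient_is_cring[OF ZP.is_cring])

lemma split_class_cong: "iso_class G M = iso_class G N \<Longrightarrow> split_class G M = split_class G N"
  by (simp add: split_class_def)

lemma split_class_carrier: "is_glider G M \<Longrightarrow> split_class G (M :: ('a, nat \<Rightarrow>\<^sub>0 'k) glider) \<in> carrier SR"
  unfolding split_class_def split_grothendieck_ring_def SI.quot_carrier using iso1_carrier by blast

lemma split_class_mult:
  fixes M N :: "('a, nat \<Rightarrow>\<^sub>0 'k) glider"
  assumes "is_glider G M" "is_glider G N"
  shows "split_class G M \<otimes>\<^bsub>SR\<^esub> split_class G N = split_class G (ntensor M N)"
  unfolding split_class_def split_grothendieck_ring_def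
  by (simp add: SI.quot_simps iso1_carrier assms iso1_mult)

lemma split_class_add:
  fixes M N :: "('a, nat \<Rightarrow>\<^sub>0 'k) glider"
  assumes "is_glider G M" "is_glider G N"
  shows "split_class G (nsum M N) = split_class G M \<oplus>\<^bsub>SR\<^esub> split_class G N"
proof -
  have c: "iso1 (nsum M N) \<in> carrier ZP" "iso1 M + iso1 N \<in> carrier ZP"
    using iso1_carrier assms nsum(1) ZP.a_closed[OF iso1_carrier[OF assms(1)] iso1_carrier[OF assms(2)]]
    by (auto simp: ZP_add)
  have "iso1 (nsum M N) - (iso1 M + iso1 N) \<in> split_ideal G"
    using ZP.additive_span_base[OF nsum_relation[OF assms]] by (simp add: split_ideal_def diff_diff_add)
  then have "split_class G (nsum M N) = split_ideal G +>\<^bsub>ZP\<^esub> (iso1 M + iso1 N)"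
    unfolding split_class_def using ZP.quotient_eq_iff_same_a_r_cos[OF split_ideal c] c by (simp add: ZP_diff)
  then show ?thesis
    unfolding split_class_def split_grothendieck_ring_def
    by (simp add: SI.quot_simps iso1_carrier assms ZP_add)
qed

lemma split_span: "carrier SR \<subseteq> additive_span SR {split_class G M | M :: ('a, nat \<Rightarrow>\<^sub>0 'k) glider. is_glider G M}"
proof -
  have E: "(\<lambda>m. single m 1) ` carrier (iso_class_monoid G :: ('a, 'k) glider_class monoid) \<subseteq> carrier ZP"
    by (auto simp: iso_class_ring_def)
  have "carrier ZP \<subseteq> additive_span ZP ((\<lambda>m. single m 1) ` carrier (iso_class_monoid G :: ('a, 'k) glider_class monoid))"
    unfolding iso_class_ring_def by (rule monoid_algebra_int_span[OF P_monoid])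
  from SI.quot_span[OF this E]
  have "carrier SR \<subseteq> additive_span SR ((\<lambda>x. split_ideal G +>\<^bsub>ZP\<^esub> x) ` (\<lambda>m. single m 1) ` carrier (iso_class_monoid G :: ('a, 'k) glider_class monoid))"
    unfolding split_grothendieck_ring_def .
  also have "(\<lambda>x. split_ideal G +>\<^bsub>ZP\<^esub> x) ` (\<lambda>m. single m 1) ` carrier (iso_class_monoid G :: ('a, 'k) glider_class monoid) =
      {split_class G M | M :: ('a, nat \<Rightarrow>\<^sub>0 'k) glider. is_glider G M}"
    by (auto simp: split_class_def iso_class_monoid_def image_def)
  finally show ?thesis .
qed

text \<open>
  A tensor product with a glider of length zero has length zero.
\<close>
lemma length_zero_ideal: "ideal (length_zero_ideal G) SR"
  unfolding length_zero_ideal_def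
proof (rule SR.additive_span_ideal[OF _ _ split_span])
  show "{split_class G M | M :: ('a, nat \<Rightarrow>\<^sub>0 'k) glider. is_glider G M} \<subseteq> carrier SR"
    using split_class_carrier by blast
  show "{split_class G M | M :: ('a, nat \<Rightarrow>\<^sub>0 'k) glider. is_glider G M \<and> glider_length M = 0} \<subseteq> carrier SR"
    using split_class_carrier by blast
  fix c x
  assume "c \<in> {split_class G M | M :: ('a, nat \<Rightarrow>\<^sub>0 'k) glider. is_glider G M}"
    and "x \<in> {split_class G M | M :: ('a, nat \<Rightarrow>\<^sub>0 'k) glider. is_glider G M \<and> glider_length M = 0}"
  then obtain L M :: "('a, nat \<Rightarrow>\<^sub>0 'k) glider" where LM: "is_glider G L" "c = split_class G L"
      "is_glider G M" "x = split_class G M" "glider_length M = 0" by blast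
  have "c \<otimes>\<^bsub>SR\<^esub> x = split_class G (ntensor M L)"
    using LM SR.m_comm split_class_carrier split_class_mult by metis
  moreover have "glider_length (ntensor M L) = 0"
    using tensor_length_zero[of M L] LM(5)
    by (auto simp: glider_length_def ntensor_def reindex_def lin_zero[OF lin_push] split: if_splits)
  ultimately show "c \<otimes>\<^bsub>SR\<^esub> x \<in> additive_span SR {split_class G M | M :: ('a, nat \<Rightarrow>\<^sub>0 'k) glider. is_glider G M \<and> glider_length M = 0}"
    using ntensor(1)[OF group_axioms LM(3,1)] by (intro SR.additive_span_base) blast
qed

sublocale LI: ideal "length_zero_ideal G" SR by (rule length_zero_ideal)

sublocale RR: cring RR
  unfolding reduced_ring_def by (rule LI.quotient_is_cring[OF SR.is_cring])

abbreviation cl :: "('a, nat \<Rightarrow>\<^sub>0 'k) glider \<Rightarrow> ('a, 'k) split_class set" where "cl M \<equiv> reduced_class G M"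

lemma cl_cong: "iso_class G M = iso_class G N \<Longrightarrow> cl M = cl N"
  unfolding reduced_class_def using split_class_cong by metis

lemma cl_isomorphic: "is_glider G M \<Longrightarrow> is_glider G N \<Longrightarrow> glider_isomorphic G M N \<Longrightarrow> cl M = cl N"
  by (intro cl_cong iso_class_eqI)

lemma cl_carrier: "is_glider G M \<Longrightarrow> cl M \<in> carrier RR"
  unfolding reduced_class_def reduced_ring_def LI.quot_carrier using split_class_carrier by blast

lemma cl_mult: "is_glider G M \<Longrightarrow> is_glider G N \<Longrightarrow> cl M \<otimes>\<^bsub>RR\<^esub> cl N = cl (ntensor M N)"
  unfolding reduced_class_def reduced_ring_def by (simp add: LI.quot_simps split_class_carrier split_class_mult)

lemma cl_add: "is_glider G M \<Longrightarrow> is_glider G N \<Longrightarrow> cl (nsum M N) = cl M \<oplus>\<^bsub>RR\<^esub> cl N"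
  unfolding reduced_class_def reduced_ring_def by (simp add: LI.quot_simps split_class_carrier split_class_add)

lemma cl_length_zero:
  assumes "is_glider G M" "lev1 M = {0}" shows "cl M = \<zero>\<^bsub>RR\<^esub>"
proof -
  have "split_class G M \<in> length_zero_ideal G"
    unfolding length_zero_ideal_def using assms by (intro SR.additive_span_base) (auto simp: glider_length_def)
  then show ?thesis
    unfolding reduced_class_def reduced_ring_def LI.quot_simps(4) using SR.a_rcos_zero[OF length_zero_ideal] by blast
qed

lemma cl_one: "\<one>\<^bsub>RR\<^esub> = cl (character_glider (\<lambda>_. 1))"
proof -
  have "\<one>\<^bsub>ZP\<^esub> = iso1 (character_glider (\<lambda>_. 1))" by (simp add: iso_class_ring_def iso_class_monoid_def)
  then have "\<one>\<^bsub>SR\<^esub> = split_class G (character_glider (\<lambda>_. 1) :: ('a, nat \<Rightarrow>\<^sub>0 'k) glider)"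
    by (simp add: split_grothendieck_ring_def SI.quot_simps split_class_def)
  then show ?thesis
    by (simp add: reduced_class_def reduced_ring_def LI.quot_simps)
qed

lemma cl_cyclic_part:
  assumes "pointed G M u" shows "cl M = cl (cyclic_part G M u)"
proof -
  obtain C :: "('a, nat \<Rightarrow>\<^sub>0 'k) glider" where C: "is_glider G C" "lev1 C = {0}" "glider_isomorphic G M (glider_sum (cyclic_part G M u) C)"
    using split_off_length_zero[OF assms] .
  note gM = pointed_glider[OF assms] and gc = pointed_glider[OF cyclic_part_irreducible(2)[OF assms]]
  have "iso_class G M = iso_class G (nsum (cyclic_part G M u) C)"
    using iso_class_eqI[OF gM glider_sum_glider[OF gc C(1)] C(3)] iso_class_nsum[OF gc C(1)] by simp
  then have "cl M = cl (cyclic_part G M u) \<oplus>\<^bsub>RR\<^esub> cl C" using cl_cong cl_add[OF gc C(1)] by metis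
  then show ?thesis using cl_length_zero[OF C(1,2)] cl_carrier[OF gc] by simp
qed

lemma cl_eqI:
  assumes "pointed G M u" "pointed G N v" "\<And>x. orbit_comb G M u x = 0 \<longleftrightarrow> orbit_comb G N v x = 0"
  shows "cl M = cl N"
  using cl_cyclic_part[OF assms(1)] cl_cyclic_part[OF assms(2)] cl_isomorphic[OF _ _ cyclic_part_isomorphic[OF assms]]
    pointed_glider[OF cyclic_part_irreducible(2)[OF assms(1)]] pointed_glider[OF cyclic_part_irreducible(2)[OF assms(2)]] by simp

definition irred_classes :: "('a, 'k) split_class set set" where
  "irred_classes = {cl M | M u. pointed G M u}"

lemma irred_classes_irreducible: "irred_classes = {cl M | M. irreducible_length_one G M}"
  unfolding irred_classes_def using irreducible_pointed cl_cyclic_part cyclic_part_irreducible(1) by blast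

lemma irred_classes_carrier: "irred_classes \<subseteq> carrier RR"
  unfolding irred_classes_def using cl_carrier pointed_glider by blast

lemma irred_classes_mult: "x \<in> irred_classes \<Longrightarrow> y \<in> irred_classes \<Longrightarrow> x \<otimes>\<^bsub>RR\<^esub> y \<in> irred_classes"
  unfolding irred_classes_def using cl_mult pointed_glider ntensor_pointed[OF group_axioms] by (smt (verit) mem_Collect_eq)

lemma one_pointed: "pointed G (character_glider (\<lambda>_. 1 :: 'k)) (single 0 1)"
  using tensor_power_pointed[of _ _ 0] one_glider[OF group_axioms] by (simp add: pointed_def character_glider_def)

lemma irred_classes_one: "\<one>\<^bsub>RR\<^esub> \<in> irred_classes"
  unfolding irred_classes_def cl_one using one_pointed by blast

lemma IR_def: "IR = RR\<lparr>carrier := generate_ring RR irred_classes\<rparr>"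
  unfolding irred_classes_irreducible irreducible_ring_def by simp

lemma IR_simps: "carrier IR = generate_ring RR irred_classes" "(\<otimes>\<^bsub>IR\<^esub>) = (\<otimes>\<^bsub>RR\<^esub>)" "(\<oplus>\<^bsub>IR\<^esub>) = (\<oplus>\<^bsub>RR\<^esub>)"
    "\<one>\<^bsub>IR\<^esub> = \<one>\<^bsub>RR\<^esub>" "\<zero>\<^bsub>IR\<^esub> = \<zero>\<^bsub>RR\<^esub>"
  by (simp_all add: IR_def)

lemma IR_cring: "cring IR"
proof -
  have "subring (generate_ring RR irred_classes) RR" by (rule RR.generate_ring_is_subring[OF irred_classes_carrier])
  then have "subcring (generate_ring RR irred_classes) RR" by (rule RR.subcringI')
  then show ?thesis unfolding IR_def using RR.subcring_iff[OF RR.generate_ring_incl[OF irred_classes_carrier]] by simp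
qed

sublocale IR: cring IR by (rule IR_cring)

lemma IR_carrier: "carrier IR \<subseteq> carrier RR"
  using RR.generate_ring_incl[OF irred_classes_carrier] by (simp add: IR_simps)

lemma irred_classes_IR: "irred_classes \<subseteq> carrier IR"
  by (auto simp: IR_simps intro: generate_ring.incl)

lemma IR_minus: "x \<in> carrier IR \<Longrightarrow> \<ominus>\<^bsub>RR\<^esub> x = \<ominus>\<^bsub>IR\<^esub> x"
  using IR.l_neg[of x] IR.a_inv_closed[of x] IR_carrier
  by (intro RR.minus_equality) (auto simp: IR_simps(3,5))

text \<open>
  The classes of irreducible gliders contain the unit and are closed under products, so the subring
  that they generate is their additive span.
\<close>
lemma irreducible_ring_span: "carrier IR \<subseteq> additive_span IR irred_classes"
proof
  define V where "V = additive_span IR irred_classes"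
  have VC: "V \<subseteq> carrier IR" unfolding V_def by (rule IR.additive_span_carrier[OF irred_classes_IR])
  have Vmult: "x \<otimes>\<^bsub>IR\<^esub> y \<in> V" if "x \<in> V" "y \<in> V" for x y
  proof -
    have wy: "w \<otimes>\<^bsub>IR\<^esub> y \<in> V" if w: "w \<in> irred_classes" for w
      using \<open>y \<in> V\<close> irred_classes_IR unfolding V_def
    proof (induction rule: IR.additive_span_induct)
      case (base v) then show ?case using irred_classes_mult[OF w] by (intro IR.additive_span_base) (simp add: IR_simps)
    next
      case (add a b) then show ?case using IR.additive_span_add w irred_classes_IR by (auto simp: IR.r_distr)
    next
      case (minus a) then show ?case using IR.additive_span_minus[OF irred_classes_IR] w irred_classes_IR by (auto simp: IR.r_minus)
    next
      case zero then show ?case using w irred_classes_IR IR.additive_span_zero by auto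
    qed
    show ?thesis using \<open>x \<in> V\<close> irred_classes_IR unfolding V_def
    proof (induction rule: IR.additive_span_induct)
      case (base w) show ?case using wy[OF base] unfolding V_def .
    next
      case (add a b) then show ?case using IR.additive_span_add \<open>y \<in> V\<close> VC by (auto simp: IR.l_distr)
    next
      case (minus a) then show ?case using IR.additive_span_minus[OF irred_classes_IR] \<open>y \<in> V\<close> VC by (auto simp: IR.l_minus)
    next
      case zero then show ?case using \<open>y \<in> V\<close> VC IR.additive_span_zero by auto
    qed
  qed
  fix x assume "x \<in> carrier IR"
  then have "x \<in> generate_ring RR irred_classes" by (simp add: IR_simps)
  then have "x \<in> V"
  proof (induction rule: generate_ring.induct)
    case one then show ?case unfolding V_def by (rule IR.additive_span_base[OF irred_classes_one])
  next
    case (incl h) then show ?case unfolding V_def by (rule IR.additive_span_base)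
  next
    case (a_inv h) then show ?case using IR.additive_span_minus[OF irred_classes_IR] VC by (auto simp: V_def IR_minus)
  next
    case (eng_add a b) then show ?case using IR.additive_span_add[of a irred_classes b] by (simp add: V_def IR_simps)
  next
    case (eng_mult a b) then show ?case using Vmult[of a b] by (simp add: IR_simps)
  qed
  then show "x \<in> additive_span IR irred_classes" by (simp add: V_def)
qed

end

subsection \<open>Multiplicities of characters\<close>

context glider_rings
begin

definition cdim :: "'a set \<Rightarrow> ('a \<Rightarrow> 'k) \<Rightarrow> ('a, 'k) glider_class \<Rightarrow> rat" where
  "cdim H \<chi> c = of_nat (eigendim H \<chi> (SOME M. M \<in> c))"

lemma cdim_iso_class:
  fixes M :: "('a, nat \<Rightarrow>\<^sub>0 'k) glider"
  assumes "is_glider G M" "H \<subseteq> carrier G"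
  shows "cdim H \<chi> (iso_class G M) = of_nat (eigendim H \<chi> M)"
proof -
  have "(SOME N. N \<in> iso_class G M) \<in> iso_class G M"
    using someI[of "\<lambda>N. N \<in> iso_class G M" M] in_iso_class[OF assms(1)] by blast
  then have "is_glider G (SOME N. N \<in> iso_class G M)" "glider_isomorphic G M (SOME N. N \<in> iso_class G M)"
    by (auto simp: iso_class_def)
  then show ?thesis unfolding cdim_def using eigendim_iso[OF assms(1) _ _ assms(2)] by metis
qed

lemma eigendim_nsum:
  assumes "is_glider G M" "is_glider G N" "H \<subseteq> carrier G"
  shows "eigendim H \<chi> (nsum M N) = eigendim H \<chi> M + eigendim H \<chi> N"
  using eigendim_sum[OF assms] eigendim_iso[OF glider_sum_glider[OF assms(1,2)] nsum[OF assms(1,2)] assms(3)] by metis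

text \<open>
  The dimension of the eigenspace descends through the successive quotients that define the ring;
  there is one function for each stage.
\<close>
definition delta_ZP :: "'a set \<Rightarrow> ('a \<Rightarrow> 'k) \<Rightarrow> (('a, 'k) glider_class \<Rightarrow>\<^sub>0 int) \<Rightarrow> rat" where
  "delta_ZP H \<chi> = int_ext (cdim H \<chi>)"

definition delta_SR :: "'a set \<Rightarrow> ('a \<Rightarrow> 'k) \<Rightarrow> ('a, 'k) split_class \<Rightarrow> rat" where
  "delta_SR H \<chi> = coset_lift (delta_ZP H \<chi>)"

definition delta_RR :: "'a set \<Rightarrow> ('a \<Rightarrow> 'k) \<Rightarrow> ('a, 'k) split_class set \<Rightarrow> rat" where
  "delta_RR H \<chi> = coset_lift (delta_SR H \<chi>)"

lemma delta_ZP_iso1: "is_glider G M \<Longrightarrow> H \<subseteq> carrier G \<Longrightarrow> delta_ZP H \<chi> (iso1 M) = of_nat (eigendim H \<chi> M)"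
  by (simp add: delta_ZP_def cdim_iso_class)

lemma delta_ZP_additive: "additive_map ZP (delta_ZP H \<chi>)"
  unfolding delta_ZP_def iso_class_ring_def by (rule additive_int_ext)

lemma delta_ZP_ideal:
  assumes "H \<subseteq> carrier G" "x \<in> split_ideal G" shows "delta_ZP H \<chi> x = 0"
proof (rule ZP.additive_map_span_zero[OF delta_ZP_additive split_relations_carrier])
  show "x \<in> additive_span ZP split_relations" using assms(2) by (simp add: split_ideal_def)
  fix y assume "y \<in> split_relations"
  then obtain M N where MN: "is_glider G M" "is_glider G N" "y = iso1 (nsum M N) - iso1 M - iso1 N"
    by (rule split_relationsE)
  have "delta_ZP H \<chi> y = delta_ZP H \<chi> (iso1 (nsum M N)) - delta_ZP H \<chi> (iso1 M) - delta_ZP H \<chi> (iso1 N)"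
    unfolding MN(3) delta_ZP_def int_ext_diff by simp
  then show "delta_ZP H \<chi> y = 0"
    using MN nsum(1)[OF MN(1,2)] assms(1) by (simp add: delta_ZP_iso1 eigendim_nsum)
qed

lemma delta_SR_class:
  assumes "is_glider G M" "H \<subseteq> carrier G"
  shows "delta_SR H \<chi> (split_class G M) = of_nat (eigendim H \<chi> (M :: ('a, nat \<Rightarrow>\<^sub>0 'k) glider))"
  unfolding delta_SR_def split_class_def
  using SI.coset_lift[OF delta_ZP_additive delta_ZP_ideal[OF assms(2)] iso1_carrier[OF assms(1)]]
  by (simp add: delta_ZP_iso1 assms)

lemma delta_SR_additive: "H \<subseteq> carrier G \<Longrightarrow> additive_map SR (delta_SR H \<chi>)"
  unfolding delta_SR_def split_grothendieck_ring_def
  by (rule SI.additive_coset_lift[OF delta_ZP_additive delta_ZP_ideal])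

lemma delta_SR_ideal:
  assumes "H \<subseteq> carrier G" "x \<in> length_zero_ideal G" shows "delta_SR H \<chi> x = 0"
proof (rule SR.additive_map_span_zero[OF delta_SR_additive[OF assms(1)]])
  let ?X = "{split_class G M | M :: ('a, nat \<Rightarrow>\<^sub>0 'k) glider. is_glider G M \<and> glider_length M = 0}"
  show "?X \<subseteq> carrier SR" using split_class_carrier by blast
  show "x \<in> additive_span SR ?X" using assms(2) by (simp add: length_zero_ideal_def)
  show "delta_SR H \<chi> y = 0" if "y \<in> ?X" for y
    using that delta_SR_class[OF _ assms(1)] eigendim_length_zero[OF _ assms(1)]
    by (auto simp: glider_length_def split: if_splits)
qed

lemma delta_RR_cl:
  assumes "is_glider G M" "H \<subseteq> carrier G"
  shows "delta_RR H \<chi> (cl M) = of_nat (eigendim H \<chi> M)"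
  unfolding delta_RR_def reduced_class_def
  using LI.coset_lift[OF delta_SR_additive[OF assms(2)] delta_SR_ideal[OF assms(2)] split_class_carrier[OF assms(1)]]
  by (simp add: delta_SR_class assms)

lemma delta_RR_additive: "H \<subseteq> carrier G \<Longrightarrow> additive_map RR (delta_RR H \<chi>)"
  unfolding delta_RR_def reduced_ring_def
  by (rule LI.additive_coset_lift[OF delta_SR_additive delta_SR_ideal])

abbreviation "QQ \<equiv> ring_of_type_algebra :: rat ring"

lemma QQ_simps [simp]: "carrier QQ = UNIV" "(\<otimes>\<^bsub>QQ\<^esub>) = (*)" "(\<oplus>\<^bsub>QQ\<^esub>) = (+)" "\<one>\<^bsub>QQ\<^esub> = 1" "\<zero>\<^bsub>QQ\<^esub> = 0"
  by (simp_all add: ring_of_type_algebra_def fun_eq_iff)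

sublocale TA: tensor_of_crings QQ IR
  by (intro tensor_of_crings.intro cring_from_type_algebra IR_cring)

abbreviation "A \<equiv> tensor_ring QQ IR"

abbreviation gl :: "rat \<Rightarrow> ('a, nat \<Rightarrow>\<^sub>0 'k) glider \<Rightarrow> (rat \<times> ('a, 'k) split_class set \<Rightarrow>\<^sub>0 int) set" where
  "gl q M \<equiv> pure_tensor QQ IR q (cl M)"

lemma cl_IR: "pointed G M u \<Longrightarrow> cl M \<in> carrier IR"
  using irred_classes_IR unfolding irred_classes_def by blast

lemma gl_carrier: "pointed G M u \<Longrightarrow> gl q M \<in> carrier A"
  by (rule TA.pure_carrier) (simp_all add: cl_IR)

lemma gl_mult: "pointed G M u \<Longrightarrow> pointed G N v \<Longrightarrow> gl q M \<otimes>\<^bsub>A\<^esub> gl r N = gl (q * r) (ntensor M N)"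
  using TA.pure_mult[of q "cl M" r "cl N"] cl_IR[of M u] cl_IR[of N v] cl_mult[of M N] pointed_glider[of G M u] pointed_glider[of G N v]
  by (simp add: IR_simps(2))

lemma gl_add: "pointed G M u \<Longrightarrow> gl (q + r) M = gl q M \<oplus>\<^bsub>A\<^esub> gl r M"
  using TA.pure_add_left[of q r "cl M"] cl_IR by simp

lemma gl_zero: "pointed G M u \<Longrightarrow> gl 0 M = \<zero>\<^bsub>A\<^esub>"
  using TA.pure_zero_left[of "cl M"] cl_IR by simp

lemma gl_one: "\<one>\<^bsub>A\<^esub> = gl 1 (character_glider (\<lambda>_. 1))"
  using TA.pure_one by (simp add: IR_simps(4) cl_one)

lemma A_induct [consumes 1, case_names gl add]:
  assumes "x \<in> carrier A" "\<And>q M u. pointed G M u \<Longrightarrow> P (gl q M)"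
    "\<And>x y. x \<in> carrier A \<Longrightarrow> y \<in> carrier A \<Longrightarrow> P x \<Longrightarrow> P y \<Longrightarrow> P (x \<oplus>\<^bsub>A\<^esub> y)"
  shows "P x"
proof (rule TA.tensor_induct[OF assms(1) irreducible_ring_span irred_classes_IR])
  show "P (pure_tensor QQ IR r w)" if "w \<in> irred_classes" for r w
    using that assms(2) unfolding irred_classes_def by blast
  show "P \<zero>\<^bsub>A\<^esub>" using assms(2)[OF one_pointed, of 0] gl_zero[OF one_pointed] by simp
qed (use assms(3) in auto)

text \<open>
  The rational extension of the eigenspace dimension, \<open>q \<otimes> r \<mapsto> q \<cdot> dim\<close>.
\<close>
definition delta :: "'a set \<Rightarrow> ('a \<Rightarrow> 'k) \<Rightarrow> (rat \<times> ('a, 'k) split_class set \<Rightarrow>\<^sub>0 int) set \<Rightarrow> rat" where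
  "delta H \<chi> = coset_lift (int_ext (\<lambda>(q, r). q * delta_RR H \<chi> r))"

lemma delta_relations:
  assumes "H \<subseteq> carrier G" "x \<in> tensor_ideal QQ IR"
  shows "int_ext (\<lambda>(q, r). q * delta_RR H \<chi> r) x = 0"
proof (rule TA.Z.additive_map_span_zero[OF additive_int_ext TA.relations_carrier])
  show "x \<in> additive_span TA.Z (tensor_relations QQ IR)" using assms(2) by (simp add: tensor_ideal_def)
  have "delta_RR H \<chi> (s \<oplus>\<^bsub>IR\<^esub> s') = delta_RR H \<chi> s + delta_RR H \<chi> s'" if "s \<in> carrier IR" "s' \<in> carrier IR" for s s'
    using delta_RR_additive[OF assms(1)] that IR_carrier unfolding additive_map_def IR_simps(3) by blast
  then show "int_ext (\<lambda>(q, r). q * delta_RR H \<chi> r) y = 0" if "y \<in> tensor_relations QQ IR" for y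
    using that unfolding tensor_relations_def by (auto simp: int_ext_diff distrib_left distrib_right)
qed

lemma delta_additive: "H \<subseteq> carrier G \<Longrightarrow> additive_map A (delta H \<chi>)"
  unfolding delta_def tensor_ring_def
  by (rule TA.I.additive_coset_lift[OF additive_int_ext delta_relations])

lemma delta_add: "H \<subseteq> carrier G \<Longrightarrow> x \<in> carrier A \<Longrightarrow> y \<in> carrier A \<Longrightarrow> delta H \<chi> (x \<oplus>\<^bsub>A\<^esub> y) = delta H \<chi> x + delta H \<chi> y"
  using delta_additive unfolding additive_map_def by blast

lemma delta_eigendim:
  assumes "pointed G M u" "H \<subseteq> carrier G"
  shows "delta H \<chi> (gl q M) = q * of_nat (eigendim H \<chi> M)"
proof -
  have "single (q, cl M) 1 \<in> carrier TA.Z" using cl_IR[OF assms(1)] by (auto simp: DirProd_def)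
  from TA.I.coset_lift[OF additive_int_ext delta_relations[OF assms(2)] this]
  have "delta H \<chi> (gl q M) = int_ext (\<lambda>(q, r). q * delta_RR H \<chi> r) (single (q, cl M) 1)"
    unfolding delta_def pure_tensor_def .
  then show ?thesis using delta_RR_cl[OF pointed_glider[OF assms(1)] assms(2)] by simp
qed

abbreviation LC :: "'a set \<Rightarrow> ('a \<Rightarrow> 'k) monoid" where "LC H \<equiv> linear_characters (G\<lparr>carrier := H\<rparr>)"

lemma LC_simps:
  "\<chi> \<in> carrier (LC H) \<Longrightarrow> h \<in> H \<Longrightarrow> \<chi> h \<noteq> 0"
  "\<chi> \<in> carrier (LC H) \<Longrightarrow> g \<in> H \<Longrightarrow> h \<in> H \<Longrightarrow> \<chi> (g \<otimes> h) = \<chi> g * \<chi> h"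
  "\<chi> \<in> carrier (LC H) \<Longrightarrow> \<chi> \<in> extensional H"
  by (auto simp: linear_characters_def hom_def mult_group_of_field_def Pi_iff)

lemma delta_gl:
  assumes "pointed G M u" "H \<subseteq> carrier G" "\<chi> \<in> carrier (LC H)"
  shows "delta H \<chi> (gl q M) = (if H \<subseteq> line_stab G M u \<and> restrict (line_char M u) H = \<chi> then q else 0)"
proof -
  have u: "u \<noteq> 0" using assms(1) by (simp add: pointed_def)
  have "(\<forall>h\<in>H. act M h u = vscale (\<chi> h) u) \<longleftrightarrow> H \<subseteq> line_stab G M u \<and> restrict (line_char M u) H = \<chi>"
  proof safe
    assume a: "\<forall>h\<in>H. act M h u = vscale (\<chi> h) u"
    show "h \<in> line_stab G M u" if "h \<in> H" for h using a that assms(2) by (auto simp: line_stab_def)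
    show "restrict (line_char M u) H = \<chi>"
      using a LC_simps(3)[OF assms(3)] by (intro extensionalityI[of _ H]) (auto intro!: line_char_eq[OF u])
  next
    fix h assume "H \<subseteq> line_stab G M u" "h \<in> H"
    then show "act M h u = vscale (restrict (line_char M u) H h) u" using line_stab_act[OF u, of h G M] by auto
  qed
  then show ?thesis by (simp add: delta_eigendim[OF assms(1,2)] eigendim_pointed[OF assms(1,2)])
qed


subsection \<open>Gliders of the same type agree modulo every prime ideal\<close>

lemma cl_tensor_power_eq:
  assumes "pointed G M u" "pointed G N v" "line_stab G M u = line_stab G N v"
    "\<And>h. h \<in> line_stab G M u \<Longrightarrow> line_char M u h = line_char N v h" "card (carrier G) \<le> n"
  shows "cl (tensor_power M n) = cl (tensor_power N n)"
  using tensor_power_annihilator[OF assms(1-5)] tensor_power_annihilator[OF assms(2,1) assms(3)[symmetric] _ assms(5)] assms(3,4)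
  by (intro cl_eqI[OF tensor_power_pointed[OF assms(1)] tensor_power_pointed[OF assms(2)]]) auto

text \<open>
  Put \<open>a = [M]\<close>, \<open>b = [N]\<close> and \<open>n = |G|\<close>. Then \<open>a\<^sup>n = b\<^sup>n\<close> and \<open>a\<^sup>n\<^sup>+\<^sup>1 = b\<^sup>n\<^sup>+\<^sup>1\<close>, so
  \<open>(a - b) a\<^sup>n = 0\<close>. A prime ideal thus contains \<open>a - b\<close>, or \<open>a\<^sup>n = b\<^sup>n\<close> and with it both \<open>a\<close> and \<open>b\<close>.
\<close>
lemma same_type_prime:
  assumes M: "pointed G M u" and N: "pointed G N v" and same: "line_stab G M u = line_stab G N v"
    "\<And>h. h \<in> line_stab G M u \<Longrightarrow> line_char M u h = line_char N v h" and I: "primeideal I A"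
  shows "gl q M \<ominus>\<^bsub>A\<^esub> gl q N \<in> I"
proof -
  interpret I: primeideal I A by (rule I)
  let ?n = "card (carrier G)"
  note tp = tensor_power_pointed[OF M] tensor_power_pointed[OF N]
  note car = gl_carrier[OF M] gl_carrier[OF N] gl_carrier[OF tp(1)] gl_carrier[OF tp(2)]
  have one: "\<one>\<^bsub>A\<^esub> \<notin> I" using I.I_notcarr I.one_imp_carrier by blast
  have pow: "gl 1 L \<otimes>\<^bsub>A\<^esub> gl 1 (tensor_power L n) = gl 1 (tensor_power L (Suc n))" if "pointed G L w" for L w n
    using gl_mult[OF that tensor_power_pointed[OF that]] by simp
  have root: "gl 1 L \<in> I" if L: "pointed G L w" and n: "gl 1 (tensor_power L n) \<in> I" for L w n
    using n
  proof (induction n)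
    case 0 then show ?case using one gl_one by simp
  next
    case (Suc n)
    then show ?case
      using I.I_prime[OF gl_carrier[OF L] gl_carrier[OF tensor_power_pointed[OF L]], of 1 1 n] pow[OF L, of n] by metis
  qed
  have eq: "gl 1 (tensor_power M ?n) = gl 1 (tensor_power N ?n)" "gl 1 (tensor_power M (Suc ?n)) = gl 1 (tensor_power N (Suc ?n))"
    using cl_tensor_power_eq[OF M N same, of ?n] cl_tensor_power_eq[OF M N same, of "Suc ?n"] by simp_all
  let ?d = "gl 1 M \<ominus>\<^bsub>A\<^esub> gl 1 N"
  have dc: "?d \<in> carrier A" using car by simp
  have "?d \<otimes>\<^bsub>A\<^esub> gl 1 (tensor_power M ?n) = gl 1 M \<otimes>\<^bsub>A\<^esub> gl 1 (tensor_power M ?n) \<ominus>\<^bsub>A\<^esub> gl 1 N \<otimes>\<^bsub>A\<^esub> gl 1 (tensor_power M ?n)"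
    using car by (simp add: a_minus_def TA.T.l_distr TA.T.l_minus)
  also have "\<dots> = gl 1 (tensor_power M (Suc ?n)) \<ominus>\<^bsub>A\<^esub> gl 1 (tensor_power N (Suc ?n))"
    unfolding pow[OF M] unfolding eq(1) pow[OF N] ..
  also have "\<dots> = \<zero>\<^bsub>A\<^esub>"
    unfolding eq(2) a_minus_def by (rule TA.T.r_neg[OF gl_carrier[OF tensor_power_pointed[OF N]]])
  finally have "?d \<otimes>\<^bsub>A\<^esub> gl 1 (tensor_power M ?n) \<in> I" by (simp add: additive_subgroup.zero_closed[OF I.additive_subgroup_axioms])
  then have "?d \<in> I \<or> gl 1 (tensor_power M ?n) \<in> I"
    using I.I_prime[OF dc gl_carrier[OF tp(1)]] by blast
  then have d: "?d \<in> I"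
  proof
    assume "gl 1 (tensor_power M ?n) \<in> I"
    then have "gl 1 M \<in> I" "gl 1 N \<in> I" using root[OF M, of ?n] root[OF N, of ?n] eq(1) by simp_all
    then show ?thesis
      unfolding a_minus_def
      by (intro additive_subgroup.a_closed[OF I.additive_subgroup_axioms] additive_subgroup.a_inv_closed[OF I.additive_subgroup_axioms])
  qed
  note E = one_pointed
  have scale: "gl q (character_glider (\<lambda>_. 1)) \<otimes>\<^bsub>A\<^esub> gl 1 L = gl q L" if L: "pointed G L w" for L w
  proof -
    have "gl q (character_glider (\<lambda>_. 1)) \<otimes>\<^bsub>A\<^esub> gl 1 L = pure_tensor QQ IR (q * 1) (\<one>\<^bsub>IR\<^esub> \<otimes>\<^bsub>IR\<^esub> cl L)"
      using TA.pure_mult[of q "\<one>\<^bsub>IR\<^esub>" 1 "cl L"] cl_IR[OF L] cl_IR[OF E] by (simp add: IR_simps(4) cl_one)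
    then show ?thesis using cl_IR[OF L] by simp
  qed
  have "gl q (character_glider (\<lambda>_. 1)) \<otimes>\<^bsub>A\<^esub> ?d = gl q M \<ominus>\<^bsub>A\<^esub> gl q N"
    using gl_carrier[OF E, of q] gl_carrier[OF M] gl_carrier[OF N]
    by (simp add: a_minus_def TA.T.r_distr TA.T.r_minus scale[OF M] scale[OF N])
  then show ?thesis using I.I_l_closed[OF d gl_carrier[OF E, of q]] by simp
qed

end

subsection \<open>Finite-dimensional rational subrings of a field\<close>

global_interpretation rat_vs: vector_space "\<lambda>(q::rat) (x::'k::field_char_0). of_rat q * x"
  by unfold_locales (simp_all add: algebra_simps of_rat_add of_rat_mult)

global_interpretation rat_vs_pair: vector_space_pair "\<lambda>(q::rat) (x::'k::field_char_0). of_rat q * x" "\<lambda>(q::rat) (x::'k::field_char_0). of_rat q * x"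
  by unfold_locales

text \<open>
  Multiplication by a nonzero element is an injective endomorphism of a finite-dimensional space,
  hence surjective.
\<close>
lemma finite_dim_subring_inverse:
  fixes E :: "'k::field_char_0 set"
  assumes "rat_vs.subspace E" "finite V" "E \<subseteq> rat_vs.span V" "1 \<in> E"
    "\<And>x y. x \<in> E \<Longrightarrow> y \<in> E \<Longrightarrow> x * y \<in> E" "a \<in> E" "a \<noteq> 0"
  shows "\<exists>b\<in>E. a * b = 1"
proof -
  obtain B where B: "B \<subseteq> E" "rat_vs.independent B" "E \<subseteq> rat_vs.span B"
    using rat_vs.maximal_independent_subset by blast
  have fB: "finite B" using rat_vs.independent_span_bound[OF assms(2) B(2)] B(1) assms(3) by blast
  have spB: "rat_vs.span B = E" using B assms(1) rat_vs.span_minimal by blast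
  have lin: "Vector_Spaces.linear (\<lambda>(q::rat) (x::'k). of_rat q * x) (\<lambda>(q::rat) (x::'k). of_rat q * x) (\<lambda>x. a * x)"
    by (simp add: Vector_Spaces.linear_iff rat_vs.vector_space_axioms distrib_left mult.left_commute)
  have inj: "inj_on (\<lambda>x. a * x) S" for S using assms(7) by (auto simp: inj_on_def)
  have ind: "rat_vs.independent ((\<lambda>x. a * x) ` B)"
    by (rule rat_vs_pair.linear_independent_injective_image[OF lin B(2) inj])
  have "1 \<in> rat_vs.span ((\<lambda>x. a * x) ` B)"
  proof (rule ccontr)
    assume n: "1 \<notin> rat_vs.span ((\<lambda>x. a * x) ` B)"
    then have "rat_vs.independent (insert 1 ((\<lambda>x. a * x) ` B))" using rat_vs.independent_insertI ind by blast
    moreover have "insert 1 ((\<lambda>x. a * x) ` B) \<subseteq> rat_vs.span B" using assms(4-6) B(1) spB by auto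
    ultimately have "card (insert 1 ((\<lambda>x. a * x) ` B)) \<le> card B" using rat_vs.independent_span_bound[OF fB] by blast
    moreover have "1 \<notin> (\<lambda>x. a * x) ` B" using n rat_vs.span_base[of 1 "(\<lambda>x. a * x) ` B"] by metis
    ultimately show False using fB card_image[OF inj[of B]] by simp
  qed
  then show ?thesis
    unfolding rat_vs_pair.linear_span_image[OF lin] spB by (auto simp: image_iff)
qed

subsection \<open>Unitriangular systems\<close>

text \<open>
  For the application to types: a type is the restriction of itself and otherwise only of types
  that belong to strictly larger subgroups.
\<close>
lemma unitriangular_system:
  fixes le :: "'p \<Rightarrow> 'p \<Rightarrow> bool" and rank :: "'p \<Rightarrow> nat"
  assumes "finite S" "\<And>p. p \<in> S \<Longrightarrow> le p p" "\<And>p p'. p \<in> S \<Longrightarrow> p' \<in> S \<Longrightarrow> le p p' \<Longrightarrow> p \<noteq> p' \<Longrightarrow> rank p < rank p'"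
  shows "\<exists>Q::'p \<Rightarrow> rat. \<forall>p\<in>S. (\<Sum>p'\<in>S. if le p p' then Q p' else 0) = b p"
    and "\<And>Q::'p \<Rightarrow> rat. (\<And>p. p \<in> S \<Longrightarrow> (\<Sum>p'\<in>S. if le p p' then Q p' else 0) = 0) \<Longrightarrow> p \<in> S \<Longrightarrow> Q p = 0"
proof -
  have "(\<exists>Q::'p \<Rightarrow> rat. \<forall>p\<in>S. (\<Sum>p'\<in>S. if le p p' then Q p' else 0) = b p) \<and>
     (\<forall>Q::'p \<Rightarrow> rat. (\<forall>p\<in>S. (\<Sum>p'\<in>S. if le p p' then Q p' else 0) = 0) \<longrightarrow> (\<forall>p\<in>S. Q p = 0))"
    using assms
  proof (induction "card S" arbitrary: S)
    case 0
    then show ?case by simp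
  next
    case (Suc n)
    \<comment> \<open>An index of minimal rank occurs in no equation but its own.\<close>
    have "S \<noteq> {}" using Suc.hyps(2) by auto
    then obtain p0 where p0: "p0 \<in> S" "\<And>p. p \<in> S \<Longrightarrow> rank p0 \<le> rank p"
      using Suc.prems(1) by (metis (no_types, lifting) arg_min_if_finite(1) arg_min_least)
    let ?S = "S - {p0}"
    have nle: "\<not> le p p0" if "p \<in> ?S" for p
      using Suc.prems(3)[of p p0] p0 that by (metis Diff_iff insertI1 leD)
    have split: "(\<Sum>p'\<in>S. if le p p' then Q p' else 0) =
        (if le p p0 then Q p0 else 0) + (\<Sum>p'\<in>?S. if le p p' then Q p' else 0)" for p and Q :: "'p \<Rightarrow> rat"
      by (rule sum.remove[OF Suc.prems(1) p0(1)])
    have IH: "(\<exists>Q::'p \<Rightarrow> rat. \<forall>p\<in>?S. (\<Sum>p'\<in>?S. if le p p' then Q p' else 0) = b p) \<and>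
       (\<forall>Q::'p \<Rightarrow> rat. (\<forall>p\<in>?S. (\<Sum>p'\<in>?S. if le p p' then Q p' else 0) = 0) \<longrightarrow> (\<forall>p\<in>?S. Q p = 0))"
      using Suc.hyps(2) Suc.prems p0(1) by (intro Suc.hyps(1)) auto
    then obtain Q0 :: "'p \<Rightarrow> rat" where Q0: "\<forall>p\<in>?S. (\<Sum>p'\<in>?S. if le p p' then Q0 p' else 0) = b p" by blast
    define Q where "Q = Q0(p0 := b p0 - (\<Sum>p'\<in>?S. if le p0 p' then Q0 p' else 0))"
    have QQ: "(\<Sum>p'\<in>?S. if le p p' then Q p' else 0) = (\<Sum>p'\<in>?S. if le p p' then Q0 p' else 0)" for p
      by (intro sum.cong) (auto simp: Q_def)
    have "\<forall>p\<in>S. (\<Sum>p'\<in>S. if le p p' then Q p' else 0) = b p"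
    proof
      fix p assume "p \<in> S"
      then show "(\<Sum>p'\<in>S. if le p p' then Q p' else 0) = b p"
        unfolding split QQ using Q0 nle[of p] Suc.prems(2)[OF p0(1)] by (cases "p = p0") (auto simp: Q_def)
    qed
    moreover have "\<forall>p\<in>S. Q p = 0" if z: "\<forall>p\<in>S. (\<Sum>p'\<in>S. if le p p' then Q p' else 0) = 0" for Q :: "'p \<Rightarrow> rat"
    proof -
      have "\<forall>p\<in>?S. (\<Sum>p'\<in>?S. if le p p' then Q p' else 0) = 0"
      proof
        fix p assume p: "p \<in> ?S"
        then have "(\<Sum>p'\<in>S. if le p p' then Q p' else 0) = 0" using z by blast
        then show "(\<Sum>p'\<in>?S. if le p p' then Q p' else 0) = 0" unfolding split using nle[OF p] by simp
      qed
      then have "\<forall>p\<in>?S. Q p = 0" using IH by blast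
      moreover have "Q p0 = 0"
      proof -
        have "(\<Sum>p'\<in>?S. if le p0 p' then Q p' else 0) = 0" using calculation by (intro sum.neutral) auto
        then show ?thesis using z p0(1) Suc.prems(2)[OF p0(1)] unfolding split by auto
      qed
      ultimately show ?thesis by auto
    qed
    ultimately show ?case by blast
  qed
  then show "\<exists>Q::'p \<Rightarrow> rat. \<forall>p\<in>S. (\<Sum>p'\<in>S. if le p p' then Q p' else 0) = b p"
    and "\<And>Q::'p \<Rightarrow> rat. (\<And>p. p \<in> S \<Longrightarrow> (\<Sum>p'\<in>S. if le p p' then Q p' else 0) = 0) \<Longrightarrow> p \<in> S \<Longrightarrow> Q p = 0"
    by blast+
qed

section \<open>The isomorphism\<close>

locale glider_setting = glider_rings G T
  for G :: "('a, 'm) monoid_scheme" (structure) and T :: "'a set \<Rightarrow> 'a set \<Rightarrow> 'a \<Rightarrow> 'k::field_char_0" +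
  assumes T: "\<And>H. subgroup H G \<Longrightarrow> T H \<in> iso (abelianization (G\<lparr>carrier := H\<rparr>)) (LC H)"
begin

abbreviation Ab :: "'a set \<Rightarrow> 'a set monoid" where "Ab H \<equiv> abelianization (G\<lparr>carrier := H\<rparr>)"
abbreviation Ab_elems :: "'a set \<Rightarrow> 'a set set" where "Ab_elems H \<equiv> carrier (Ab H)"

lemma Ab_comm_group: "subgroup H G \<Longrightarrow> comm_group (Ab H)"
  unfolding abelianization_def by (rule group.derived_quot_is_comm_group[OF subgroup_imp_group])

lemma finite_subgroup: "subgroup H G \<Longrightarrow> finite H"
  using finite_subset[OF subgroup.subset finite_carrier] .

lemma finite_Ab_elems: "subgroup H G \<Longrightarrow> finite (Ab_elems H)"
  using finite_subgroup by (auto simp: abelianization_def FactGroup_def RCOSETS_def)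

lemma T_carrier: "subgroup H G \<Longrightarrow> z \<in> Ab_elems H \<Longrightarrow> T H z \<in> carrier (LC H)"
  using T[of H] by (auto simp: iso_def hom_def)

lemma T_eq_iff: "subgroup H G \<Longrightarrow> z \<in> Ab_elems H \<Longrightarrow> w \<in> Ab_elems H \<Longrightarrow> T H z = T H w \<longleftrightarrow> z = w"
  using T[of H] by (auto simp: iso_def bij_betw_def dest: inj_onD)

lemma T_surj: "subgroup H G \<Longrightarrow> \<chi> \<in> carrier (LC H) \<Longrightarrow> \<exists>z\<in>Ab_elems H. T H z = \<chi>"
proof -
  assume "subgroup H G" "\<chi> \<in> carrier (LC H)"
  then have "\<chi> \<in> T H ` Ab_elems H" using T[of H] by (simp add: iso_def bij_betw_def)
  then show ?thesis by blast
qed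

lemma T_mult:
  assumes "subgroup H G" "z \<in> Ab_elems H" "w \<in> Ab_elems H" "h \<in> H"
  shows "T H (z \<otimes>\<^bsub>Ab H\<^esub> w) h = T H z h * T H w h"
proof -
  have "T H (z \<otimes>\<^bsub>Ab H\<^esub> w) = T H z \<otimes>\<^bsub>LC H\<^esub> T H w" using T[OF assms(1)] assms(2,3) by (auto simp: iso_def hom_def)
  then show ?thesis using assms(4) by (simp add: linear_characters_def)
qed

lemma T_one:
  assumes "subgroup H G" "h \<in> H" shows "T H \<one>\<^bsub>Ab H\<^esub> h = 1"
proof -
  interpret B: comm_group "Ab H" by (rule Ab_comm_group[OF assms(1)])
  show ?thesis
    using T_mult[OF assms(1) B.one_closed B.one_closed assms(2)]
      LC_simps(1)[OF T_carrier[OF assms(1) B.one_closed] assms(2)] by simp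
qed

lemma character_orthogonality:
  assumes H: "subgroup H G" and \<chi>: "\<chi> \<in> carrier (LC H)" and \<psi>: "\<psi> \<in> carrier (LC H)" and ne: "\<chi> \<noteq> \<psi>"
  shows "(\<Sum>h\<in>H. \<chi> h * inverse (\<psi> h)) = 0"
proof -

  obtain h0 where h0: "h0 \<in> H" "\<chi> h0 \<noteq> \<psi> h0"
    using ne LC_simps(3)[OF \<chi>] LC_simps(3)[OF \<psi>] extensionalityI by blast
  let ?S = "\<Sum>h\<in>H. \<chi> h * inverse (\<psi> h)"
  have "bij_betw (\<lambda>h. h0 \<otimes> h) H H"
    by (rule bij_betwI[of _ _ _ "\<lambda>h. inv h0 \<otimes> h"])
       (use h0(1) subgroup.m_closed[OF H] subgroup.m_inv_closed[OF H] subgroup.mem_carrier[OF H] in \<open>auto simp flip: m_assoc\<close>)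
  then have "?S = (\<Sum>h\<in>H. \<chi> (h0 \<otimes> h) * inverse (\<psi> (h0 \<otimes> h)))"
    by (rule sum.reindex_bij_betw[symmetric])
  also have "\<dots> = (\<Sum>h\<in>H. \<chi> h0 * inverse (\<psi> h0) * (\<chi> h * inverse (\<psi> h)))"
    by (intro sum.cong refl) (simp add: LC_simps(2)[OF \<chi> h0(1)] LC_simps(2)[OF \<psi> h0(1)])
  also have "\<dots> = \<chi> h0 * inverse (\<psi> h0) * ?S" by (simp add: sum_distrib_left)
  finally have "(\<chi> h0 * inverse (\<psi> h0) - 1) * ?S = 0" by (simp add: algebra_simps)
  moreover have "\<chi> h0 * inverse (\<psi> h0) \<noteq> 1"
    using h0(2) LC_simps(1)[OF \<psi> h0(1)] by (simp add: field_simps)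
  ultimately show ?thesis by simp
qed

text \<open>
  Pairing with the inverse of one character isolates its coefficient, by orthogonality.
\<close>
lemma character_independence:
  assumes H: "subgroup H G" and z: "\<And>h. h \<in> H \<Longrightarrow> (\<Sum>z\<in>Ab_elems H. c z * T H z h) = 0" and w: "w \<in> Ab_elems H"
  shows "c w = 0"
proof -
  have "0 = (\<Sum>h\<in>H. (\<Sum>z\<in>Ab_elems H. c z * T H z h) * inverse (T H w h))" using z by simp
  also have "\<dots> = (\<Sum>z\<in>Ab_elems H. \<Sum>h\<in>H. c z * T H z h * inverse (T H w h))"
    unfolding sum_distrib_right by (rule sum.swap)
  also have "\<dots> = (\<Sum>z\<in>Ab_elems H. c z * (\<Sum>h\<in>H. T H z h * inverse (T H w h)))"
    by (simp add: sum_distrib_left mult.assoc)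
  also have "\<dots> = (\<Sum>z\<in>Ab_elems H. if z = w then c w * of_nat (card H) else 0)"
  proof (intro sum.cong refl)
    fix z assume z: "z \<in> Ab_elems H"
    show "c z * (\<Sum>h\<in>H. T H z h * inverse (T H w h)) = (if z = w then c w * of_nat (card H) else 0)"
    proof (cases "z = w")
      case True
      have "(\<Sum>h\<in>H. T H w h * inverse (T H w h)) = (\<Sum>h\<in>H. 1)"
        by (intro sum.cong refl) (simp add: LC_simps(1)[OF T_carrier[OF H w]])
      then show ?thesis using True by simp
    next
      case False
      then show ?thesis
        using character_orthogonality[OF H T_carrier[OF H z] T_carrier[OF H w]] T_eq_iff[OF H z w] by simp
    qed
  qed
  also have "\<dots> = c w * of_nat (card H)" using w finite_Ab_elems[OF H] by simp
  finally have "c w * of_nat (card H) = 0" by simp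
  moreover have "card H \<noteq> 0" using finite_subgroup[OF H] subgroup.one_closed[OF H] by auto
  ultimately show ?thesis by simp
qed

lemma weight_index:
  assumes "pointed G M u" "subgroup H G" "H \<subseteq> line_stab G M u"
  obtains z where "z \<in> Ab_elems H" "T H z = restrict (line_char M u) H"
  using T_surj[OF assms(2) line_char_character[OF assms]] by blast

lemma delta_gl_index:
  assumes "pointed G M u" "subgroup H G" "z \<in> Ab_elems H"
  shows "delta H (T H z) (gl q M) = (if H \<subseteq> line_stab G M u \<and> restrict (line_char M u) H = T H z then q else 0)"
  by (rule delta_gl[OF assms(1) subgroup.subset[OF assms(2)] T_carrier[OF assms(2,3)]])

subsection \<open>Evaluation at a group element\<close>

text \<open>
  The \<open>H\<close>-component of the homomorphism to the group algebras, followed by \<open>z \<mapsto> T\<^sub>z(h)\<close>. The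
  kernels of these evaluations are the maximal ideals that bound the radical.
\<close>
definition ev :: "'a set \<Rightarrow> 'a \<Rightarrow> (rat \<times> ('a, 'k) split_class set \<Rightarrow>\<^sub>0 int) set \<Rightarrow> 'k" where
  "ev H h x = (\<Sum>z\<in>Ab_elems H. of_rat (delta H (T H z) x) * T H z h)"

lemma ev_add: "subgroup H G \<Longrightarrow> x \<in> carrier A \<Longrightarrow> y \<in> carrier A \<Longrightarrow> ev H h (x \<oplus>\<^bsub>A\<^esub> y) = ev H h x + ev H h y"
  by (simp add: ev_def delta_add[OF subgroup.subset] of_rat_add distrib_right sum.distrib)

text \<open>
  At most one character of \<open>H\<close> contributes, the restriction of the character of the line. This is
  what makes the evaluation multiplicative.
\<close>
lemma ev_gl:
  assumes M: "pointed G M u" and H: "subgroup H G" "h \<in> H"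
  shows "ev H h (gl q M) = (if H \<subseteq> line_stab G M u then of_rat q * line_char M u h else 0)"
proof (cases "H \<subseteq> line_stab G M u")
  case True
  obtain z where z: "z \<in> Ab_elems H" "T H z = restrict (line_char M u) H" using weight_index[OF M H(1) True] .
  have "ev H h (gl q M) = (\<Sum>w\<in>Ab_elems H. if w = z then of_rat q * T H z h else 0)"
    unfolding ev_def
    by (intro sum.cong refl) (use z True T_eq_iff[OF H(1) z(1)] in \<open>auto simp: delta_gl_index[OF M H(1)]\<close>)
  then show ?thesis using z H finite_Ab_elems[OF H(1)] True by simp
next
  case False
  then show ?thesis unfolding ev_def by (simp add: delta_gl_index[OF M H(1)])
qed

lemma ev_mult:
  assumes H: "subgroup H G" "h \<in> H" and x: "x \<in> carrier A" and y: "y \<in> carrier A"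
  shows "ev H h (x \<otimes>\<^bsub>A\<^esub> y) = ev H h x * ev H h y"
  using x
proof (induction rule: A_induct)
  case (gl q M u)
  show ?case using y
  proof (induction rule: A_induct)
    case (gl r N v)
    note MN = ntensor_pointed[OF group_axioms \<open>pointed G M u\<close> gl]
    show ?case
      using line_stab_ntensor[OF \<open>pointed G M u\<close> gl] H(2)
      by (auto simp: gl_mult[OF \<open>pointed G M u\<close> gl] ev_gl[OF MN H] ev_gl[OF gl H] ev_gl[OF \<open>pointed G M u\<close> H] of_rat_mult)
  next
    case (add a b)
    then show ?case using gl_carrier[OF gl, of q] by (simp add: TA.T.r_distr ev_add[OF H(1)] distrib_left)
  qed
next
  case (add a b)
  then show ?case using y by (simp add: TA.T.l_distr ev_add[OF H(1)] distrib_right)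
qed

lemma ev_one: "subgroup H G \<Longrightarrow> h \<in> H \<Longrightarrow> ev H h \<one>\<^bsub>A\<^esub> = 1"
proof -
  assume H: "subgroup H G" "h \<in> H"
  have "line_stab G (character_glider (\<lambda>_. 1 :: 'k)) (single 0 1) = carrier G"
    using exI[of "\<lambda>c. single 0 (1::'k) = vscale c (single 0 1)" 1] by (auto simp: line_stab_def character_glider_def)
  moreover have "line_char (character_glider (\<lambda>_. 1 :: 'k)) (single 0 1) h = 1"
    by (rule line_char_eq) (simp_all add: character_glider_def)
  ultimately show ?thesis
    unfolding gl_one ev_gl[OF one_pointed H] using subgroup.subset[OF H(1)] by simp
qed

lemma ev_minus: "subgroup H G \<Longrightarrow> x \<in> carrier A \<Longrightarrow> ev H h (\<ominus>\<^bsub>A\<^esub> x) = - ev H h x"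
proof -
  assume H: "subgroup H G" and x: "x \<in> carrier A"
  have "additive_map A (ev H h)" using ev_add[OF H] by (auto simp: additive_map_def)
  then show ?thesis using TA.T.additive_map_minus x by blast
qed

lemma ev_zero: "subgroup H G \<Longrightarrow> ev H h \<zero>\<^bsub>A\<^esub> = 0"
proof -
  assume H: "subgroup H G"
  have "additive_map A (ev H h)" using ev_add[OF H] by (auto simp: additive_map_def)
  then show ?thesis using TA.T.additive_map_zero by blast
qed

text \<open>
  The values lie in the rational span of the finitely many numbers \<open>T\<^sub>z(h)\<close>.
\<close>
lemma ev_inverse:
  assumes H: "subgroup H G" "h \<in> H" and x: "x \<in> carrier A" "ev H h x \<noteq> 0"
  shows "\<exists>y\<in>carrier A. ev H h (x \<otimes>\<^bsub>A\<^esub> y) = 1"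
proof -
  let ?E = "ev H h ` carrier A"
  have "\<exists>b\<in>?E. ev H h x * b = 1"
  proof (rule finite_dim_subring_inverse)
    show "rat_vs.subspace ?E"
    proof (rule rat_vs.subspaceI)
      show "0 \<in> ?E" using ev_zero[OF H(1)] TA.T.zero_closed by (metis image_eqI)
      show "a + b \<in> ?E" if ab: "a \<in> ?E" "b \<in> ?E" for a b
      proof -
        obtain x y where "x \<in> carrier A" "a = ev H h x" "y \<in> carrier A" "b = ev H h y" using ab by (elim imageE)
        then show ?thesis by (intro image_eqI[of _ _ "x \<oplus>\<^bsub>A\<^esub> y"]) (simp_all add: ev_add[OF H(1)])
      qed
      show "of_rat q * a \<in> ?E" if a: "a \<in> ?E" for q a
      proof -
        obtain y where y: "y \<in> carrier A" "a = ev H h y" using a by blast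
        let ?q = "gl q (character_glider (\<lambda>_. 1))"
        have "ev H h \<one>\<^bsub>A\<^esub> = 1" by (rule ev_one[OF H])
        then have "ev H h ?q = of_rat q"
          unfolding gl_one ev_gl[OF one_pointed H] by (auto split: if_splits)
        then show ?thesis
          using ev_mult[OF H gl_carrier[OF one_pointed, of q] y(1)] y TA.T.m_closed[OF gl_carrier[OF one_pointed, of q] y(1)]
          by (intro image_eqI[of _ _ "?q \<otimes>\<^bsub>A\<^esub> y"]) simp_all
      qed
    qed
    show "finite ((\<lambda>z. T H z h) ` Ab_elems H)" using finite_Ab_elems[OF H(1)] by simp
    show "?E \<subseteq> rat_vs.span ((\<lambda>z. T H z h) ` Ab_elems H)"
    proof (rule image_subsetI)
      fix y
      show "ev H h y \<in> rat_vs.span ((\<lambda>z. T H z h) ` Ab_elems H)"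
        unfolding ev_def by (rule rat_vs.span_sum, rule rat_vs.span_scale, rule rat_vs.span_base, rule imageI)
    qed
    show "1 \<in> ?E" using ev_one[OF H] TA.T.one_closed by (metis image_eqI)
    show "a * b \<in> ?E" if ab: "a \<in> ?E" "b \<in> ?E" for a b
    proof -
      obtain x y where "x \<in> carrier A" "a = ev H h x" "y \<in> carrier A" "b = ev H h y" using ab by (elim imageE)
      then show ?thesis by (intro image_eqI[of _ _ "x \<otimes>\<^bsub>A\<^esub> y"]) (simp_all add: ev_mult[OF H])
    qed
  qed (use x in auto)
  then show ?thesis using ev_mult[OF H x(1)] by auto
qed

text \<open>
  The image of the evaluation is a field.
\<close>
lemma ev_kernel_maximal:
  assumes H: "subgroup H G" "h \<in> H"
  shows "maximalideal {x \<in> carrier A. ev H h x = 0} A" (is "maximalideal ?I A")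
proof (rule maximalidealI)
  show "ideal ?I A"
  proof (rule idealI)
    show "ring A" by (rule TA.T.ring_axioms)
    show "subgroup ?I (add_monoid A)"
      by (rule TA.T.add.subgroupI)
         (auto simp: ev_add[OF H(1)] ev_minus[OF H(1)] simp flip: a_inv_def intro!: exI[of _ "\<zero>\<^bsub>A\<^esub>"] ev_zero[OF H(1)])
  qed (auto simp: ev_mult[OF H])
  show "carrier A \<noteq> ?I" using ev_one[OF H] TA.T.one_closed by force
  fix J assume J: "ideal J A" "?I \<subseteq> J" "J \<subseteq> carrier A"
  interpret J: ideal J A by (rule J(1))
  show "J = ?I \<or> J = carrier A"
  proof (cases "J \<subseteq> ?I")
    case True then show ?thesis using J(2) by blast
  next
    case False
    then obtain a where a: "a \<in> J" "a \<in> carrier A" "ev H h a \<noteq> 0" using J(3) by blast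
    obtain b where b: "b \<in> carrier A" "ev H h (a \<otimes>\<^bsub>A\<^esub> b) = 1" using ev_inverse[OF H a(2,3)] by blast
    let ?c = "a \<otimes>\<^bsub>A\<^esub> b"
    have c: "?c \<in> carrier A" "?c \<in> J" using a b J.I_r_closed by auto
    have "\<one>\<^bsub>A\<^esub> \<oplus>\<^bsub>A\<^esub> \<ominus>\<^bsub>A\<^esub> ?c \<in> ?I"
      using c(1) b(2) by (simp add: ev_add[OF H(1)] ev_minus[OF H(1)] ev_one[OF H])
    then have "(\<one>\<^bsub>A\<^esub> \<oplus>\<^bsub>A\<^esub> \<ominus>\<^bsub>A\<^esub> ?c) \<oplus>\<^bsub>A\<^esub> ?c \<in> J"
      using J(2) c(2) additive_subgroup.a_closed[OF J.additive_subgroup_axioms] by blast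
    then have "\<one>\<^bsub>A\<^esub> \<in> J" using c(1) by (simp add: TA.T.a_assoc TA.T.l_neg)
    then show ?thesis using J.one_imp_carrier by blast
  qed
qed

text \<open>
  An element of the radical lies in the kernels of all evaluations, and these determine the
  multiplicities because the characters of a subgroup are linearly independent.
\<close>
lemma radical_delta_zero:
  assumes x: "x \<in> jacobson_radical A" and H: "subgroup H G" and z: "z \<in> Ab_elems H"
  shows "delta H (T H z) x = 0"
proof -
  have "ev H h x = 0" if "h \<in> H" for h
    using x ev_kernel_maximal[OF H that] unfolding jacobson_radical_def by blast
  then have "of_rat (delta H (T H z) x) = (0::'k)"
    unfolding ev_def by (rule character_independence[OF H _ z])
  then show ?thesis by simp
qed


subsection \<open>Representatives of the types\<close>

text \<open>
  A type is a subgroup with a character of it; the character is encoded by an element of the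
  abelianization of the subgroup.
\<close>
abbreviation types :: "('a set \<times> 'a set) set" where "types \<equiv> Sigma {H. subgroup H G} Ab_elems"

lemma types_subset: "p \<in> types \<Longrightarrow> fst p \<subseteq> carrier G"
  using subgroup.subset[of "fst p" G] by auto

definition rep :: "'a set \<times> 'a set \<Rightarrow> ('a, nat \<Rightarrow>\<^sub>0 'k) glider \<times> (nat \<Rightarrow>\<^sub>0 'k)" where
  "rep p = (SOME (M, u). pointed G M u \<and> line_stab G M u = fst p \<and> (\<forall>h\<in>fst p. line_char M u h = T (fst p) (snd p) h))"

abbreviation "repM p \<equiv> fst (rep p)"
abbreviation "repv p \<equiv> snd (rep p)"

lemma rep:
  assumes "p \<in> types"
  shows "pointed G (repM p) (repv p)" "line_stab G (repM p) (repv p) = fst p"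
    "h \<in> fst p \<Longrightarrow> line_char (repM p) (repv p) h = T (fst p) (snd p) h"
proof -
  have H: "subgroup (fst p) G" and z: "snd p \<in> Ab_elems (fst p)" using assms by auto
  note TC = T_carrier[OF H z]
  have "\<exists>(M :: ('a, nat \<Rightarrow>\<^sub>0 'k) glider) u. pointed G M u \<and> line_stab G M u = fst p \<and>
      (\<forall>h\<in>fst p. line_char M u h = T (fst p) (snd p) h)"
    by (rule induced_glider_exists[OF H]) (simp_all add: LC_simps(1,2)[OF TC])
  then obtain M :: "('a, nat \<Rightarrow>\<^sub>0 'k) glider" and u where
    "pointed G M u" "line_stab G M u = fst p" "\<forall>h\<in>fst p. line_char M u h = T (fst p) (snd p) h"
    by (elim exE conjE)
  then have "(\<lambda>(M, u). pointed G M u \<and> line_stab G M u = fst p \<and> (\<forall>h\<in>fst p. line_char M u h = T (fst p) (snd p) h)) (M, u)"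
    by simp
  then have "(\<lambda>(M, u). pointed G M u \<and> line_stab G M u = fst p \<and> (\<forall>h\<in>fst p. line_char M u h = T (fst p) (snd p) h)) (rep p)"
    unfolding rep_def by (rule someI)
  then show "pointed G (repM p) (repv p)" "line_stab G (repM p) (repv p) = fst p"
    "h \<in> fst p \<Longrightarrow> line_char (repM p) (repv p) h = T (fst p) (snd p) h" by (auto simp: case_prod_unfold)
qed

lemma finite_types: "finite types"
proof -
  have "finite {H. subgroup H G}"
    using finite_subset[of "{H. subgroup H G}" "Pow (carrier G)"] finite_carrier subgroup.subset by blast
  then show ?thesis using finite_Ab_elems by (intro finite_SigmaI) auto
qed

definition restricts :: "'a set \<times> 'a set \<Rightarrow> 'a set \<times> 'a set \<Rightarrow> bool" where
  "restricts p p' \<longleftrightarrow> fst p \<subseteq> fst p' \<and> restrict (T (fst p') (snd p')) (fst p) = T (fst p) (snd p)"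

lemma restricts_refl: "p \<in> types \<Longrightarrow> restricts p p"
  using LC_simps(3)[OF T_carrier] by (auto simp: restricts_def extensional_restrict)

lemma restricts_rank:
  assumes "p \<in> types" "p' \<in> types" "restricts p p'" "p \<noteq> p'"
  shows "card (fst p) < card (fst p')"
proof -
  have "fst p \<noteq> fst p'"
  proof
    assume e: "fst p = fst p'"
    then have "T (fst p) (snd p) = T (fst p) (snd p')"
      using assms(1-3) restricts_refl[OF assms(2)] by (simp add: restricts_def)
    then have "snd p = snd p'" using T_eq_iff[of "fst p" "snd p" "snd p'"] assms(1,2) e by auto
    then show False using e assms(4) by (simp add: prod_eq_iff)
  qed
  then have "fst p \<subset> fst p'" using assms(3) by (auto simp: restricts_def)
  moreover have "finite (fst p')" using assms(2) finite_subgroup by auto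
  ultimately show ?thesis by (rule psubset_card_mono[rotated])
qed

abbreviation delta_at :: "'a set \<times> 'a set \<Rightarrow> (rat \<times> ('a, 'k) split_class set \<Rightarrow>\<^sub>0 int) set \<Rightarrow> rat" where
  "delta_at p \<equiv> delta (fst p) (T (fst p) (snd p))"

lemma delta_at_same_type:
  assumes M: "pointed G M u" and p: "p \<in> types" and p': "p' \<in> types" "line_stab G M u = fst p'"
    "\<And>h. h \<in> fst p' \<Longrightarrow> line_char M u h = T (fst p') (snd p') h"
  shows "delta_at p (gl q M) = (if restricts p p' then q else 0)"
proof -
  have H: "subgroup (fst p) G" "snd p \<in> Ab_elems (fst p)" using p by auto
  have "restrict (line_char M u) (fst p) = restrict (T (fst p') (snd p')) (fst p)" if "fst p \<subseteq> fst p'"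
    using that p'(3) by (intro restrict_ext) auto
  then show ?thesis unfolding delta_gl_index[OF M H] restricts_def using p'(2) by auto
qed

lemma delta_at_rep: "p \<in> types \<Longrightarrow> p' \<in> types \<Longrightarrow> delta_at p (gl q (repM p')) = (if restricts p p' then q else 0)"
  by (rule delta_at_same_type[OF rep(1)]) (use rep in auto)

definition comb :: "('a set \<times> 'a set \<Rightarrow> rat) \<Rightarrow> (rat \<times> ('a, 'k) split_class set \<Rightarrow>\<^sub>0 int) set" where
  "comb Q = (\<Oplus>\<^bsub>A\<^esub> p\<in>types. gl (Q p) (repM p))"

lemma rep_carrier: "(\<lambda>p. gl (Q p) (repM p)) \<in> types \<rightarrow> carrier A"
  using gl_carrier rep(1) by blast

lemma comb_carrier: "comb Q \<in> carrier A"
  unfolding comb_def by (rule TA.T.finsum_closed[OF rep_carrier])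

lemma delta_zero: "H \<subseteq> carrier G \<Longrightarrow> delta H \<chi> \<zero>\<^bsub>A\<^esub> = 0"
  using TA.T.additive_map_zero[OF delta_additive] .

lemma delta_finsum:
  assumes "H \<subseteq> carrier G" "finite F" "f \<in> F \<rightarrow> carrier A"
  shows "delta H \<chi> (\<Oplus>\<^bsub>A\<^esub> p\<in>F. f p) = (\<Sum>p\<in>F. delta H \<chi> (f p))"
  using assms(2,3)
proof (induction F)
  case empty then show ?case using delta_zero[OF assms(1)] by simp
next
  case (insert p F)
  then have "f \<in> F \<rightarrow> carrier A" "f p \<in> carrier A" by auto
  then show ?case using insert TA.T.finsum_insert[of F p f] TA.T.finsum_closed[of f F]
    by (simp add: delta_add[OF assms(1)])
qed

lemma delta_at_comb: "p \<in> types \<Longrightarrow> delta_at p (comb Q) = (\<Sum>p'\<in>types. if restricts p p' then Q p' else 0)"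
proof -
  assume p: "p \<in> types"
  then have "fst p \<subseteq> carrier G" by (rule types_subset)
  then have "delta_at p (comb Q) = (\<Sum>p'\<in>types. delta_at p (gl (Q p') (repM p')))"
    unfolding comb_def by (rule delta_finsum[OF _ finite_types rep_carrier])
  also have "\<dots> = (\<Sum>p'\<in>types. if restricts p p' then Q p' else 0)"
    by (intro sum.cong refl delta_at_rep p)
  finally show ?thesis .
qed

lemma comb_add: "comb (\<lambda>p. Q p + Q' p) = comb Q \<oplus>\<^bsub>A\<^esub> comb Q'"
  unfolding comb_def TA.T.finsum_addf[OF rep_carrier rep_carrier, symmetric]
  by (rule TA.T.finsum_cong') (use gl_add rep(1) TA.T.a_closed gl_carrier in blast)+

lemma comb_single:
  assumes "p0 \<in> types" shows "comb (\<lambda>p. if p = p0 then q else 0) = gl q (repM p0)"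
proof -
  have "comb (\<lambda>p. if p = p0 then q else 0) = (\<Oplus>\<^bsub>A\<^esub> p\<in>types. if p0 = p then gl q (repM p) else \<zero>\<^bsub>A\<^esub>)"
    unfolding comb_def
    by (rule TA.T.finsum_cong') (use gl_carrier[OF rep(1)] gl_zero[OF rep(1)] in auto)
  also have "\<dots> = gl q (repM p0)"
    by (rule TA.T.finsum_singleton[OF assms finite_types rep_carrier])
  finally show ?thesis .
qed

lemma comb_zero: "(\<And>p. p \<in> types \<Longrightarrow> Q p = 0) \<Longrightarrow> comb Q = \<zero>\<^bsub>A\<^esub>"
  unfolding comb_def using gl_zero[OF rep(1)]
  by (intro TA.T.add.finprod_one_eqI) simp

lemma comb_surj: "\<exists>Q. \<forall>p\<in>types. delta_at p (comb Q) = b p"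
  using unitriangular_system(1)[of types restricts "\<lambda>p. card (fst p)" b] finite_types restricts_refl restricts_rank
  by (simp add: delta_at_comb)

lemma comb_inj: "(\<And>p. p \<in> types \<Longrightarrow> delta_at p (comb Q) = 0) \<Longrightarrow> comb Q = \<zero>\<^bsub>A\<^esub>"
  using unitriangular_system(2)[of types restricts "\<lambda>p. card (fst p)" Q] finite_types restricts_refl restricts_rank
  by (intro comb_zero) (simp add: delta_at_comb)

text \<open>
  A glider may be replaced by the representative of its type: this changes nothing modulo the prime
  ideal, and it preserves the multiplicities.
\<close>
lemma comb_mod_prime:
  assumes x: "x \<in> carrier A" and I: "primeideal I A"
  shows "\<exists>Q. x \<ominus>\<^bsub>A\<^esub> comb Q \<in> I \<and> (\<forall>p\<in>types. delta_at p (comb Q) = delta_at p x)"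
  using x
proof (induction rule: A_induct)
  case (gl q M u)
  obtain z where z: "z \<in> Ab_elems (line_stab G M u)" "T (line_stab G M u) z = restrict (line_char M u) (line_stab G M u)"
    using weight_index[OF gl line_stab_subgroup[OF gl]] by blast
  let ?p = "(line_stab G M u, z)"
  have p: "?p \<in> types" using z(1) line_stab_subgroup[OF gl] by simp
  have same: "line_stab G M u = fst ?p" "line_char M u h = T (fst ?p) (snd ?p) h" if "h \<in> fst ?p" for h
    using z(2) that by simp_all
  have st: "line_stab G M u = line_stab G (repM ?p) (repv ?p)" using rep(2)[OF p] by simp
  have "gl q M \<ominus>\<^bsub>A\<^esub> gl q (repM ?p) \<in> I"
    by (rule same_type_prime[OF gl rep(1)[OF p] st _ I]) (use rep(3)[OF p] z(2) in simp)
  moreover have "delta_at p' (gl q (repM ?p)) = delta_at p' (gl q M)" if "p' \<in> types" for p'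
    using delta_at_rep[OF that p] delta_at_same_type[OF gl that p] z(2) by simp
  ultimately show ?case
    by (intro exI[of _ "\<lambda>p. if p = ?p then q else 0"]) (simp add: comb_single[OF p])
next
  case (add x y)
  interpret I: primeideal I A by (rule I)
  obtain Q Q' where Q: "x \<ominus>\<^bsub>A\<^esub> comb Q \<in> I" "\<forall>p\<in>types. delta_at p (comb Q) = delta_at p x"
    "y \<ominus>\<^bsub>A\<^esub> comb Q' \<in> I" "\<forall>p\<in>types. delta_at p (comb Q') = delta_at p y" using add.IH by blast
  have "(x \<ominus>\<^bsub>A\<^esub> comb Q) \<oplus>\<^bsub>A\<^esub> (y \<ominus>\<^bsub>A\<^esub> comb Q') \<in> I"
    using Q additive_subgroup.a_closed[OF I.additive_subgroup_axioms] by blast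
  moreover have "(x \<ominus>\<^bsub>A\<^esub> comb Q) \<oplus>\<^bsub>A\<^esub> (y \<ominus>\<^bsub>A\<^esub> comb Q') = (x \<oplus>\<^bsub>A\<^esub> y) \<ominus>\<^bsub>A\<^esub> comb (\<lambda>p. Q p + Q' p)"
    using add.hyps comb_carrier[of Q] comb_carrier[of Q']
    by (simp add: comb_add a_minus_def TA.T.minus_add TA.T.a_ac)
  moreover have "delta_at p (comb (\<lambda>p. Q p + Q' p)) = delta_at p (x \<oplus>\<^bsub>A\<^esub> y)" if p: "p \<in> types" for p
  proof -
    have "fst p \<subseteq> carrier G" using p by (rule types_subset)
    then show ?thesis using bspec[OF Q(2) p] bspec[OF Q(4) p] add.hyps comb_carrier by (simp add: comb_add delta_add)
  qed
  ultimately show ?case by (intro exI[of _ "\<lambda>p. Q p + Q' p"]) auto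
qed

lemma delta_zero_radical:
  assumes x: "x \<in> carrier A" and d: "\<And>p. p \<in> types \<Longrightarrow> delta_at p x = 0"
  shows "x \<in> jacobson_radical A"
proof -
  have "x \<in> I" if I: "maximalideal I A" for I
  proof -
    obtain Q where Q: "x \<ominus>\<^bsub>A\<^esub> comb Q \<in> I" "\<forall>p\<in>types. delta_at p (comb Q) = delta_at p x"
      using comb_mod_prime[OF x TA.T.maximalideal_prime[OF I]] by blast
    have "comb Q = \<zero>\<^bsub>A\<^esub>"
    proof (rule comb_inj)
      fix p assume p: "p \<in> types"
      show "delta_at p (comb Q) = 0" using bspec[OF Q(2) p] d[OF p] by simp
    qed
    then show ?thesis using Q(1) x by (simp add: a_minus_def)
  qed
  then show ?thesis using x by (simp add: jacobson_radical_def)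
qed


subsection \<open>The homomorphism to the group algebras\<close>

definition coeffs_at :: "'a set \<Rightarrow> (rat \<times> ('a, 'k) split_class set \<Rightarrow>\<^sub>0 int) set \<Rightarrow> ('a set \<Rightarrow>\<^sub>0 rat)" where
  "coeffs_at H x = (\<Sum>z\<in>Ab_elems H. single z (delta H (T H z) x))"

lemma lookup_coeffs_at: "subgroup H G \<Longrightarrow> lookup (coeffs_at H x) z = (if z \<in> Ab_elems H then delta H (T H z) x else 0)"
  using finite_Ab_elems by (auto simp: coeffs_at_def lookup_sum lookup_single when_def)

lemma coeffs_at_carrier: "subgroup H G \<Longrightarrow> coeffs_at H x \<in> carrier (monoid_algebra (Ab H))"
  by (auto simp: in_keys_iff lookup_coeffs_at split: if_splits)

lemma coeffs_at_add:
  "subgroup H G \<Longrightarrow> x \<in> carrier A \<Longrightarrow> y \<in> carrier A \<Longrightarrow> coeffs_at H (x \<oplus>\<^bsub>A\<^esub> y) = coeffs_at H x + coeffs_at H y"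
  by (rule poly_mapping_eqI) (simp add: lookup_coeffs_at lookup_add delta_add[OF subgroup.subset])

lemma coeffs_at_gl:
  assumes "pointed G M u" "subgroup H G" "z \<in> Ab_elems H" "H \<subseteq> line_stab G M u" "T H z = restrict (line_char M u) H"
  shows "coeffs_at H (gl q M) = single z q"
  by (rule poly_mapping_eqI)
     (use assms T_eq_iff[OF assms(2,3)] in \<open>auto simp: lookup_coeffs_at lookup_single when_def delta_gl_index[OF assms(1,2)]\<close>)

lemma coeffs_at_gl_zero:
  assumes "pointed G M u" "subgroup H G" "\<not> H \<subseteq> line_stab G M u"
  shows "coeffs_at H (gl q M) = 0"
  by (rule poly_mapping_eqI) (use assms in \<open>auto simp: lookup_coeffs_at delta_gl_index[OF assms(1,2)]\<close>)

lemma coeffs_at_mult: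
  assumes H: "subgroup H G" and x: "x \<in> carrier A" and y: "y \<in> carrier A"
  shows "coeffs_at H (x \<otimes>\<^bsub>A\<^esub> y) = convolution (Ab H) (coeffs_at H x) (coeffs_at H y)"
  using x
proof (induction rule: A_induct)
  case (gl q M u)
  note M = gl
  show ?case using y
  proof (induction rule: A_induct)
    case (gl r N v)
    note N = gl
    note MN = ntensor_pointed[OF group_axioms M N]
    show ?case
    proof (cases "H \<subseteq> line_stab G M u \<and> H \<subseteq> line_stab G N v")
      case True
      obtain z where z: "z \<in> Ab_elems H" "T H z = restrict (line_char M u) H" using weight_index[OF M H] True by blast
      obtain w where w: "w \<in> Ab_elems H" "T H w = restrict (line_char N v) H" using weight_index[OF N H] True by blast
      interpret B: comm_group "Ab H" by (rule Ab_comm_group[OF H])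
      have zw: "z \<otimes>\<^bsub>Ab H\<^esub> w \<in> Ab_elems H" using z(1) w(1) by simp
      have "T H (z \<otimes>\<^bsub>Ab H\<^esub> w) = restrict (line_char (ntensor M N) (ntensor_vec u v)) H"
      proof (rule extensionalityI[of _ H])
        show "T H (z \<otimes>\<^bsub>Ab H\<^esub> w) \<in> extensional H" by (rule LC_simps(3)[OF T_carrier[OF H zw]])
        show "T H (z \<otimes>\<^bsub>Ab H\<^esub> w) h = restrict (line_char (ntensor M N) (ntensor_vec u v)) H h" if "h \<in> H" for h
        proof -
          have hm: "h \<in> line_stab G M u" "h \<in> line_stab G N v" using True that by blast+
          show ?thesis
            using T_mult[OF H z(1) w(1) that] that by (simp add: z(2) w(2) line_stab_ntensor(2)[OF M N hm])
        qed
      qed simp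
      moreover have "H \<subseteq> line_stab G (ntensor M N) (ntensor_vec u v)" using line_stab_ntensor(1)[OF M N] True by simp
      ultimately show ?thesis
        using True by (simp add: gl_mult[OF M N] coeffs_at_gl[OF MN H zw] coeffs_at_gl[OF M H z(1) _ z(2)] coeffs_at_gl[OF N H w(1) _ w(2)])
    next
      case False
      then have "\<not> H \<subseteq> line_stab G (ntensor M N) (ntensor_vec u v)" using line_stab_ntensor(1)[OF M N] by simp
      moreover have "coeffs_at H (gl q M) = 0 \<or> coeffs_at H (gl r N) = 0"
        using False coeffs_at_gl_zero[OF M H] coeffs_at_gl_zero[OF N H] by blast
      ultimately show ?thesis using coeffs_at_gl_zero[OF MN H] by (auto simp: gl_mult[OF M N])
    qed
  next
    case (add a b)
    then show ?case using gl_carrier[OF M, of q] by (simp add: TA.T.r_distr coeffs_at_add[OF H] convolution_add_right)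
  qed
next
  case (add a b)
  then show ?case using y by (simp add: TA.T.l_distr coeffs_at_add[OF H] convolution_add_left)
qed

lemma character_glider_pointed:
  assumes "\<chi> \<in> hom G mult_group_of_field"
  shows "pointed G (character_glider \<chi> :: ('a, nat \<Rightarrow>\<^sub>0 'k) glider) (single 0 1)"
    and "line_stab G (character_glider \<chi> :: ('a, nat \<Rightarrow>\<^sub>0 'k) glider) (single 0 1) = carrier G"
    and "line_char (character_glider \<chi> :: ('a, nat \<Rightarrow>\<^sub>0 'k) glider) (single 0 1) h = \<chi> h"
proof -
  show "pointed G (character_glider \<chi> :: ('a, nat \<Rightarrow>\<^sub>0 'k) glider) (single 0 1)"
    using character_glider_glider[OF group_axioms assms] by (simp add: pointed_def character_glider_def)
  show "line_stab G (character_glider \<chi> :: ('a, nat \<Rightarrow>\<^sub>0 'k) glider) (single 0 1) = carrier G"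
    by (auto simp: line_stab_def character_glider_def)
  show "line_char (character_glider \<chi> :: ('a, nat \<Rightarrow>\<^sub>0 'k) glider) (single 0 1) h = \<chi> h"
    by (rule line_char_eq) (simp_all add: character_glider_def)
qed

lemma coeffs_at_one:
  assumes H: "subgroup H G" shows "coeffs_at H \<one>\<^bsub>A\<^esub> = single \<one>\<^bsub>Ab H\<^esub> 1"
proof -
  interpret B: comm_group "Ab H" by (rule Ab_comm_group[OF H])
  have h1: "(\<lambda>_. 1) \<in> hom G (mult_group_of_field :: 'k monoid)" by (auto simp: hom_def mult_group_of_field_def)
  note c = character_glider_pointed[OF h1]
  have "T H \<one>\<^bsub>Ab H\<^esub> = restrict (line_char (character_glider (\<lambda>_. 1 :: 'k)) (single 0 1)) H"
    by (rule extensionalityI[of _ H])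
       (use LC_simps(3)[OF T_carrier[OF H B.one_closed]] T_one[OF H] c(3) in auto)
  then show ?thesis
    unfolding gl_one by (intro coeffs_at_gl[OF c(1) H B.one_closed]) (use c(2) subgroup.subset[OF H] in simp)
qed

abbreviation Bsum :: "('a set \<Rightarrow> 'a set \<Rightarrow>\<^sub>0 rat) ring" where
  "Bsum \<equiv> product_ring {H. subgroup H G} (\<lambda>H. monoid_algebra (Ab H))"

definition char_hom :: "(rat \<times> ('a, 'k) split_class set \<Rightarrow>\<^sub>0 int) set \<Rightarrow> 'a set \<Rightarrow> ('a set \<Rightarrow>\<^sub>0 rat)" where
  "char_hom x = (\<lambda>H\<in>{H. subgroup H G}. coeffs_at H x)"

lemma Bsum_ring: "ring Bsum"
proof (rule product_ring_ring)
  fix H assume "H \<in> {H. subgroup H G}"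
  then interpret B: comm_group "Ab H" using Ab_comm_group by blast
  show "ring (monoid_algebra (Ab H) :: ('a set \<Rightarrow>\<^sub>0 rat) ring)"
    by (rule cring.axioms(1)[OF monoid_algebra_cring[OF B.comm_monoid_axioms]])
qed

lemma char_hom_ring_hom: "char_hom \<in> ring_hom A Bsum"
proof (rule ring_hom_memI)
  show "char_hom x \<in> carrier Bsum" if "x \<in> carrier A" for x
    using coeffs_at_carrier by (auto simp: char_hom_def product_ring_def)
  show "char_hom (x \<otimes>\<^bsub>A\<^esub> y) = char_hom x \<otimes>\<^bsub>Bsum\<^esub> char_hom y" if "x \<in> carrier A" "y \<in> carrier A" for x y
    using that by (auto simp: char_hom_def product_ring_def coeffs_at_mult intro!: restrict_ext)
  show "char_hom (x \<oplus>\<^bsub>A\<^esub> y) = char_hom x \<oplus>\<^bsub>Bsum\<^esub> char_hom y" if "x \<in> carrier A" "y \<in> carrier A" for x y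
    using that by (auto simp: char_hom_def product_ring_def coeffs_at_add intro!: restrict_ext)
  show "char_hom \<one>\<^bsub>A\<^esub> = \<one>\<^bsub>Bsum\<^esub>"
    by (auto simp: char_hom_def product_ring_def coeffs_at_one intro!: restrict_ext)
qed

lemma char_hom_ring_hom_ring: "ring_hom_ring A Bsum char_hom"
  by (rule ring_hom_ringI2[OF TA.T.ring_axioms Bsum_ring char_hom_ring_hom])

lemma char_hom_eq_iff:
  "char_hom x = char_hom y \<longleftrightarrow> (\<forall>p\<in>types. delta_at p x = delta_at p y)"
proof
  assume e: "char_hom x = char_hom y"
  show "\<forall>p\<in>types. delta_at p x = delta_at p y"
  proof
    fix p assume "p \<in> types"
    then have p: "subgroup (fst p) G" "snd p \<in> Ab_elems (fst p)" by auto
    then have "coeffs_at (fst p) x = coeffs_at (fst p) y" using fun_cong[OF e, of "fst p"] by (simp add: char_hom_def)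
    then have "lookup (coeffs_at (fst p) x) (snd p) = lookup (coeffs_at (fst p) y) (snd p)" by simp
    then show "delta_at p x = delta_at p y" using p by (simp add: lookup_coeffs_at)
  qed
next
  assume e: "\<forall>p\<in>types. delta_at p x = delta_at p y"
  have "coeffs_at H x = coeffs_at H y" if H: "subgroup H G" for H
    by (rule poly_mapping_eqI) (use e H in \<open>auto simp: lookup_coeffs_at\<close>)
  then show "char_hom x = char_hom y" by (auto simp: char_hom_def intro!: restrict_ext)
qed

lemma char_hom_surj: "char_hom ` carrier A = carrier Bsum"
proof
  show "char_hom ` carrier A \<subseteq> carrier Bsum" using char_hom_ring_hom by (auto simp: ring_hom_def)
  show "carrier Bsum \<subseteq> char_hom ` carrier A"
  proof
    fix b assume b: "b \<in> carrier Bsum"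
    obtain Q where Q: "\<forall>p\<in>types. delta_at p (comb Q) = lookup (b (fst p)) (snd p)"
      using comb_surj[of "\<lambda>p. lookup (b (fst p)) (snd p)"] by blast
    have "b H = coeffs_at H (comb Q)" if H: "subgroup H G" for H
    proof (rule poly_mapping_eqI)
      fix z
      have "b H \<in> carrier (monoid_algebra (Ab H))" using b H by (auto simp: product_ring_def)
      then show "lookup (b H) z = lookup (coeffs_at H (comb Q)) z"
        using Q H by (auto simp: lookup_coeffs_at in_keys_iff)
    qed
    moreover have "b \<in> extensional {H. subgroup H G}" using b by (simp add: product_ring_def PiE_def)
    ultimately have "b = char_hom (comb Q)"
      unfolding char_hom_def by (intro extensionalityI[of _ "{H. subgroup H G}"]) auto
    then show "b \<in> char_hom ` carrier A" using comb_carrier by blast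
  qed
qed

lemma char_hom_kernel: "a_kernel A Bsum char_hom = jacobson_radical A"
proof -
  have "x \<in> a_kernel A Bsum char_hom \<longleftrightarrow> x \<in> jacobson_radical A" for x
  proof -
    have "x \<in> a_kernel A Bsum char_hom \<longleftrightarrow> x \<in> carrier A \<and> char_hom x = char_hom \<zero>\<^bsub>A\<^esub>"
      unfolding a_kernel_def' ring_hom_zero[OF char_hom_ring_hom TA.T.ring_axioms Bsum_ring] by simp
    also have "\<dots> \<longleftrightarrow> x \<in> carrier A \<and> (\<forall>p\<in>types. delta_at p x = 0)"
    proof -
      have "delta_at p \<zero>\<^bsub>A\<^esub> = 0" if "p \<in> types" for p
        by (rule delta_zero[OF types_subset[OF that]])
      then show ?thesis unfolding char_hom_eq_iff by simp
    qed
    also have "\<dots> \<longleftrightarrow> x \<in> jacobson_radical A"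
    proof
      show "x \<in> carrier A \<and> (\<forall>p\<in>types. delta_at p x = 0)" if "x \<in> jacobson_radical A"
        using that radical_delta_zero[OF that] by (auto simp: jacobson_radical_def)
    qed (use delta_zero_radical in blast)
    finally show ?thesis .
  qed
  then show ?thesis by blast
qed

subsection \<open>The algebra structures\<close>

lemma coeffs_at_zero: "subgroup H G \<Longrightarrow> coeffs_at H \<zero>\<^bsub>A\<^esub> = 0"
  by (rule poly_mapping_eqI) (simp add: lookup_coeffs_at delta_zero[OF subgroup.subset])

lemma coeffs_at_finsum:
  assumes "subgroup H G" "finite F" "f \<in> F \<rightarrow> carrier A"
  shows "coeffs_at H (\<Oplus>\<^bsub>A\<^esub> p\<in>F. f p) = (\<Sum>p\<in>F. coeffs_at H (f p))"
  using assms(2,3)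
proof (induction F)
  case empty then show ?case using coeffs_at_zero[OF assms(1)] by simp
next
  case (insert p F)
  then have "f \<in> F \<rightarrow> carrier A" "f p \<in> carrier A" by auto
  then show ?case using insert TA.T.finsum_insert[of F p f] TA.T.finsum_closed[of f F]
    by (simp add: coeffs_at_add[OF assms(1)])
qed

lemma subgroup_carrier: "subgroup (carrier G) G" by (rule subgroup_self)

lemma Ab_carrier: "Ab (carrier G) = abelianization G"
  by (simp add: abelianization_def)

lemma T_hom: "z \<in> carrier (abelianization G) \<Longrightarrow> T (carrier G) z \<in> hom G mult_group_of_field"
  using T_carrier[OF subgroup_carrier, of z] by (simp add: Ab_carrier linear_characters_def hom_def)

lemma coeffs_at_character:
  assumes H: "subgroup H G" and z: "z \<in> carrier (abelianization G)"
  shows "coeffs_at H (gl q (character_glider (T (carrier G) z))) = single (restricted_element G T H z) q"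
proof -
  note c = character_glider_pointed[OF T_hom[OF z]]
  have HS: "H \<subseteq> line_stab G (character_glider (T (carrier G) z) :: ('a, nat \<Rightarrow>\<^sub>0 'k) glider) (single 0 1)"
    unfolding c(2) using subgroup.subset[OF H] .
  have w: "restrict (line_char (character_glider (T (carrier G) z) :: ('a, nat \<Rightarrow>\<^sub>0 'k) glider) (single 0 1)) H =
      restrict (T (carrier G) z) H"
    by (rule restrict_ext) (rule c(3))
  have "restrict (T (carrier G) z) H \<in> T H ` Ab_elems H"
    using weight_index[OF c(1) H HS] unfolding w by (metis image_eqI)
  then have "restricted_element G T H z \<in> Ab_elems H" "T H (restricted_element G T H z) = restrict (T (carrier G) z) H"
    unfolding restricted_element_def by (rule inv_into_into, rule f_inv_into_f)
  then show ?thesis using coeffs_at_gl[OF c(1) H _ HS] w by simp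
qed

lemma structure_map:
  assumes x: "x \<in> carrier (monoid_algebra (abelianization G))"
  shows "glider_structure_map G T x \<in> carrier A"
    and "char_hom (glider_structure_map G T x) = (\<lambda>H\<in>{H. subgroup H G}. \<Sum>z\<in>keys x.
          single (restricted_element G T H z) (lookup x z))"
proof -
  have k: "z \<in> carrier (abelianization G)" if "z \<in> keys x" for z using x that by auto
  let ?f = "\<lambda>z. gl (lookup x z) (character_glider (T (carrier G) z))"
  have f: "?f \<in> keys x \<rightarrow> carrier A"
    using gl_carrier[OF character_glider_pointed(1)[OF T_hom[OF k]]] by blast
  have e: "glider_structure_map G T x = (\<Oplus>\<^bsub>A\<^esub> z\<in>keys x. ?f z)"
    by (simp add: glider_structure_map_def rational_glider_ring_def)
  show "glider_structure_map G T x \<in> carrier A" unfolding e by (rule TA.T.finsum_closed[OF f])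
  have "coeffs_at H (glider_structure_map G T x) = (\<Sum>z\<in>keys x. single (restricted_element G T H z) (lookup x z))"
    if H: "subgroup H G" for H
    unfolding e coeffs_at_finsum[OF H finite_keys f] by (intro sum.cong refl coeffs_at_character[OF H k])
  then show "char_hom (glider_structure_map G T x) = (\<lambda>H\<in>{H. subgroup H G}. \<Sum>z\<in>keys x.
          single (restricted_element G T H z) (lookup x z))"
    unfolding char_hom_def by (intro restrict_ext) simp
qed

lemma algebra_iso_exists:
  "\<exists>\<phi>. \<phi> \<in> algebra_iso (monoid_algebra (abelianization G))
    (glider_algebra_mod_radical G T) (subgroup_algebra_sum G T)"
proof -
  define J where "J = jacobson_radical A"
  define \<phi> where "\<phi> = (\<lambda>C. the_elem (char_hom ` C))"
  have iso: "\<phi> \<in> ring_iso (A Quot J) Bsum"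
    using ring_hom_ring.FactRing_iso_set[OF char_hom_ring_hom_ring char_hom_surj] unfolding char_hom_kernel J_def \<phi>_def .
  have \<phi>_coset: "\<phi> (J +>\<^bsub>A\<^esub> x) = char_hom x" if "x \<in> carrier A" for x
    using ring_hom_ring.the_elem_simp[OF char_hom_ring_hom_ring that] unfolding char_hom_kernel J_def \<phi>_def .
  have "\<phi> ((J +>\<^bsub>A\<^esub> glider_structure_map G T r) \<otimes>\<^bsub>A Quot J\<^esub> a) =
      (\<lambda>H\<in>{H. subgroup H G}. \<Sum>z\<in>keys r. single (restricted_element G T H z) (lookup r z)) \<otimes>\<^bsub>Bsum\<^esub> \<phi> a"
    if r: "r \<in> carrier (monoid_algebra (abelianization G))" and a: "a \<in> carrier (A Quot J)" for r a
  proof -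
    note s = structure_map[OF r]
    have "J +>\<^bsub>A\<^esub> glider_structure_map G T r \<in> carrier (A Quot J)"
      using s(1) by (auto simp: FactRing_def A_RCOSETS_def' a_r_coset_def')
    then show ?thesis
      using iso a \<phi>_coset[OF s(1)] s(2) by (simp add: ring_iso_def ring_hom_def)
  qed
  then have "\<phi> \<in> algebra_iso (monoid_algebra (abelianization G))
      (glider_algebra_mod_radical G T) (subgroup_algebra_sum G T)"
    using iso
    by (simp add: algebra_iso_def glider_algebra_mod_radical_def subgroup_algebra_sum_def algebra_along_def
        rational_glider_ring_def Let_def J_def ring_iso_def ring_hom_def del: monoid_algebra_simps)
  then show ?thesis by blast
qed

end

theorem theorem4:
  fixes G :: "('g, 'm) monoid_scheme"
    and T :: "'g set \<Rightarrow> 'g set \<Rightarrow> 'g \<Rightarrow> 'k::{alg_closed_field, field_char_0}"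
  assumes "group G" and "finite (carrier G)" and "nilpotent_of_class G 2"
    and "\<And>H. subgroup H G \<Longrightarrow>
      T H \<in> iso (abelianization (G\<lparr>carrier := H\<rparr>)) (linear_characters (G\<lparr>carrier := H\<rparr>))"
  shows "\<exists>\<phi>. \<phi> \<in> algebra_iso (monoid_algebra (abelianization G))
    (glider_algebra_mod_radical G T) (subgroup_algebra_sum G T)"
proof -
  interpret group G by (rule assms(1))
  interpret glider_setting G T
    by (intro glider_setting.intro glider_rings.intro finite_group.intro finite_group_axioms.intro
        glider_setting_axioms.intro assms(1,2,4))
  show ?thesis by (rule algebra_iso_exists)
qed

end
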